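(* Let $n$ be a positive integer and $r$ a non-negative integer. The number of Sundaram tableaux (on the alphabet $1<\bar1<2<\bar2<\cdots<n<\bar n<\infty$) of height at most $n$ and width at most $r$ is $$\prod_{i=1}^n\frac{2i+r-1}{2i-1}\prod_{i,j=1}^n\frac{i+j+r-1}{i+j-1}.$$ Moreover, with both sums running over all Sundaram tableaux $T$ of height at most $n$ and width at most $r$, $$\sum_T(-1)^{|T|}=(-1)^{rn}\prod_{i,j=1}^n\frac{i+j+r-1}{i+j-1},\qquad \sum_T(-1)^{m_\infty(T)}=\prod_{i,j=1}^n\frac{i+j+r-1}{i+j-1}.$$
   Context: A Sundaram tableau is a filling of the Young diagram of a partition with letters from $1<\bar1<2<\bar2<\cdots<n<\bar n<\infty$ that is semi-standard (weakly increasing along rows, strictly increasing down columns), such that all entries in row $k$ are at least $k$ in this order, with the exceptional rule that the letter $\infty$ may occur multiple times in each column but at most once in each row. The empty tableau is included. The height is the number of rows, the width is the number of columns (length of the first row), $|T|$ is the number of squares of $T$, and $m_\infty(T)$ is the number of occurrences of $\infty$ in $T$. *)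

theory Defs
  imports Complex_Main
begin

datatype letter = Unbarred nat | Barred nat | Infty

instantiation letter :: linorder
begin

fun less_letter :: "letter \<Rightarrow> letter \<Rightarrow> bool" where
  "Unbarred i < Unbarred j \<longleftrightarrow> i < j"
| "Unbarred i < Barred j \<longleftrightarrow> i \<le> j"
| "Barred i < Unbarred j \<longleftrightarrow> i < j"
| "Barred i < Barred j \<longleftrightarrow> i < j"
| "Unbarred _ < Infty \<longleftrightarrow> True"
| "Barred _ < Infty \<longleftrightarrow> True"
| "Infty < _ \<longleftrightarrow> False"

definition less_eq_letter :: "letter \<Rightarrow> letter \<Rightarrow> bool" where
  "x \<le> y \<longleftrightarrow> x < y \<or> x = (y :: letter)"

instance
proof
  fix x y z :: letter
  show "(x < y) = (x \<le> y \<and> \<not> y \<le> x)"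
    by (cases x; cases y; auto simp: less_eq_letter_def)
  show "x \<le> x"
    by (simp add: less_eq_letter_def)
  show "x \<le> z" if "x \<le> y" "y \<le> z"
    using that by (cases x; cases y; cases z; auto simp: less_eq_letter_def)
  show "x = y" if "x \<le> y" "y \<le> x"
    using that by (cases x; cases y; auto simp: less_eq_letter_def)
  show "x \<le> y \<or> y \<le> x"
    by (cases x; cases y; auto simp: less_eq_letter_def)
qed

end

definition alphabet :: "nat \<Rightarrow> letter set" where
  "alphabet n = Unbarred ` {1..n} \<union> Barred ` {1..n} \<union> {Infty}"

text \<open>
  A filling of a Young diagram is the list of its rows from top to bottom (English convention).
  Requiring the rows to be nonempty makes the representation unique, so that each tableau is
  counted once; the empty tableau is the empty list.
\<close>

type_synonym filling = "letter list list"

definition young_shape :: "filling \<Rightarrow> bool" where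
  "young_shape T \<longleftrightarrow> [] \<notin> set T \<and> sorted_wrt (\<ge>) (map length T)"

definition height :: "filling \<Rightarrow> nat" where
  "height T = length T"

definition width :: "filling \<Rightarrow> nat" where
  "width T = (if T = [] then 0 else length (hd T))"

definition num_squares :: "filling \<Rightarrow> nat" where
  "num_squares T = sum_list (map length T)"

definition m_infty :: "filling \<Rightarrow> nat" where
  "m_infty T = count_list (concat T) Infty"

text \<open>
  Rows are indexed from 0 here, so the lower bound for the entries of the row \<open>T ! i\<close> is the
  letter \<open>Unbarred (Suc i)\<close>.
\<close>

definition sundaram_tableau :: "nat \<Rightarrow> filling \<Rightarrow> bool" where
  "sundaram_tableau n T \<longleftrightarrow>
     young_shape T \<and>
     (\<forall>row \<in> set T. set row \<subseteq> alphabet n) \<and>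
     (\<forall>row \<in> set T. sorted row \<and> count_list row Infty \<le> 1) \<and>
     (\<forall>i j. Suc i < length T \<and> j < length (T ! Suc i) \<longrightarrow>
        T ! i ! j < T ! Suc i ! j \<or> (T ! i ! j = Infty \<and> T ! Suc i ! j = Infty)) \<and>
     (\<forall>i < length T. \<forall>x \<in> set (T ! i). Unbarred (Suc i) \<le> x)"

definition sundaram_tableaux :: "nat \<Rightarrow> nat \<Rightarrow> nat \<Rightarrow> filling set" where
  "sundaram_tableaux n h w = {T. sundaram_tableau n T \<and> height T \<le> h \<and> width T \<le> w}"

end

theory Submission
  imports Defs "Jordan_Normal_Form.Determinant"
begin

text \<open>
  Rows, and the entries of sequences such as \<open>\<rho>\<close>, are numbered \<open>0, \<dots>, n - 1\<close> below.

  Deleting the letters \<open>\<infinity>\<close> from a Sundaram tableau of shape \<open>\<nu>\<close> leaves a tableau in the letters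
  \<open>1, \<dots>, n\<close> with and without bar, of a shape \<open>\<mu>\<close> such that \<open>\<nu> - \<mu>\<close> is a vertical strip.  Removing the
  largest letter again and again counts these symplectic tableaux by an iterated sum over interlacing
  partitions.  Such a sum lets every row of a determinant run through an interval of its own, so it
  can be carried out inside the determinant: up to a sign, the number is the determinant of the
  binomials \<open>p\<^sub>j(l\<^sub>i)\<close>, where \<open>p\<^sub>j(l) = (l + j choose 2 j + 1)\<close> and \<open>l\<^sub>i = \<mu>\<^sub>i + n - i\<close>
  (\<open>card_fillings_symplectic\<close>).  Putting the vertical strip back with weight \<open>t\<close> for each \<open>\<infinity>\<close> turns
  \<open>p\<^sub>j(l)\<close> into \<open>p\<^sub>j(l) + t p\<^sub>j(l - 1)\<close>.  This is a polynomial in \<open>y = l - 1/2\<close> that is odd for \<open>t = 1\<close>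
  and even for \<open>t = -1\<close>.  Hence, with \<open>e = 1\<close> or \<open>e = 0\<close> respectively, the weighted number of tableaux of
  shape \<open>\<nu>\<close> is \<open>V\<^sub>e(\<nu> + \<rho>) / V\<^sub>e(\<rho>)\<close>, where \<open>\<rho>\<^sub>i = n - i - 1/2\<close> and \<open>V\<^sub>e(y)\<close> is the product of all \<open>y\<^sub>i\<^sup>e\<close> and
  of all \<open>y\<^sub>j\<^sup>2 - y\<^sub>i\<^sup>2\<close> with \<open>i < j\<close> (\<open>sum_vertical_strips_card\<close>).

  It remains to sum \<open>V\<^sub>e(\<nu> + \<rho>)\<close> over all \<open>\<nu>\<close> in the \<open>n \<times> r\<close> rectangle.  Let \<open>\<delta>\<^sub>i = n - 1 - i\<close>.  For an alternating function
  \<open>F\<close>, the value \<open>F(\<nu> + \<delta>)\<close> equals the sum of \<open>F(w + \<delta>)\<close> over the weights \<open>w\<close> of all Gelfand-Tsetlin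
  patterns with top row \<open>\<nu>\<close>, i.e. of all semistandard tableaux of shape \<open>\<nu>\<close>
  (\<open>pattern_sum_alternating\<close>).  Taken over the whole rectangle, the multiset of weights is invariant
  under permutations and under each reflection \<open>w\<^sub>i \<mapsto> r - w\<^sub>i\<close>.  Since \<open>V\<^sub>e\<close> has the least degree among the
  polynomials with its behaviour under signed permutations, averaging over such a multiset only
  multiplies it by a constant: the sum of \<open>V\<^sub>e(z + w - r/2)\<close> over all weights is \<open>A V\<^sub>e(z)\<close>, where \<open>A\<close> is the number of
  patterns (\<open>bounded_sum_parity_alternant\<close>).  For \<open>z = \<rho> + r/2\<close> this shows that the required sum is
  \<open>A V\<^sub>e(\<rho> + r/2)\<close>.  For \<open>e = 1\<close> and \<open>z = \<rho>\<close> the corresponding sum over \<open>\<nu>\<close> collapses to one term by a sign-reversing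
  involution (\<open>sum_partitions_odd_alternant\<close>), which gives \<open>A = V\<^sub>1(\<rho> + r/2) / V\<^sub>1(\<rho>)\<close>.  So the sum of
  the weights is
  \<open>(V\<^sub>1(\<rho> + r/2) / V\<^sub>1(\<rho>)) (V\<^sub>e(\<rho> + r/2) / V\<^sub>e(\<rho>))\<close>, and the factors of the two quotients are
  those of the asserted products.

  The sum of \<open>(-1)\<close> to the number of squares is reduced to the sum of \<open>(-1)\<close> to the number of \<open>\<infinity>\<close> by
  an involution that inserts or deletes a single \<open>\<infinity>\<close>; it is defined wherever the two signs do
  not agree up to the factor \<open>(-1)\<^bsup>rn\<^esup>\<close> (\<open>sum_neg_one_power_strips\<close>).
\<close>

section \<open>Boxes, determinants and alternants\<close>

text \<open>
  Sequences with finitely many nonzero entries are total functions that vanish from \<open>n\<close> on.  In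
  contrast to extensional functions, partitions of different lengths then live in the same type
  and the part after the last one is the \<open>0\<close> that interlacing conditions need.
\<close>

definition box :: "nat \<Rightarrow> (nat \<Rightarrow> nat) \<Rightarrow> (nat \<Rightarrow> nat) \<Rightarrow> (nat \<Rightarrow> nat) set" where
  "box n lo hi = {f. (\<forall>i<n. lo i \<le> f i \<and> f i \<le> hi i) \<and> (\<forall>i\<ge>n. f i = 0)}"

lemma bij_betw_box_PiE:
  "bij_betw (\<lambda>f. restrict f {..<n}) (box n lo hi) (PiE {..<n} (\<lambda>i. {lo i..hi i}))"
  by (rule bij_betw_byWitness[where f' = "\<lambda>f i. if i < n then f i else 0"])
     (auto simp: box_def PiE_def extensional_def fun_eq_iff restrict_def Pi_def)

lemma finite_box [simp, intro]: "finite (box n lo hi)"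
  using bij_betw_finite[OF bij_betw_box_PiE] by (simp add: finite_PiE)

lemma prod_sum_box:
  fixes g :: "nat \<Rightarrow> nat \<Rightarrow> real"
  shows "(\<Prod>i<n. \<Sum>x=lo i..hi i. g i x) = (\<Sum>f\<in>box n lo hi. \<Prod>i<n. g i (f i))"
proof -
  have "(\<Prod>i<n. \<Sum>x=lo i..hi i. g i x) = (\<Sum>f\<in>PiE {..<n} (\<lambda>i. {lo i..hi i}). \<Prod>i<n. g i (f i))"
    by (rule prod_sum_PiE) auto
  also have "\<dots> = (\<Sum>f\<in>box n lo hi. \<Prod>i<n. g i (restrict f {..<n} i))"
    by (rule sum.reindex_bij_betw[OF bij_betw_box_PiE, symmetric])
  finally show ?thesis by simp
qed

lemma det_mat_Leibniz:
  fixes a :: "nat \<Rightarrow> nat \<Rightarrow> real"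
  shows "det (mat n n (\<lambda>(i,j). a i j)) =
    (\<Sum>p | p permutes {..<n}. of_int (sign p) * (\<Prod>i<n. a i (p i)))"
proof -
  have "det (mat n n (\<lambda>(i,j). a i j)) =
    (\<Sum>p | p permutes {..<n}. of_int (sign p) * (\<Prod>i<n. mat n n (\<lambda>(i,j). a i j) $$ (i, p i)))"
    unfolding lessThan_atLeast0 by (rule det_def') simp
  also have "\<dots> = (\<Sum>p | p permutes {..<n}. of_int (sign p) * (\<Prod>i<n. a i (p i)))"
  proof (rule sum.cong[OF refl])
    fix p assume "p \<in> {p. p permutes {..<n}}"
    then have "p i < n" if "i < n" for i
      using that permutes_in_image[of p "{..<n}" i] by simp
    then have "(\<Prod>i<n. mat n n (\<lambda>(i,j). a i j) $$ (i, p i)) = (\<Prod>i<n. a i (p i))"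
      by (intro prod.cong) simp_all
    then show "of_int (sign p) * (\<Prod>i<n. mat n n (\<lambda>(i,j). a i j) $$ (i, p i)) =
               of_int (sign p) * (\<Prod>i<n. a i (p i))" by simp
  qed
  finally show ?thesis .
qed

text \<open>
  Summing over one independent variable per row is the same as summing each row separately.  This
  multilinearity is what evaluates all branching sums.
\<close>

lemma det_sum_rows:
  fixes g :: "nat \<Rightarrow> nat \<Rightarrow> nat \<Rightarrow> real"
  shows "(\<Sum>f\<in>box n lo hi. det (mat n n (\<lambda>(i,j). g i j (f i)))) =
         det (mat n n (\<lambda>(i,j). \<Sum>x=lo i..hi i. g i j x))"
  unfolding det_mat_Leibniz prod_sum_box sum_distrib_left by (rule sum.swap)

lemma det_scale_rows:
  fixes a :: "nat \<Rightarrow> nat \<Rightarrow> real"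
  shows "det (mat n n (\<lambda>(i,j). r i * a i j)) = (\<Prod>i<n. r i) * det (mat n n (\<lambda>(i,j). a i j))"
  unfolding det_mat_Leibniz prod.distrib sum_distrib_left by (simp add: mult_ac)

lemma mat_mult_entries:
  fixes a b :: "nat \<Rightarrow> nat \<Rightarrow> real"
  shows "mat n n (\<lambda>(i,j). a i j) * mat n n (\<lambda>(i,j). b i j) = mat n n (\<lambda>(i,j). \<Sum>k<n. a i k * b k j)"
  by (rule eq_matI) (auto simp: scalar_prod_def lessThan_atLeast0)

lemma det_upper_triangular_entries:
  fixes a :: "nat \<Rightarrow> nat \<Rightarrow> real"
  assumes "\<And>i j. j < i \<Longrightarrow> i < n \<Longrightarrow> a i j = 0"
  shows "det (mat n n (\<lambda>(i,j). a i j)) = (\<Prod>i<n. a i i)"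
proof -
  have "det (mat n n (\<lambda>(i,j). a i j)) = prod_list (diag_mat (mat n n (\<lambda>(i,j). a i j)))"
    by (rule det_upper_triangular) (auto simp: upper_triangular_def assms)
  also have "\<dots> = (\<Prod>i<n. a i i)"
    by (simp add: prod_list_diag_prod lessThan_atLeast0)
  finally show ?thesis .
qed

lemma det_lower_triangular_entries:
  fixes a :: "nat \<Rightarrow> nat \<Rightarrow> real"
  assumes "\<And>i j. i < j \<Longrightarrow> j < n \<Longrightarrow> a i j = 0"
  shows "det (mat n n (\<lambda>(i,j). a i j)) = (\<Prod>i<n. a i i)"
proof -
  have "det (mat n n (\<lambda>(i,j). a i j)) = prod_list (diag_mat (mat n n (\<lambda>(i,j). a i j)))"
    by (rule det_lower_triangular[of n]) (auto simp: assms)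
  also have "\<dots> = (\<Prod>i<n. a i i)"
    by (simp add: prod_list_diag_prod lessThan_atLeast0)
  finally show ?thesis .
qed

text \<open>
  Interlacing sums telescope and leave differences of consecutive rows; these do not change the
  determinant, since they come from multiplication by a unitriangular matrix.
\<close>

lemma det_row_differences:
  fixes a :: "nat \<Rightarrow> nat \<Rightarrow> real"
  shows "det (mat n n (\<lambda>(i,j). a i j - (if Suc i < n then a (Suc i) j else 0))) =
         det (mat n n (\<lambda>(i,j). a i j))"
proof -
  let ?u = "\<lambda>i k. if k = i then 1 else if k = Suc i then -1 else (0 :: real)"
  have "(\<Sum>k<n. ?u i k * a k j) = a i j - (if Suc i < n then a (Suc i) j else 0)"
    if "i < n" for i j
  proof -
    have "(\<Sum>k<n. ?u i k * a k j) =
          (\<Sum>k<n. (if k = i then a i j else 0) + (if k = Suc i then - a (Suc i) j else 0))"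
      by (rule sum.cong) auto
    also have "\<dots> = a i j - (if Suc i < n then a (Suc i) j else 0)"
      using that by (simp add: sum.distrib sum.delta)
    finally show ?thesis .
  qed
  then have "mat n n (\<lambda>(i,j). a i j - (if Suc i < n then a (Suc i) j else 0)) =
        mat n n (\<lambda>(i,j). ?u i j) * mat n n (\<lambda>(i,j). a i j)"
    unfolding mat_mult_entries by (intro eq_matI) auto
  moreover have "det (mat n n (\<lambda>(i,j). ?u i j)) = 1"
    by (subst det_upper_triangular_entries) auto
  ultimately show ?thesis
    by (simp add: det_mult[of _ n])
qed

text \<open>
  The generalized Vandermonde determinant of the functions \<open>\<phi> 0, \<phi> 1, \<dots>\<close> at the points \<open>y 0, y 1, \<dots>\<close>.
\<close>

definition alternant :: "nat \<Rightarrow> (nat \<Rightarrow> 'a \<Rightarrow> real) \<Rightarrow> (nat \<Rightarrow> 'a) \<Rightarrow> real" where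
  "alternant n \<phi> y = det (mat n n (\<lambda>(i,j). \<phi> j (y i)))"

lemma alternant_Leibniz:
  "alternant n \<phi> y = (\<Sum>p | p permutes {..<n}. of_int (sign p) * (\<Prod>i<n. \<phi> (p i) (y i)))"
  unfolding alternant_def det_mat_Leibniz ..

lemma alternant_cong:
  assumes "\<And>i j. i < n \<Longrightarrow> j < n \<Longrightarrow> \<phi> j (y i) = \<phi>' j (y' i)"
  shows "alternant n \<phi> y = alternant n \<phi>' y'"
  unfolding alternant_def by (rule arg_cong[where f = det], rule cong_mat) (auto simp: assms)

lemma alternant_permute:
  assumes "p permutes {..<n}"
  shows "alternant n \<phi> (y \<circ> p) = of_int (sign p) * alternant n \<phi> y"
proof -
  have "mat n n (\<lambda>(i,j). \<phi> j ((y \<circ> p) i)) = mat n n (\<lambda>(i,j). mat n n (\<lambda>(i,j). \<phi> j (y i)) $$ (p i, j))"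
    using permutes_in_image[OF assms] by (intro eq_matI) auto
  then show ?thesis unfolding alternant_def
    using det_permute_rows[of "mat n n (\<lambda>(i,j). \<phi> j (y i))" n p] assms
    by (simp add: lessThan_atLeast0)
qed

lemma alternant_eq_rows:
  assumes "a < n" "b < n" "a \<noteq> b" "\<And>j. j < n \<Longrightarrow> \<phi> j (y a) = \<phi> j (y b)"
  shows "alternant n \<phi> y = 0"
  unfolding alternant_def
  by (rule det_identical_rows[of _ n a b]) (use assms in \<open>auto simp: row_def\<close>)

lemma alternant_zero_row:
  assumes "a < n" "\<And>j. j < n \<Longrightarrow> \<phi> j (y a) = 0"
  shows "alternant n \<phi> y = 0"
proof -
  have vanish: "(\<Prod>i<n. \<phi> (p i) (y i)) = 0" if "p permutes {..<n}" for p
    using assms permutes_in_image[OF that, of a] by (intro prod_zero) auto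
  show ?thesis unfolding alternant_Leibniz
    by (rule sum.neutral) (metis (no_types, lifting) mem_Collect_eq mult_zero_right vanish)
qed

lemma alternant_eq_columns:
  assumes "a < n" "b < n" "a \<noteq> b" "\<phi> a = \<phi> b"
  shows "alternant n \<phi> y = 0"
proof -
  have "alternant n \<phi> y = det (transpose_mat (mat n n (\<lambda>(i,j). \<phi> j (y i))))"
    unfolding alternant_def by (rule det_transpose[symmetric, of _ n]) simp
  also have "\<dots> = 0"
    by (rule det_identical_rows[of _ n a b]) (use assms in \<open>auto simp: row_def transpose_mat_def\<close>)
  finally show ?thesis .
qed

lemma alternant_triangular_basis_change:
  assumes "\<And>i j. i < n \<Longrightarrow> j < n \<Longrightarrow> \<phi> j (y i) = (\<Sum>k\<le>j. a j k * \<phi>' k (y' i))"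
  shows "alternant n \<phi> y = (\<Prod>j<n. a j j) * alternant n \<phi>' y'"
proof -
  let ?b = "\<lambda>k j. if k \<le> j then a j k else 0"
  have "\<phi> j (y i) = (\<Sum>k<n. \<phi>' k (y' i) * ?b k j)" if "i < n" "j < n" for i j
  proof -
    have "(\<Sum>k<n. \<phi>' k (y' i) * ?b k j) = (\<Sum>k\<le>j. \<phi>' k (y' i) * ?b k j)"
      using that by (intro sum.mono_neutral_right) auto
    then show ?thesis using assms[OF that] by (simp add: mult.commute)
  qed
  then have "mat n n (\<lambda>(i,j). \<phi> j (y i)) =
             mat n n (\<lambda>(i,k). \<phi>' k (y' i)) * mat n n (\<lambda>(k,j). ?b k j)"
    unfolding mat_mult_entries by (intro eq_matI) auto
  moreover have "det (mat n n (\<lambda>(k,j). ?b k j)) = (\<Prod>j<n. a j j)"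
    by (subst det_upper_triangular_entries) auto
  ultimately show ?thesis
    unfolding alternant_def by (simp add: det_mult[of _ n])
qed

text \<open>
  The Newton basis consists of monic polynomials of degrees \<open>0, 1, 2, \<dots>\<close>, so the base change from
  powers is unitriangular.
\<close>

lemma alternant_Newton_eq_powers:
  "alternant n (\<lambda>j x. \<Prod>m<j. (x - c m)) y = alternant n (\<lambda>j x. x ^ j) y"
proof -
  let ?p = "\<lambda>j. \<Prod>m<j. [:- c m, 1:]"
  have deg: "degree (?p j) = j" for j
    by (subst degree_prod_eq_sum_degree) auto
  have lead: "coeff (?p j) j = 1" for j
    using lead_coeff_prod[of "\<lambda>m. [:- c m, 1:]" "{..<j}"] unfolding deg by simp
  have "(\<Prod>m<j. (x - c m)) = (\<Sum>k\<le>j. coeff (?p j) k * x ^ k)" for j x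
  proof -
    have "(\<Prod>m<j. (x - c m)) = poly (?p j) x" by (simp add: poly_prod)
    then show ?thesis by (simp add: poly_altdef deg)
  qed
  then show ?thesis
    by (subst alternant_triangular_basis_change[where a = "\<lambda>j. coeff (?p j)"]) (auto simp: lead)
qed

text \<open>
  As the nodes \<open>c\<close> do not matter, they may be taken to be the points \<open>y\<close>; then the matrix is lower
  triangular.
\<close>

lemma Vandermonde_Newton:
  "alternant n (\<lambda>j x. \<Prod>m<j. (x - c m)) y = (\<Prod>j<n. \<Prod>i<j. (y j - y i))"
proof -
  have "alternant n (\<lambda>j x. \<Prod>m<j. (x - c m)) y = alternant n (\<lambda>j x. \<Prod>m<j. (x - y m)) y"
    by (simp add: alternant_Newton_eq_powers)
  also have "\<dots> = (\<Prod>j<n. \<Prod>i<j. (y j - y i))"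
    unfolding alternant_def by (rule det_lower_triangular_entries) auto
  finally show ?thesis .
qed

text \<open>
  Pulling the factor \<open>x ^ e\<close> out of each row leaves a Vandermonde determinant in the squares.
\<close>

lemma alternant_squares:
  "alternant n (\<lambda>j x. c j * (x ^ e * (\<Prod>m<j. (x\<^sup>2 - d m)))) y =
   (\<Prod>j<n. c j) * ((\<Prod>i<n. y i ^ e) * (\<Prod>j<n. \<Prod>i<j. ((y j)\<^sup>2 - (y i)\<^sup>2)))"
proof -
  have "alternant n (\<lambda>j x. c j * (x ^ e * (\<Prod>m<j. (x\<^sup>2 - d m)))) y =
        (\<Prod>j<n. c j) * alternant n (\<lambda>j x. x ^ e * (\<Prod>m<j. (x\<^sup>2 - d m))) y"
    using alternant_triangular_basis_change[of n "\<lambda>j x. c j * (x ^ e * (\<Prod>m<j. (x\<^sup>2 - d m)))" y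
      "\<lambda>j k. if k = j then c j else 0" "\<lambda>j x. x ^ e * (\<Prod>m<j. (x\<^sup>2 - d m))" y]
    by (simp add: if_distribR if_distrib[of "\<lambda>x. x * _"] cong: if_cong)
  also have "alternant n (\<lambda>j x. x ^ e * (\<Prod>m<j. (x\<^sup>2 - d m))) y =
      (\<Prod>i<n. y i ^ e) * alternant n (\<lambda>j x. \<Prod>m<j. (x - d m)) (\<lambda>i. (y i)\<^sup>2)"
    unfolding alternant_def by (rule det_scale_rows)
  finally show ?thesis by (simp add: Vandermonde_Newton)
qed

text \<open>
  The function \<open>V\<^sub>e\<close> of the introduction.  For \<open>e = 1\<close> it is, up to a constant, the Weyl dimension
  polynomial of type \<open>B\<^sub>n\<close>, for \<open>e = 0\<close> that of type \<open>D\<^sub>n\<close>.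
\<close>

definition parity_alternant :: "nat \<Rightarrow> nat \<Rightarrow> (nat \<Rightarrow> real) \<Rightarrow> real" where
  "parity_alternant n e = alternant n (\<lambda>j x. x ^ (2 * j + e))"

lemma parity_alternant_eq_prod:
  "parity_alternant n e y = (\<Prod>i<n. y i ^ e) * (\<Prod>j<n. \<Prod>i<j. ((y j)\<^sup>2 - (y i)\<^sup>2))"
proof -
  have "parity_alternant n e y =
        alternant n (\<lambda>j x. 1 * (x ^ e * (\<Prod>m<j. (x\<^sup>2 - (\<lambda>_. 0) m)))) y"
    unfolding parity_alternant_def
    by (rule alternant_cong) (simp add: power_add power_mult)
  then show ?thesis unfolding alternant_squares by simp
qed

section \<open>Gelfand-Tsetlin patterns and the symmetry of their weights\<close>

definition partitions :: "nat \<Rightarrow> nat \<Rightarrow> (nat \<Rightarrow> nat) set" where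
  "partitions n r = {\<nu>. (\<forall>i. \<nu> (Suc i) \<le> \<nu> i) \<and> \<nu> 0 \<le> r \<and> (\<forall>i\<ge>n. \<nu> i = 0)}"

text \<open>
  The partitions that interlace with \<open>\<nu>\<close>: the possible rows directly below the row \<open>\<nu>\<close> in a
  Gelfand-Tsetlin pattern.
\<close>

definition below :: "nat \<Rightarrow> (nat \<Rightarrow> nat) \<Rightarrow> (nat \<Rightarrow> nat) set" where
  "below n \<nu> = box n (\<lambda>i. \<nu> (Suc i)) \<nu>"

text \<open>
  The sum of \<open>G w\<close> over all Gelfand-Tsetlin patterns with top row \<open>\<nu>\<close>, where \<open>w k\<close> is the difference of
  the sums of two consecutive rows, i.e. the number of entries \<open>k\<close> in the corresponding
  semistandard tableau.  Only the functional is needed, not the set of patterns.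
\<close>

fun pattern_sum :: "nat \<Rightarrow> (nat \<Rightarrow> nat) \<Rightarrow> ((nat \<Rightarrow> real) \<Rightarrow> real) \<Rightarrow> real" where
  "pattern_sum 0 \<nu> G = G (\<lambda>_. 0)"
| "pattern_sum (Suc n) \<nu> G =
     (\<Sum>\<mu>\<in>below n \<nu>. pattern_sum n \<mu>
        (\<lambda>w. G (w(n := (\<Sum>i\<le>n. real (\<nu> i)) - (\<Sum>i<n. real (\<mu> i))))))"

definition bounded_sum :: "nat \<Rightarrow> nat \<Rightarrow> ((nat \<Rightarrow> real) \<Rightarrow> real) \<Rightarrow> real" where
  "bounded_sum n r G = (\<Sum>\<nu>\<in>partitions n r. pattern_sum n \<nu> G)"

lemma finite_below [simp, intro]: "finite (below n \<nu>)"
  by (simp add: below_def)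

lemma partitions_le: "\<nu> \<in> partitions n r \<Longrightarrow> \<nu> i \<le> r"
  by (induction i) (auto simp: partitions_def intro: le_trans)

lemma partitions_antimono: "\<nu> \<in> partitions n r \<Longrightarrow> i \<le> j \<Longrightarrow> \<nu> j \<le> \<nu> i"
  by (rule lift_Suc_antimono_le) (auto simp: partitions_def)

lemma finite_partitions [simp, intro]: "finite (partitions n r)"
  by (rule finite_subset[OF _ finite_box[of n "\<lambda>_. 0" "\<lambda>_. r"]])
     (auto simp: box_def partitions_le, auto simp: partitions_def)

lemma pattern_sum_sum:
  "pattern_sum n \<nu> (\<lambda>w. \<Sum>x\<in>A. G x w) = (\<Sum>x\<in>A. pattern_sum n \<nu> (G x))"
proof (induction n arbitrary: \<nu> G)
  case (Suc n)
  show ?case by (simp only: pattern_sum.simps Suc sum.swap[of _ A])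
qed simp

lemma pattern_sum_cmult:
  "pattern_sum n \<nu> (\<lambda>w. c * G w) = c * pattern_sum n \<nu> G"
  by (induction n arbitrary: \<nu> G) (simp_all add: sum_distrib_left)

lemma bounded_sum_sum:
  "bounded_sum n r (\<lambda>w. \<Sum>x\<in>A. G x w) = (\<Sum>x\<in>A. bounded_sum n r (G x))"
  unfolding bounded_sum_def pattern_sum_sum by (rule sum.swap)

lemma bounded_sum_cmult:
  "bounded_sum n r (\<lambda>w. c * G w) = c * bounded_sum n r G"
  unfolding bounded_sum_def pattern_sum_cmult by (simp add: sum_distrib_left)

text \<open>
  Reflecting every coordinate in the midpoint of its interval permutes the box.
\<close>

lemma sum_box_reflect:
  fixes H :: "real \<Rightarrow> real"
  shows "(\<Sum>f\<in>box n lo hi. H (\<Sum>i<n. real (f i))) =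
         (\<Sum>f\<in>box n lo hi. H ((\<Sum>i<n. real (lo i) + real (hi i)) - (\<Sum>i<n. real (f i))))"
proof -
  define ref where "ref = (\<lambda>f i. if i < n then lo i + hi i - f i else (0::nat))"
  have ref_in: "ref f \<in> box n lo hi" and ref_ref: "ref (ref f) = f"
    and sum_ref: "(\<Sum>i<n. real (lo i) + real (hi i)) - (\<Sum>i<n. real (ref f i)) = (\<Sum>i<n. real (f i))"
    if "f \<in> box n lo hi" for f
  proof -
    have b: "lo i \<le> f i" "f i \<le> hi i" if "i < n" for i
      using \<open>f \<in> _\<close> that by (auto simp: box_def)
    have z: "f i = 0" if "\<not> i < n" for i
      using \<open>f \<in> _\<close> that by (auto simp: box_def)
    show "ref f \<in> box n lo hi"
      using b by (fastforce simp: ref_def box_def)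
    show "ref (ref f) = f"
    proof
      fix i show "ref (ref f) i = f i"
        using b[of i] z[of i] by (cases "i < n") (simp_all add: ref_def)
    qed
    have "real (ref f i) = real (lo i) + real (hi i) - real (f i)" if "i < n" for i
      using b[OF that] that by (simp add: ref_def of_nat_diff)
    then show "(\<Sum>i<n. real (lo i) + real (hi i)) - (\<Sum>i<n. real (ref f i)) = (\<Sum>i<n. real (f i))"
      by (simp add: sum_subtractf)
  qed
  show ?thesis
    by (rule sum.reindex_bij_witness[where i = ref and j = ref])
       (simp_all add: ref_in ref_ref sum_ref)
qed

text \<open>
  The Bender-Knuth argument: between fixed rows \<open>\<nu>\<close> and \<open>\<kappa>\<close>, the entries of the middle row range over
  independent intervals, and the end points of these intervals add up to the sum of both fixed rows.  So reflection
  in the midpoints exchanges the last two weights.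
\<close>

lemma pattern_sum_swap_last:
  "pattern_sum (Suc (Suc k)) \<nu> (\<lambda>w. G (w \<circ> transpose k (Suc k))) = pattern_sum (Suc (Suc k)) \<nu> G"
proof (cases "\<forall>i\<le>k. \<nu> (Suc i) \<le> \<nu> i")
  case False
  then have "below (Suc k) \<nu> = {}" by (force simp: below_def box_def less_Suc_eq_le)
  then show ?thesis by simp
next
  case True
  define lo where "lo = (\<lambda>\<kappa> i. max (\<nu> (Suc i)) (\<kappa> i :: nat))"
  define hi where "hi = (\<lambda>\<kappa> i. if i = 0 then \<nu> 0 else min (\<nu> i) (\<kappa> (i - 1) :: nat))"
  define K where "K = box k (\<lambda>_. 0) (\<lambda>_. \<nu> 0)"
  let ?s = "\<lambda>n f. \<Sum>i<n. real (f i :: nat)"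
  have mem: "\<mu> \<in> below (Suc k) \<nu> \<and> \<kappa> \<in> below k \<mu> \<longleftrightarrow> \<kappa> \<in> K \<and> \<mu> \<in> box (Suc k) (lo \<kappa>) (hi \<kappa>)"
    for \<mu> \<kappa>
  proof
    assume a: "\<mu> \<in> below (Suc k) \<nu> \<and> \<kappa> \<in> below k \<mu>"
    then have 1: "\<nu> (Suc i) \<le> \<mu> i" "\<mu> i \<le> \<nu> i" if "i \<le> k" for i
      using that by (auto simp: below_def box_def)
    from a have 2: "\<mu> (Suc i) \<le> \<kappa> i" "\<kappa> i \<le> \<mu> i" if "i < k" for i
      using that by (auto simp: below_def box_def)
    from a have 3: "\<mu> i = 0" if "i > k" for i using that by (auto simp: below_def box_def)
    from a have 4: "\<kappa> i = 0" if "i \<ge> k" for i using that by (auto simp: below_def box_def)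
    have 5: "\<nu> i \<le> \<nu> 0" if "i \<le> k" for i
      using that
    proof (induction i)
      case (Suc i)
      then have "\<nu> (Suc i) \<le> \<nu> i" using True by simp
      with Suc show ?case by simp
    qed simp
    have "\<kappa> i \<le> \<nu> 0" if "i < k" for i
      using 2(2)[OF that] 1(2)[of i] 5[of i] that by simp
    then have "\<kappa> \<in> K" using 4 unfolding K_def box_def by simp
    moreover have "\<mu> \<in> box (Suc k) (lo \<kappa>) (hi \<kappa>)"
      unfolding box_def
    proof (intro CollectI conjI allI impI)
      fix i assume "i < Suc k"
      then show "lo \<kappa> i \<le> \<mu> i" using 1[of i] 2[of i] 4[of i] by (cases "i < k") (auto simp: lo_def)
      show "\<mu> i \<le> hi \<kappa> i" using 1[of i] 2[of "i - 1"] \<open>i < Suc k\<close> by (cases i) (auto simp: hi_def)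
    qed (use 3 in auto)
    ultimately show "\<kappa> \<in> K \<and> \<mu> \<in> box (Suc k) (lo \<kappa>) (hi \<kappa>)" ..
  next
    assume a: "\<kappa> \<in> K \<and> \<mu> \<in> box (Suc k) (lo \<kappa>) (hi \<kappa>)"
    then have 1: "lo \<kappa> i \<le> \<mu> i" "\<mu> i \<le> hi \<kappa> i" if "i \<le> k" for i
      using that by (auto simp: box_def)
    from a have 3: "\<mu> i = 0" if "i > k" for i using that by (auto simp: box_def)
    from a have 4: "\<kappa> i = 0" if "i \<ge> k" for i using that by (auto simp: K_def box_def)
    have "\<mu> \<in> below (Suc k) \<nu>" unfolding below_def box_def
    proof (intro CollectI conjI allI impI)
      fix i assume "i < Suc k"
      then show "\<nu> (Suc i) \<le> \<mu> i" "\<mu> i \<le> \<nu> i"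
        using 1[of i] by (auto simp: lo_def hi_def split: if_splits)
    qed (use 3 in auto)
    moreover have "\<kappa> \<in> below k \<mu>" unfolding below_def box_def
    proof (intro CollectI conjI allI impI)
      fix i assume "i < k"
      then show "\<kappa> i \<le> \<mu> i" "\<mu> (Suc i) \<le> \<kappa> i"
        using 1[of i] 1(2)[of "Suc i"] by (auto simp: lo_def hi_def)
    qed (use 4 in auto)
    ultimately show "\<mu> \<in> below (Suc k) \<nu> \<and> \<kappa> \<in> below k \<mu>" ..
  qed
  have swap: "(\<Sum>\<mu>\<in>below (Suc k) \<nu>. \<Sum>\<kappa>\<in>below k \<mu>. f \<mu> \<kappa>) =
              (\<Sum>\<kappa>\<in>K. \<Sum>\<mu>\<in>box (Suc k) (lo \<kappa>) (hi \<kappa>). f \<mu> \<kappa>)" for f :: "_ \<Rightarrow> _ \<Rightarrow> real"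
  proof -
    have "(\<Sum>\<mu>\<in>below (Suc k) \<nu>. \<Sum>\<kappa>\<in>below k \<mu>. f \<mu> \<kappa>) =
          (\<Sum>(\<mu>,\<kappa>)\<in>Sigma (below (Suc k) \<nu>) (below k). f \<mu> \<kappa>)"
      by (simp add: sum.Sigma)
    also have "\<dots> = (\<Sum>(\<kappa>,\<mu>)\<in>Sigma K (\<lambda>\<kappa>. box (Suc k) (lo \<kappa>) (hi \<kappa>)). f \<mu> \<kappa>)"
      by (rule sum.reindex_bij_witness[where i = prod.swap and j = prod.swap]) (auto dest: mem[THEN iffD1, OF conjI] mem[THEN iffD2, OF conjI])
    also have "\<dots> = (\<Sum>\<kappa>\<in>K. \<Sum>\<mu>\<in>box (Suc k) (lo \<kappa>) (hi \<kappa>). f \<mu> \<kappa>)"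
      by (simp add: sum.Sigma K_def)
    finally show ?thesis .
  qed
  \<comment> \<open>Pair the lower end of each interval with the upper end of the next: a maximum and a minimum
    of the same two numbers.\<close>
  have total: "(\<Sum>i<Suc k. real (lo \<kappa> i) + real (hi \<kappa> i)) = ?s (Suc (Suc k)) \<nu> + ?s k \<kappa>"
    if "\<kappa> \<in> K" for \<kappa>
  proof -
    have "(\<Sum>i<Suc k. real (lo \<kappa> i) + real (hi \<kappa> i)) =
          (\<Sum>i<k. real (lo \<kappa> i)) + real (lo \<kappa> k) + (real (hi \<kappa> 0) + (\<Sum>i<k. real (hi \<kappa> (Suc i))))"
      unfolding sum.distrib sum.lessThan_Suc_shift[of "\<lambda>i. real (hi \<kappa> i)"] by simp
    also have "\<dots> = (\<Sum>i<k. real (lo \<kappa> i) + real (hi \<kappa> (Suc i))) + real (\<nu> (Suc k)) + real (\<nu> 0)"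
      using that by (simp add: sum.distrib lo_def hi_def K_def box_def)
    also have "(\<Sum>i<k. real (lo \<kappa> i) + real (hi \<kappa> (Suc i))) = (\<Sum>i<k. real (\<nu> (Suc i)) + real (\<kappa> i))"
      by (rule sum.cong) (auto simp: lo_def hi_def max_def min_def)
    finally show ?thesis
      unfolding sum.lessThan_Suc_shift[of "\<lambda>i. real (\<nu> i)" "Suc k"] by (simp add: sum.distrib)
  qed
  have expand: "pattern_sum (Suc (Suc k)) \<nu> G' =
      (\<Sum>\<kappa>\<in>K. \<Sum>\<mu>\<in>box (Suc k) (lo \<kappa>) (hi \<kappa>). pattern_sum k \<kappa>
         (\<lambda>w. G' (w(k := ?s (Suc k) \<mu> - ?s k \<kappa>, Suc k := ?s (Suc (Suc k)) \<nu> - ?s (Suc k) \<mu>))))" for G'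
    unfolding pattern_sum.simps lessThan_Suc_atMost[symmetric] swap ..
  show ?thesis unfolding expand
  proof (rule sum.cong[OF refl])
    fix \<kappa> assume k: "\<kappa> \<in> K"
    let ?H = "\<lambda>t. pattern_sum k \<kappa> (\<lambda>w. G (w(k := t - ?s k \<kappa>, Suc k := ?s (Suc (Suc k)) \<nu> - t)))"
    have "(\<Sum>\<mu>\<in>box (Suc k) (lo \<kappa>) (hi \<kappa>). ?H (?s (Suc k) \<mu>)) =
      (\<Sum>\<mu>\<in>box (Suc k) (lo \<kappa>) (hi \<kappa>). ?H (?s (Suc (Suc k)) \<nu> + ?s k \<kappa> - ?s (Suc k) \<mu>))"
      unfolding sum_box_reflect[of ?H "Suc k" "lo \<kappa>" "hi \<kappa>"] total[OF k] ..
    moreover have "(w(k := a - b, Suc k := c - a)) \<circ> transpose k (Suc k) =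
        w(k := (c + b - a) - b, Suc k := c - (c + b - a))" for w :: "nat \<Rightarrow> real" and a b c
      by (auto simp: fun_eq_iff transpose_def)
    ultimately show "(\<Sum>\<mu>\<in>box (Suc k) (lo \<kappa>) (hi \<kappa>). pattern_sum k \<kappa>
         (\<lambda>w. G (w(k := ?s (Suc k) \<mu> - ?s k \<kappa>, Suc k := ?s (Suc (Suc k)) \<nu> - ?s (Suc k) \<mu>) \<circ> transpose k (Suc k)))) =
      (\<Sum>\<mu>\<in>box (Suc k) (lo \<kappa>) (hi \<kappa>). pattern_sum k \<kappa>
         (\<lambda>w. G (w(k := ?s (Suc k) \<mu> - ?s k \<kappa>, Suc k := ?s (Suc (Suc k)) \<nu> - ?s (Suc k) \<mu>))))"
      by (simp only:)
  qed
qed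

lemma pattern_sum_swap_adjacent:
  assumes "Suc k < n"
  shows "pattern_sum n \<nu> (\<lambda>w. G (w \<circ> transpose k (Suc k))) = pattern_sum n \<nu> G"
  using assms
proof (induction n arbitrary: \<nu> G)
  case (Suc m)
  show ?case
  proof (cases "Suc k = m")
    case True
    then show ?thesis using pattern_sum_swap_last[of k \<nu> G] by (simp only: True)
  next
    case False
    then have "Suc k < m" using Suc.prems by simp
    have shift: "w(m := t) \<circ> transpose k (Suc k) = (w \<circ> transpose k (Suc k))(m := t)"
      for w :: "nat \<Rightarrow> real" and t
      using \<open>Suc k < m\<close> by (auto simp: fun_eq_iff transpose_def)
    have "pattern_sum m \<mu> (\<lambda>w. G ((w \<circ> transpose k (Suc k))(m := t))) =
          pattern_sum m \<mu> (\<lambda>w. G (w(m := t)))" for \<mu> t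
      by (rule Suc.IH[OF \<open>Suc k < m\<close>])
    then show ?thesis by (simp only: pattern_sum.simps shift)
  qed
qed simp

lemma pattern_sum_swap:
  assumes "a < b" "b < n"
  shows "pattern_sum n \<nu> (\<lambda>w. G (w \<circ> transpose a b)) = pattern_sum n \<nu> G"
  using assms
proof (induction b arbitrary: G)
  case (Suc b)
  show ?case
  proof (cases "a = b")
    case True
    then show ?thesis using pattern_sum_swap_adjacent[of b n \<nu> G] Suc.prems by (simp only:)
  next
    case False
    then have ab: "a < b" "b < n" "Suc b < n" using Suc.prems by auto
    let ?t = "transpose b (Suc b)"
    have "w \<circ> transpose a (Suc b) = ((w \<circ> ?t) \<circ> transpose a b) \<circ> ?t" for w :: "nat \<Rightarrow> real"
      using ab(1) by (auto simp: fun_eq_iff transpose_def)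
    then have "pattern_sum n \<nu> (\<lambda>w. G (w \<circ> transpose a (Suc b))) =
               pattern_sum n \<nu> (\<lambda>w. G (((w \<circ> ?t) \<circ> transpose a b) \<circ> ?t))" by simp
    also have "\<dots> = pattern_sum n \<nu> G"
      using pattern_sum_swap_adjacent[OF ab(3), of \<nu> "\<lambda>w. G ((w \<circ> transpose a b) \<circ> ?t)"]
        Suc.IH[OF ab(1,2), of "\<lambda>w. G (w \<circ> ?t)"] pattern_sum_swap_adjacent[OF ab(3), of \<nu> G]
      by (simp only:)
    finally show ?thesis .
  qed
qed simp

lemma pattern_sum_permute:
  assumes "p permutes {..<n}"
  shows "pattern_sum n \<nu> (\<lambda>w. G (w \<circ> p)) = pattern_sum n \<nu> G"
proof -
  have "\<forall>G. pattern_sum n \<nu> (\<lambda>w. G (w \<circ> p)) = pattern_sum n \<nu> G"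
    using assms
  proof (rule permutes_induct)
    fix a b :: nat and p
    assume ab: "a \<in> {..<n}" "b \<in> {..<n}" "a \<noteq> b"
      and IH: "\<forall>G. pattern_sum n \<nu> (\<lambda>w. G (w \<circ> p)) = pattern_sum n \<nu> G"
    have swap: "pattern_sum n \<nu> (\<lambda>w. G' (w \<circ> transpose a b)) = pattern_sum n \<nu> G'" for G'
      using pattern_sum_swap[of a b n \<nu> G'] pattern_sum_swap[of b a n \<nu> G'] ab
      by (cases a b rule: linorder_cases) (auto simp: transpose_commute)
    show "\<forall>G. pattern_sum n \<nu> (\<lambda>w. G (w \<circ> (transpose a b \<circ> p))) = pattern_sum n \<nu> G"
    proof
      fix G show "pattern_sum n \<nu> (\<lambda>w. G (w \<circ> (transpose a b \<circ> p))) = pattern_sum n \<nu> G"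
        using swap[of "\<lambda>w. G (w \<circ> p)"] IH[rule_format, of G] by (simp only: comp_assoc)
    qed
  qed simp_all
  then show ?thesis ..
qed

lemma bounded_sum_permute:
  "p permutes {..<n} \<Longrightarrow> bounded_sum n r (\<lambda>w. G (w \<circ> p)) = bounded_sum n r G"
  unfolding bounded_sum_def by (simp add: pattern_sum_permute)

text \<open>
  With the second row \<open>\<mu>\<close> fixed, the entries of the top row range over the intervals between
  consecutive parts of \<open>\<mu>\<close>, preceded by \<open>r\<close>; so reflection in the midpoints turns the last weight
  into its difference from \<open>r\<close>.
\<close>

lemma bounded_sum_reflect_last:
  "bounded_sum (Suc m) r (\<lambda>w. G (w(m := real r - w m))) = bounded_sum (Suc m) r G"
proof -
  define hi where "hi = (\<lambda>\<mu> (i::nat). if i = 0 then r else (\<mu> (i - 1) :: nat))"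
  let ?s = "\<lambda>n f. \<Sum>i<n. real (f i :: nat)"
  have mem: "\<nu> \<in> partitions (Suc m) r \<and> \<mu> \<in> below m \<nu> \<longleftrightarrow>
             \<mu> \<in> partitions m r \<and> \<nu> \<in> box (Suc m) \<mu> (hi \<mu>)" for \<mu> \<nu>
  proof
    assume a: "\<nu> \<in> partitions (Suc m) r \<and> \<mu> \<in> below m \<nu>"
    then have 1: "\<nu> (Suc i) \<le> \<mu> i" "\<mu> i \<le> \<nu> i" if "i < m" for i
      using that by (auto simp: below_def box_def)
    from a have 3: "\<mu> i = 0" if "i \<ge> m" for i using that by (auto simp: below_def box_def)
    from a have 4: "\<nu> i = 0" if "i > m" for i using that by (auto simp: partitions_def)
    have 5: "\<nu> i \<le> r" for i using a partitions_le by blast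
    have 6: "\<mu> i \<le> \<nu> i" for i using 1(2)[of i] 3[of i] by (cases "i < m") auto
    have "\<mu> \<in> partitions m r" unfolding partitions_def
    proof (intro CollectI conjI allI impI)
      fix i show "\<mu> (Suc i) \<le> \<mu> i"
        using 1(1)[of i] 6[of "Suc i"] 3[of "Suc i"] by (cases "i < m") auto
      show "\<mu> 0 \<le> r" using 6[of 0] 5[of 0] by simp
    qed (use 3 in auto)
    moreover have "\<nu> \<in> box (Suc m) \<mu> (hi \<mu>)" unfolding box_def
    proof (intro CollectI conjI allI impI)
      fix i assume "i < Suc m"
      then show "\<mu> i \<le> \<nu> i" "\<nu> i \<le> hi \<mu> i"
        using 6[of i] 5[of 0] 1(1)[of "i - 1"] by (cases i; auto simp: hi_def)+
    qed (use 4 in auto)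
    ultimately show "\<mu> \<in> partitions m r \<and> \<nu> \<in> box (Suc m) \<mu> (hi \<mu>)" ..
  next
    assume a: "\<mu> \<in> partitions m r \<and> \<nu> \<in> box (Suc m) \<mu> (hi \<mu>)"
    then have 1: "\<mu> i \<le> \<nu> i" "\<nu> i \<le> hi \<mu> i" if "i \<le> m" for i
      using that by (auto simp: box_def)
    from a have 3: "\<nu> i = 0" if "i > m" for i using that by (auto simp: box_def)
    from a have 4: "\<mu> i = 0" if "i \<ge> m" for i using that by (auto simp: partitions_def)
    have 5: "\<nu> (Suc i) \<le> \<mu> i" if "i < m" for i using 1(2)[of "Suc i"] that by (simp add: hi_def)
    have "\<nu> \<in> partitions (Suc m) r" unfolding partitions_def
    proof (intro CollectI conjI allI impI)
      fix i show "\<nu> (Suc i) \<le> \<nu> i"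
        using 1(1)[of i] 5[of i] 3[of "Suc i"] by (cases "i < m") auto
      show "\<nu> 0 \<le> r" using 1(2)[of 0] by (simp add: hi_def)
    qed (use 3 in auto)
    moreover have "\<mu> \<in> below m \<nu>" using 1(1) 4 5 by (auto simp: below_def box_def)
    ultimately show "\<nu> \<in> partitions (Suc m) r \<and> \<mu> \<in> below m \<nu>" ..
  qed
  have swap: "(\<Sum>\<nu>\<in>partitions (Suc m) r. \<Sum>\<mu>\<in>below m \<nu>. f \<nu> \<mu>) =
              (\<Sum>\<mu>\<in>partitions m r. \<Sum>\<nu>\<in>box (Suc m) \<mu> (hi \<mu>). f \<nu> \<mu>)" for f :: "_ \<Rightarrow> _ \<Rightarrow> real"
  proof -
    have "(\<Sum>\<nu>\<in>partitions (Suc m) r. \<Sum>\<mu>\<in>below m \<nu>. f \<nu> \<mu>) =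
          (\<Sum>(\<nu>,\<mu>)\<in>Sigma (partitions (Suc m) r) (below m). f \<nu> \<mu>)"
      by (simp add: sum.Sigma)
    also have "\<dots> = (\<Sum>(\<mu>,\<nu>)\<in>Sigma (partitions m r) (\<lambda>\<mu>. box (Suc m) \<mu> (hi \<mu>)). f \<nu> \<mu>)"
      by (rule sum.reindex_bij_witness[where i = prod.swap and j = prod.swap]) (auto dest: mem[THEN iffD1, OF conjI] mem[THEN iffD2, OF conjI])
    also have "\<dots> = (\<Sum>\<mu>\<in>partitions m r. \<Sum>\<nu>\<in>box (Suc m) \<mu> (hi \<mu>). f \<nu> \<mu>)"
      by (simp add: sum.Sigma)
    finally show ?thesis .
  qed
  have expand: "bounded_sum (Suc m) r G' =
      (\<Sum>\<mu>\<in>partitions m r. \<Sum>\<nu>\<in>box (Suc m) \<mu> (hi \<mu>). pattern_sum m \<mu>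
         (\<lambda>w. G' (w(m := ?s (Suc m) \<nu> - ?s m \<mu>))))" for G'
    unfolding bounded_sum_def pattern_sum.simps lessThan_Suc_atMost[symmetric] swap ..
  show ?thesis unfolding expand
  proof (rule sum.cong[OF refl])
    fix \<mu> assume mu: "\<mu> \<in> partitions m r"
    then have [simp]: "\<mu> m = 0" by (simp add: partitions_def)
    have "(\<Sum>i<Suc m. real (\<mu> i) + real (hi \<mu> i)) = real r + 2 * ?s m \<mu>"
      unfolding sum.distrib sum.lessThan_Suc_shift[of "\<lambda>i. real (hi \<mu> i)"] by (simp add: hi_def)
    then show "(\<Sum>\<nu>\<in>box (Suc m) \<mu> (hi \<mu>). pattern_sum m \<mu>
         (\<lambda>w. G ((w(m := ?s (Suc m) \<nu> - ?s m \<mu>))(m := real r - (w(m := ?s (Suc m) \<nu> - ?s m \<mu>)) m)))) =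
       (\<Sum>\<nu>\<in>box (Suc m) \<mu> (hi \<mu>). pattern_sum m \<mu> (\<lambda>w. G (w(m := ?s (Suc m) \<nu> - ?s m \<mu>))))"
      using sum_box_reflect[of "\<lambda>t. pattern_sum m \<mu> (\<lambda>w. G (w(m := t - ?s m \<mu>)))" "Suc m" \<mu> "hi \<mu>"]
      by (simp add: algebra_simps)
  qed
qed

lemma bounded_sum_reflect:
  assumes "k < n"
  shows "bounded_sum n r (\<lambda>w. G (w(k := real r - w k))) = bounded_sum n r G"
proof -
  obtain m where m: "n = Suc m" using assms by (cases n) auto
  let ?t = "transpose k m"
  have t: "?t permutes {..<n}" using assms m by (intro permutes_swap_id) auto
  have eq: "(w \<circ> ?t)(k := real r - (w \<circ> ?t) k) = (w(m := real r - w m)) \<circ> ?t" for w :: "nat \<Rightarrow> real"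
    by (auto simp: fun_eq_iff transpose_def)
  have "bounded_sum n r (\<lambda>w. G (w(k := real r - w k))) =
        bounded_sum n r (\<lambda>w. G ((w(m := real r - w m)) \<circ> ?t))"
    unfolding bounded_sum_permute[OF t, of r "\<lambda>w. G (w(k := real r - w k))", symmetric] eq ..
  also have "\<dots> = bounded_sum n r G"
    using bounded_sum_reflect_last[of m r "\<lambda>w. G (w \<circ> ?t)"] bounded_sum_permute[OF t, of r G] m by simp
  finally show ?thesis .
qed

section \<open>Alternating functions summed over pattern weights\<close>

text \<open>
  The first condition replaces a restriction of the argument to \<open>n\<close> coordinates.
\<close>

definition alternating :: "nat \<Rightarrow> ((nat \<Rightarrow> real) \<Rightarrow> real) \<Rightarrow> bool" where
  "alternating n F \<longleftrightarrow> (\<forall>y y'. (\<forall>i<n. y i = y' i) \<longrightarrow> F y = F y') \<and>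
     (\<forall>a<n. \<forall>b<n. a \<noteq> b \<longrightarrow> (\<forall>y. F (y \<circ> transpose a b) = - F y))"

lemma alternatingD:
  assumes "alternating n F"
  shows "(\<And>i. i < n \<Longrightarrow> y i = y' i) \<Longrightarrow> F y = F y'"
    and "a < n \<Longrightarrow> b < n \<Longrightarrow> a \<noteq> b \<Longrightarrow> F (y \<circ> transpose a b) = - F y"
  using assms unfolding alternating_def by blast+

lemma alternating_alternant: "alternating n (alternant n \<phi>)"
  unfolding alternating_def
proof (intro conjI allI impI)
  fix a b and y :: "nat \<Rightarrow> real" assume "a < n" "b < n" "a \<noteq> b"
  then show "alternant n \<phi> (y \<circ> transpose a b) = - alternant n \<phi> y"
    by (subst alternant_permute) (auto simp: sign_swap_id intro: permutes_swap_id)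
qed (auto intro: alternant_cong)

lemma sum_eq_0_if_sign_reversing:
  fixes f :: "'a \<Rightarrow> real"
  assumes "\<And>x. x \<in> S \<Longrightarrow> \<phi> x \<in> S" "\<And>x. x \<in> S \<Longrightarrow> \<phi> (\<phi> x) = x" "\<And>x. x \<in> S \<Longrightarrow> f (\<phi> x) = - f x"
  shows "sum f S = 0"
proof -
  have "sum f S = (\<Sum>x\<in>S. - f x)"
    by (rule sum.reindex_bij_witness[where i = \<phi> and j = \<phi>]) (simp_all add: assms)
  then show ?thesis by (simp add: sum_negf)
qed

text \<open>
  One row of the pattern identity.  Put \<open>l\<^sub>i = \<nu>\<^sub>i + n - i\<close> and \<open>m\<^sub>i = \<mu>\<^sub>i + n - i\<close>; the \<open>m\<^sub>i\<close> run independently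
  through the intervals \<open>(l\<^sub>i\<^sub>+\<^sub>1, l\<^sub>i]\<close>, and the last argument \<open>e\<close> is determined by the requirement that
  \<open>m\<close> and \<open>e\<close> have the same total as \<open>l\<close>.  Unless \<open>e\<close> takes its least value \<open>l\<^sub>n\<close>, it lies in exactly one of
  these intervals, say in the one of \<open>m\<^sub>i\<close>, and exchanging \<open>e\<close> with \<open>m\<^sub>i\<close> changes the sign.  What is left is the
  term with \<open>m = l\<close>.
\<close>

lemma sum_below_alternating:
  assumes F: "alternating (Suc n) F" and dec: "\<And>i. \<nu> (Suc i) \<le> \<nu> i"
  shows "(\<Sum>\<mu>\<in>below n \<nu>. F (\<lambda>i. (if i < n then real (\<mu> i) + real (n - i)
            else (\<Sum>i\<le>n. real (\<nu> i)) - (\<Sum>i<n. real (\<mu> i))) + c)) =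
         F (\<lambda>i. real (\<nu> i) + real (n - i) + c)"
proof -
  define l where "l = (\<lambda>i. \<nu> i + (n - i))"
  define e where "e = (\<lambda>\<mu>. (\<Sum>i\<le>n. \<nu> i) - (\<Sum>i<n. \<mu> i))"
  define m where "m = (\<lambda>\<mu> i. if i < n then \<mu> i + (n - i) else e \<mu>)"
  define G where "G = (\<lambda>\<mu>. F (\<lambda>i. real (m \<mu> i) + c))"
  define idx where "idx = (\<lambda>x. LEAST i. l (Suc i) < x)"
  define \<nu>' where "\<nu>' = (\<lambda>i. if i < n then \<nu> i else 0)"
  define S where "S = {\<mu> \<in> below n \<nu>. \<nu> n < e \<mu>}"
  define \<phi> where "\<phi> = (\<lambda>\<mu>. \<mu>(idx (e \<mu>) := e \<mu> - (n - idx (e \<mu>))))"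
  have inB: "\<nu> (Suc i) \<le> \<mu> i" "\<mu> i \<le> \<nu> i" if "\<mu> \<in> below n \<nu>" "i < n" for \<mu> i
    using that by (auto simp: below_def box_def)
  have sum_le: "(\<Sum>i<n. \<mu> i) \<le> (\<Sum>i<n. \<nu> i)" if "\<mu> \<in> below n \<nu>" for \<mu>
    using inB(2)[OF that] by (intro sum_mono) auto
  have e_sum: "e \<mu> + (\<Sum>i<n. \<mu> i) = (\<Sum>i<n. \<nu> i) + \<nu> n" if "\<mu> \<in> below n \<nu>" for \<mu>
    using sum_le[OF that] unfolding e_def lessThan_Suc_atMost[symmetric] by simp
  have anti: "\<nu> j \<le> \<nu> i" if "i \<le> j" for i j
    by (rule lift_Suc_antimono_le[of \<nu>, OF dec that])
  have anti_l: "l j \<le> l i" if "i \<le> j" for i j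
    unfolding l_def using anti[OF that] that by simp
  have e_le: "e \<mu> \<le> \<nu> 0" if "\<mu> \<in> below n \<nu>" for \<mu>
  proof -
    have "(\<Sum>i<n. \<nu> (Suc i)) \<le> (\<Sum>i<n. \<mu> i)"
      using inB(1)[OF that] by (intro sum_mono) auto
    moreover have "(\<Sum>i<n. \<nu> i) + \<nu> n = \<nu> 0 + (\<Sum>i<n. \<nu> (Suc i))"
      using sum.lessThan_Suc_shift[of \<nu> n] by simp
    ultimately show ?thesis using e_sum[OF that] by linarith
  qed
  have idx_eq: "idx x = i" if "l (Suc i) < x" "x \<le> l i" for x i
    unfolding idx_def
  proof (rule Least_equality)
    fix j assume "l (Suc j) < x"
    then show "i \<le> j" using anti_l[of "Suc j" i] that by (cases "i \<le> j") auto
  qed (use that in simp)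
  \<comment> \<open>The interval that contains the last argument.\<close>
  have idx_ex: "idx (e \<mu>) < n \<and> l (Suc (idx (e \<mu>))) < e \<mu> \<and> e \<mu> \<le> l (idx (e \<mu>))" if "\<mu> \<in> S" for \<mu>
  proof -
    have mu: "\<mu> \<in> below n \<nu>" "\<nu> n < e \<mu>" using that by (auto simp: S_def)
    have n: "n > 0" using mu e_le[OF mu(1)] by (cases n) auto
    then have ex: "l (Suc (n - 1)) < e \<mu>" using mu by (simp add: l_def)
    then have 1: "l (Suc (idx (e \<mu>))) < e \<mu>" unfolding idx_def by (rule LeastI)
    have "idx (e \<mu>) \<le> n - 1" unfolding idx_def by (rule Least_le) (rule ex)
    moreover have "e \<mu> \<le> l (idx (e \<mu>))"
    proof (cases "idx (e \<mu>)")
      case 0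
      then show ?thesis using e_le[OF mu(1)] by (simp add: l_def)
    next
      case (Suc j)
      then have "\<not> l (Suc j) < e \<mu>" using not_less_Least[of j "\<lambda>i. l (Suc i) < e \<mu>"]
        unfolding idx_def by simp
      then show ?thesis using Suc by simp
    qed
    ultimately show ?thesis using 1 n by simp
  qed
  have phi: "\<phi> \<mu> \<in> S \<and> \<phi> (\<phi> \<mu>) = \<mu> \<and> G (\<phi> \<mu>) = - G \<mu>" if "\<mu> \<in> S" for \<mu>
  proof -
    define k where "k = idx (e \<mu>)"
    have k: "k < n" "l (Suc k) < e \<mu>" "e \<mu> \<le> l k" using idx_ex[OF that] by (auto simp: k_def)
    have mu: "\<mu> \<in> below n \<nu>" using that by (auto simp: S_def)
    have phi: "\<phi> \<mu> = \<mu>(k := e \<mu> - (n - k))" by (simp add: \<phi>_def k_def)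
    have ge: "n - k \<le> e \<mu>" using k by (simp add: l_def)
    have m1: "l (Suc k) < m \<mu> k" "m \<mu> k \<le> l k"
      using inB[OF mu k(1)] k(1) by (auto simp: m_def l_def)
    have phi_B: "\<phi> \<mu> \<in> below n \<nu>"
      using mu k unfolding phi below_def box_def by (auto simp: l_def)
    have s1: "(\<Sum>i<n. \<phi> \<mu> i) = (e \<mu> - (n - k)) + sum \<mu> ({..<n} - {k})"
      unfolding phi by (subst sum.remove[of _ k]) (use k in \<open>auto intro!: sum.cong\<close>)
    have s2: "(\<Sum>i<n. \<mu> i) = \<mu> k + sum \<mu> ({..<n} - {k})"
      by (rule sum.remove) (use k in auto)
    have e_phi: "e (\<phi> \<mu>) = m \<mu> k"
      using e_sum[OF mu] e_sum[OF phi_B] s1 s2 ge k(1) unfolding m_def by simp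
    have idx_phi: "idx (e (\<phi> \<mu>)) = k" unfolding e_phi by (rule idx_eq) (use m1 in auto)
    have "\<nu> n \<le> l (Suc k)" using anti_l[of "Suc k" n] k by (simp add: l_def)
    then have "\<phi> \<mu> \<in> S" using phi_B e_phi m1 by (simp add: S_def)
    moreover have "\<phi> (\<phi> \<mu>) = \<mu>"
    proof -
      have "\<phi> (\<phi> \<mu>) = (\<phi> \<mu>)(idx (e (\<phi> \<mu>)) := e (\<phi> \<mu>) - (n - idx (e (\<phi> \<mu>))))"
        by (simp only: \<phi>_def)
      then have "\<phi> (\<phi> \<mu>) = (\<phi> \<mu>)(k := m \<mu> k - (n - k))"
        unfolding idx_phi unfolding e_phi .
      then show ?thesis using k(1) by (simp add: phi m_def)
    qed
    moreover have "G (\<phi> \<mu>) = - G \<mu>"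
    proof -
      have mm: "m (\<phi> \<mu>) i = m \<mu> (transpose k n i)" if "i < Suc n" for i
        using that k ge e_phi by (auto simp: m_def phi transpose_def)
      have "G (\<phi> \<mu>) = F ((\<lambda>i. real (m \<mu> i) + c) \<circ> transpose k n)"
        unfolding G_def by (rule alternatingD(1)[OF F]) (simp add: mm)
      also have "\<dots> = - G \<mu>"
        unfolding G_def by (rule alternatingD(2)[OF F]) (use k in auto)
      finally show ?thesis .
    qed
    ultimately show ?thesis by blast
  qed
  have sum_S: "sum G S = 0"
    by (rule sum_eq_0_if_sign_reversing[where \<phi> = \<phi>]) (use phi in auto)
  have B: "below n \<nu> = insert \<nu>' S" and notin: "\<nu>' \<notin> S"
  proof -
    have \<nu>': "\<nu>' \<in> below n \<nu>" using dec by (auto simp: \<nu>'_def below_def box_def)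
    have e': "e \<nu>' = \<nu> n" using e_sum[OF \<nu>'] by (simp add: \<nu>'_def)
    then show "\<nu>' \<notin> S" by (simp add: S_def)
    have "\<mu> = \<nu>'" if "\<mu> \<in> below n \<nu>" "\<mu> \<notin> S" for \<mu>
    proof -
      have "(\<Sum>i<n. \<nu> i) \<le> (\<Sum>i<n. \<mu> i)" using that e_sum[OF that(1)] by (simp add: S_def)
      then have eq: "(\<Sum>i<n. \<mu> i) = (\<Sum>i<n. \<nu> i)" using sum_le[OF that(1)] by simp
      have small: "\<mu> i = \<nu> i" if "i < n" for i
        by (rule sum_mono_inv[OF eq]) (use inB(2)[OF \<open>\<mu> \<in> below n \<nu>\<close>] that in simp_all)
      have large: "\<mu> i = 0" if "\<not> i < n" for i
        using \<open>\<mu> \<in> below n \<nu>\<close> that by (simp add: below_def box_def)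
      show ?thesis
      proof
        fix i show "\<mu> i = \<nu>' i"
          using small[of i] large[of i] by (cases "i < n") (simp_all add: \<nu>'_def)
      qed
    qed
    moreover have "S \<subseteq> below n \<nu>" unfolding S_def by blast
    ultimately show "below n \<nu> = insert \<nu>' S" using \<nu>' by blast
  qed
  have "finite S" by (rule finite_subset[of _ "below n \<nu>"]) (auto simp: S_def)
  have "sum G (below n \<nu>) = G \<nu>' + sum G S"
    unfolding B by (rule sum.insert[OF \<open>finite S\<close> notin])
  also have "\<dots> = G \<nu>'" by (simp add: sum_S)
  also have "\<dots> = F (\<lambda>i. real (\<nu> i) + real (n - i) + c)"
    unfolding G_def
  proof (rule alternatingD(1)[OF F])
    fix i assume "i < Suc n"
    moreover have "e \<nu>' = \<nu> n"
      unfolding e_def lessThan_Suc_atMost[symmetric] by (simp add: \<nu>'_def)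
    ultimately show "real (m \<nu>' i) + c = real (\<nu> i) + real (n - i) + c"
      by (auto simp: m_def \<nu>'_def less_Suc_eq)
  qed
  finally have "sum G (below n \<nu>) = F (\<lambda>i. real (\<nu> i) + real (n - i) + c)" .
  moreover have "sum G (below n \<nu>) = (\<Sum>\<mu>\<in>below n \<nu>. F (\<lambda>i. (if i < n then real (\<mu> i) + real (n - i)
            else (\<Sum>i\<le>n. real (\<nu> i)) - (\<Sum>i<n. real (\<mu> i))) + c))"
  proof (rule sum.cong[OF refl])
    fix \<mu> assume mu: "\<mu> \<in> below n \<nu>"
    have "real (e \<mu>) = (\<Sum>i\<le>n. real (\<nu> i)) - (\<Sum>i<n. real (\<mu> i))"
      using arg_cong[OF e_sum[OF mu], of real] unfolding lessThan_Suc_atMost[symmetric] by simp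
    then show "G \<mu> = F (\<lambda>i. (if i < n then real (\<mu> i) + real (n - i)
            else (\<Sum>i\<le>n. real (\<nu> i)) - (\<Sum>i<n. real (\<mu> i))) + c)"
      unfolding G_def by (intro alternatingD(1)[OF F]) (simp add: m_def of_nat_diff)
  qed
  ultimately show ?thesis by simp
qed

text \<open>
  In terms of characters: the alternants \<open>a\<^bsub>w + \<delta>\<^esub>\<close>, summed over the weights \<open>w\<close> of a Schur function,
  add up to \<open>a\<^bsub>\<nu> + \<delta>\<^esub>\<close>.
\<close>

lemma pattern_sum_alternating:
  assumes "alternating n F" "\<And>i. \<nu> (Suc i) \<le> \<nu> i"
  shows "pattern_sum n \<nu> (\<lambda>w. F (\<lambda>i. w i + real (n - 1 - i) + c)) =
         F (\<lambda>i. real (\<nu> i) + real (n - 1 - i) + c)"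
  using assms
proof (induction n arbitrary: F \<nu> c)
  case 0
  then show ?case by (auto intro: alternatingD(1))
next
  case (Suc n)
  define e where "e = (\<lambda>\<mu>. (\<Sum>i\<le>n. real (\<nu> i)) - (\<Sum>i<n. real (\<mu> i :: nat)))"
  have "pattern_sum n \<mu> (\<lambda>w. F (\<lambda>i. (w(n := e \<mu>)) i + real (n - i) + c)) =
        F (\<lambda>i. (if i < n then real (\<mu> i) + real (n - i) else e \<mu>) + c)"
    if mu: "\<mu> \<in> below n \<nu>" for \<mu>
  proof -
    \<comment> \<open>With the last coordinate fixed, \<open>F\<close> is alternating in the others, and their offset grows by one.\<close>
    define F1 where "F1 = (\<lambda>y. F (\<lambda>i. if i < n then y i else e \<mu> + c))"
    have F1: "alternating n F1"
      unfolding alternating_def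
    proof (intro conjI allI impI)
      fix y y' :: "nat \<Rightarrow> real" assume "\<forall>i<n. y i = y' i"
      then show "F1 y = F1 y'" unfolding F1_def by (intro alternatingD(1)[OF Suc.prems(1)]) auto
    next
      fix a b and y :: "nat \<Rightarrow> real" assume ab: "a < n" "b < n" "a \<noteq> b"
      then have eq: "(\<lambda>i. if i < n then (y \<circ> transpose a b) i else e \<mu> + c) =
                     (\<lambda>i. if i < n then y i else e \<mu> + c) \<circ> transpose a b"
        by (auto simp: fun_eq_iff transpose_def)
      show "F1 (y \<circ> transpose a b) = - F1 y"
        unfolding F1_def eq by (rule alternatingD(2)[OF Suc.prems(1)]) (use ab in auto)
    qed
    have cong: "F (\<lambda>i. (w(n := e \<mu>)) i + real (n - i) + c) =
                F1 (\<lambda>i. w i + real (n - 1 - i) + (c + 1))" for w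
      unfolding F1_def by (rule alternatingD(1)[OF Suc.prems(1)]) (auto simp: of_nat_diff)
    have dec: "\<mu> (Suc i) \<le> \<mu> i" for i
      using mu Suc.prems(2)[of i] by (cases "Suc i < n") (auto simp: below_def box_def intro: le_trans)
    have "pattern_sum n \<mu> (\<lambda>w. F (\<lambda>i. (w(n := e \<mu>)) i + real (n - i) + c)) =
          F1 (\<lambda>i. real (\<mu> i) + real (n - 1 - i) + (c + 1))"
      unfolding cong by (rule Suc.IH) (rule F1, rule dec)
    also have "\<dots> = F (\<lambda>i. (if i < n then real (\<mu> i) + real (n - i) else e \<mu>) + c)"
      unfolding F1_def by (rule alternatingD(1)[OF Suc.prems(1)]) (auto simp: of_nat_diff)
    finally show ?thesis .
  qed
  then have "pattern_sum (Suc n) \<nu> (\<lambda>w. F (\<lambda>i. w i + real (Suc n - 1 - i) + c)) =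
      (\<Sum>\<mu>\<in>below n \<nu>. F (\<lambda>i. (if i < n then real (\<mu> i) + real (n - i) else e \<mu>) + c))"
    unfolding e_def pattern_sum.simps diff_Suc_1 by (rule sum.cong[OF refl])
  also have "\<dots> = F (\<lambda>i. real (\<nu> i) + real (n - i) + c)"
    unfolding e_def by (rule sum_below_alternating) (rule Suc.prems)+
  finally show ?case by (simp only: diff_Suc_1)
qed

lemma sum_partitions_alternating:
  assumes "alternating n F"
  shows "(\<Sum>\<nu>\<in>partitions n r. F (\<lambda>i. real (\<nu> i) + real (n - 1 - i) + c)) =
         bounded_sum n r (\<lambda>w. F (\<lambda>i. w i + real (n - 1 - i) + c))"
  unfolding bounded_sum_def
  by (rule sum.cong[OF refl], rule pattern_sum_alternating[OF assms, symmetric])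
     (auto simp: partitions_def)

section \<open>Averaging parity alternants over a rectangle\<close>

lemma even_part_power:
  fixes z v :: real
  assumes "e \<le> 1"
  shows "((z + v) ^ (2 * m + e) + (z - v) ^ (2 * m + e)) / 2 =
    (\<Sum>k=0..m. real ((2 * m + e) choose (2 * k + e)) * v ^ (2 * (m - k)) * z ^ (2 * k + e))"
proof -
  let ?N = "2 * m + e"
  let ?f = "\<lambda>t. real (?N choose t) * v ^ (?N - t) * z ^ t"
  let ?S = "(\<lambda>k. 2 * k + e) ` {0..m}"
  have "(z + v) ^ ?N + (z - v) ^ ?N = (\<Sum>t\<le>?N. real (?N choose t) * z ^ t * v ^ (?N - t)) +
         (\<Sum>t\<le>?N. real (?N choose t) * z ^ t * (- v) ^ (?N - t))"
    using binomial_ring[of z v ?N] binomial_ring[of z "- v" ?N] by simp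
  also have "\<dots> = (\<Sum>t\<le>?N. if even (?N - t) then 2 * ?f t else 0)"
    unfolding sum.distrib[symmetric]
    by (rule sum.cong) (auto simp: power_minus_odd)
  also have "\<dots> = (\<Sum>t\<in>?S. if even (?N - t) then 2 * ?f t else 0)"
  proof (rule sum.mono_neutral_right)
    show "\<forall>t\<in>{..?N} - ?S. (if even (?N - t) then 2 * ?f t else 0) = 0"
    proof
      fix t assume t: "t \<in> {..?N} - ?S"
      have "odd (?N - t)"
      proof
        assume "even (?N - t)"
        then obtain q where q: "?N - t = 2 * q" by (elim evenE)
        then have "t = 2 * (m - q) + e" using t assms by auto
        then show False using t by auto
      qed
      then show "(if even (?N - t) then 2 * ?f t else 0) = 0" by simp
    qed
  qed auto
  also have "\<dots> = (\<Sum>k=0..m. if even (?N - (2 * k + e)) then 2 * ?f (2 * k + e) else 0)"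
    by (subst sum.reindex) (auto simp: inj_on_def)
  also have "\<dots> = 2 * (\<Sum>k=0..m. real (?N choose (2 * k + e)) * v ^ (2 * (m - k)) * z ^ (2 * k + e))"
    unfolding sum_distrib_left by (rule sum.cong) (auto simp: diff_mult_distrib2)
  finally show ?thesis by simp
qed

text \<open>
  By the reflections \<open>w\<^sub>i \<mapsto> r - w\<^sub>i\<close>, each factor may be replaced by its even part, one coordinate at
  a time.
\<close>

lemma bounded_sum_even_parts:
  fixes h :: "nat \<Rightarrow> real \<Rightarrow> real"
  shows "bounded_sum n r (\<lambda>w. \<Prod>i<n. h i (w i - real r / 2)) =
    bounded_sum n r (\<lambda>w. \<Prod>i<n. (h i (w i - real r / 2) + h i (- (w i - real r / 2))) / 2)"
proof -
  define sym where "sym = (\<lambda>k i v. if i < k then (h i v + h i (- v)) / 2 else h i (v :: real))"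
  define P where "P = (\<lambda>k w. \<Prod>i<n. sym k i (w i - real r / 2))"
  have "bounded_sum n r (P k) = bounded_sum n r (P 0)" if "k \<le> n" for k
    using that
  proof (induction k)
    case (Suc k)
    have k: "k < n" using Suc.prems by simp
    \<comment> \<open>The reflection \<open>w\<^sub>k \<mapsto> r - w\<^sub>k\<close> negates \<open>w\<^sub>k - r/2\<close>.\<close>
    have avg: "P (Suc k) w = (1/2) * (P k w + P k (w(k := real r - w k)))" for w
    proof -
      let ?v = "w k - real r / 2"
      let ?R = "\<Prod>i\<in>{..<n} - {k}. sym k i (w i - real r / 2)"
      have remove: "P m u = sym m k (u k - real r / 2) * (\<Prod>i\<in>{..<n} - {k}. sym m i (u i - real r / 2))"
        for m u unfolding P_def by (rule prod.remove) (use k in auto)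
      have "(\<Prod>i\<in>{..<n} - {k}. sym (Suc k) i (w i - real r / 2)) = ?R"
        by (rule prod.cong) (auto simp: sym_def)
      then have 1: "P (Suc k) w = ((h k ?v + h k (- ?v)) / 2) * ?R"
        unfolding remove by (simp add: sym_def)
      have 2: "P k w = h k ?v * ?R" unfolding remove by (simp add: sym_def)
      have "(\<Prod>i\<in>{..<n} - {k}. sym k i ((w(k := real r - w k)) i - real r / 2)) = ?R"
        by (rule prod.cong) auto
      then have 3: "P k (w(k := real r - w k)) = h k (- ?v) * ?R"
        unfolding remove by (simp add: sym_def)
      show ?thesis unfolding 1 2 3 by (simp add: field_simps)
    qed
    have "bounded_sum n r (P (Suc k)) = bounded_sum n r
      (\<lambda>w. (1/2) * (\<Sum>b\<in>{False, True}. if b then P k (w(k := real r - w k)) else P k w))"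
      by (rule arg_cong[where f = "bounded_sum n r"], rule ext) (simp add: avg)
    also have "\<dots> = (1/2) * bounded_sum n r
      (\<lambda>w. \<Sum>b\<in>{False, True}. if b then P k (w(k := real r - w k)) else P k w)"
      by (rule bounded_sum_cmult)
    also have "\<dots> = (1/2) * (bounded_sum n r (P k) + bounded_sum n r (\<lambda>w. P k (w(k := real r - w k))))"
      unfolding bounded_sum_sum by simp
    also have "\<dots> = bounded_sum n r (P k)"
      unfolding bounded_sum_reflect[OF k, of r "P k"] by simp
    finally show ?case using Suc by simp
  qed simp
  from this[OF order_refl] show ?thesis
    unfolding P_def sym_def by simp
qed

lemma prod_sum_permuted:
  fixes g :: "nat \<Rightarrow> nat \<Rightarrow> nat \<Rightarrow> real"
  assumes p: "p permutes {..<n}"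
  shows "(\<Prod>i<n. \<Sum>k=0..p i. g i (p i) k) = (\<Sum>f\<in>box n (\<lambda>_. 0) id. \<Prod>i<n. g i (p i) (f (p i)))"
proof -
  have perm: "(\<Prod>j<n. G j) = (\<Prod>i<n. G (p i))" for G :: "nat \<Rightarrow> real"
    using prod.permute[OF p, of G] by (simp add: comp_def)
  have inv: "inv_into UNIV p (p i) = i" for i using permutes_inverses(2)[OF p] by simp
  have "(\<Prod>i<n. \<Sum>k=0..p i. g i (p i) k) = (\<Prod>j<n. \<Sum>k=0..id j. g (inv_into UNIV p j) j k)"
    unfolding perm[of "\<lambda>j. \<Sum>k=0..id j. g (inv_into UNIV p j) j k"] by (simp add: inv)
  also have "\<dots> = (\<Sum>f\<in>box n (\<lambda>_. 0) id. \<Prod>j<n. g (inv_into UNIV p j) j (f j))"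
    by (rule prod_sum_box)
  also have "\<dots> = (\<Sum>f\<in>box n (\<lambda>_. 0) id. \<Prod>i<n. g i (p i) (f (p i)))"
  proof (rule sum.cong[OF refl])
    fix f show "(\<Prod>j<n. g (inv_into UNIV p j) j (f j)) = (\<Prod>i<n. g i (p i) (f (p i)))"
      unfolding perm[of "\<lambda>j. g (inv_into UNIV p j) j (f j)"] by (simp add: inv)
  qed
  finally show ?thesis .
qed

lemma inj_on_regressive_eq_id:
  fixes f :: "nat \<Rightarrow> nat"
  assumes "inj_on f {..<n}" "\<And>j. j < n \<Longrightarrow> f j \<le> j" "j < n"
  shows "f j = j"
  using assms(3)
proof (induction j rule: less_induct)
  case (less j)
  show ?case
  proof (rule ccontr)
    assume "f j \<noteq> j"
    then have "f j < j" using assms(2)[OF less.prems] by simp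
    then have "f (f j) = f j" using less by simp
    then have "f j = j" using assms(1) less.prems \<open>f j < j\<close> by (auto dest: inj_onD)
    then show False using \<open>f j \<noteq> j\<close> by simp
  qed
qed

text \<open>
  Expand the alternant by Leibniz and each even part by the binomial theorem: the power
  \<open>z ^ (2 j + e)\<close> contributes powers \<open>z ^ (2 k + e)\<close> with \<open>k \<le> j\<close> only.  By permutation invariance the
  coefficients do not depend on the permutation in the Leibniz formula, so that alternants with
  exponents \<open>2 (f j) + e\<close> appear for all choices \<open>f j \<le> j\<close>.  Those with non-injective \<open>f\<close>
  vanish, and an injective \<open>f\<close> with \<open>f j \<le> j\<close> is the identity.
\<close>

lemma bounded_sum_parity_alternant:
  assumes e: "e \<le> 1"
  shows "bounded_sum n r (\<lambda>w. parity_alternant n e (\<lambda>i. z i + (w i - real r / 2))) =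
         bounded_sum n r (\<lambda>_. 1) * parity_alternant n e z"
proof -
  define c where "c = (\<lambda>m k v. real ((2 * m + e) choose (2 * k + e)) * (v :: real) ^ (2 * (m - k)))"
  define C where "C = (\<lambda>f. bounded_sum n r (\<lambda>w. \<Prod>j<n. c j (f j) (w j - real r / 2)))"
  let ?P = "{p. p permutes {..<n}}"
  let ?B = "box n (\<lambda>_. 0) id"
  let ?f0 = "\<lambda>i. if i < n then i else (0 :: nat)"
  have expand: "bounded_sum n r (\<lambda>w. \<Prod>i<n. (z i + (w i - real r / 2)) ^ (2 * p i + e)) =
      (\<Sum>f\<in>?B. C f * (\<Prod>i<n. z i ^ (2 * f (p i) + e)))" if p: "p permutes {..<n}" for p
  proof -
    have "bounded_sum n r (\<lambda>w. \<Prod>i<n. (z i + (w i - real r / 2)) ^ (2 * p i + e)) =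
      bounded_sum n r (\<lambda>w. \<Prod>i<n. \<Sum>k=0..p i. c (p i) k (w i - real r / 2) * z i ^ (2 * k + e))"
      unfolding bounded_sum_even_parts[of n r "\<lambda>i v. (z i + v) ^ (2 * p i + e)"]
      unfolding add_uminus_conv_diff even_part_power[OF e] c_def ..
    also have "\<dots> = bounded_sum n r (\<lambda>w. \<Sum>f\<in>?B. (\<Prod>i<n. z i ^ (2 * f (p i) + e)) *
                          (\<Prod>i<n. c (p i) (f (p i)) (w i - real r / 2)))"
      unfolding prod_sum_permuted[OF p, of "\<lambda>i j k. c j k (w i - real r / 2) * z i ^ (2 * k + e)" for w]
      by (simp add: prod.distrib mult.commute)
    also have "\<dots> = (\<Sum>f\<in>?B. (\<Prod>i<n. z i ^ (2 * f (p i) + e)) * C f)"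
      unfolding bounded_sum_sum bounded_sum_cmult
    proof (rule sum.cong[OF refl])
      fix f
      have q: "inv_into UNIV p permutes {..<n}" using p by (rule permutes_inv)
      have "(\<Prod>i<n. c (p i) (f (p i)) (w i - real r / 2)) =
            (\<Prod>j<n. c j (f j) ((w \<circ> inv_into UNIV p) j - real r / 2))" for w
        using prod.permute[OF p, of "\<lambda>j. c j (f j) ((w \<circ> inv_into UNIV p) j - real r / 2)"]
          permutes_inverses(2)[OF p] by (simp add: comp_def)
      then have "bounded_sum n r (\<lambda>w. \<Prod>i<n. c (p i) (f (p i)) (w i - real r / 2)) = C f"
        unfolding C_def
        using bounded_sum_permute[OF q, of r "\<lambda>w. \<Prod>j<n. c j (f j) (w j - real r / 2)"] by simp
      then show "(\<Prod>i<n. z i ^ (2 * f (p i) + e)) *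
          bounded_sum n r (\<lambda>w. \<Prod>i<n. c (p i) (f (p i)) (w i - real r / 2)) =
          (\<Prod>i<n. z i ^ (2 * f (p i) + e)) * C f" by simp
    qed
    finally show ?thesis by (simp add: mult.commute)
  qed
  have "bounded_sum n r (\<lambda>w. parity_alternant n e (\<lambda>i. z i + (w i - real r / 2))) =
      (\<Sum>p\<in>?P. of_int (sign p) * (\<Sum>f\<in>?B. C f * (\<Prod>i<n. z i ^ (2 * f (p i) + e))))"
    unfolding parity_alternant_def alternant_Leibniz bounded_sum_sum bounded_sum_cmult
    by (rule sum.cong) (simp_all add: expand)
  also have "\<dots> = (\<Sum>f\<in>?B. C f * alternant n (\<lambda>j x. x ^ (2 * f j + e)) z)"
    unfolding alternant_Leibniz sum_distrib_left
    by (subst sum.swap) (simp add: mult_ac)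
  also have "\<dots> = (\<Sum>f\<in>{?f0}. C f * alternant n (\<lambda>j x. x ^ (2 * f j + e)) z)"
  proof (rule sum.mono_neutral_right)
    show "\<forall>f\<in>?B - {?f0}. C f * alternant n (\<lambda>j x. x ^ (2 * f j + e)) z = 0"
    proof
      fix f assume f: "f \<in> ?B - {?f0}"
      have "\<not> inj_on f {..<n}"
      proof
        assume "inj_on f {..<n}"
        then have "f j = j" if "j < n" for j
          using inj_on_regressive_eq_id[of f n j] f that by (auto simp: box_def)
        then have "f = ?f0" using f by (auto simp: fun_eq_iff box_def)
        then show False using f by simp
      qed
      then obtain a b where "a < n" "b < n" "a \<noteq> b" "f a = f b" by (auto simp: inj_on_def)
      then have "alternant n (\<lambda>j x. x ^ (2 * f j + e)) z = 0"
        by (intro alternant_eq_columns[of a n b]) auto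
      then show "C f * alternant n (\<lambda>j x. x ^ (2 * f j + e)) z = 0" by simp
    qed
  qed (rule finite_box, auto simp: box_def)
  also have "\<dots> = C ?f0 * parity_alternant n e z"
    unfolding parity_alternant_def by (simp, intro disjI2 alternant_cong) simp
  also have "C ?f0 = bounded_sum n r (\<lambda>_. 1)"
    unfolding C_def c_def by simp
  finally show ?thesis .
qed

lemma sum_partitions_parity_alternant:
  assumes "e \<le> 1"
  shows "(\<Sum>\<nu>\<in>partitions n r. parity_alternant n e (\<lambda>i. real (\<nu> i) + real (n - 1 - i) + c)) =
    bounded_sum n r (\<lambda>_. 1) * parity_alternant n e (\<lambda>i. real (n - 1 - i) + c + real r / 2)"
proof -
  have "(\<Sum>\<nu>\<in>partitions n r. parity_alternant n e (\<lambda>i. real (\<nu> i) + real (n - 1 - i) + c)) =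
    bounded_sum n r (\<lambda>w. parity_alternant n e (\<lambda>i. w i + real (n - 1 - i) + c))"
    unfolding parity_alternant_def by (rule sum_partitions_alternating[OF alternating_alternant])
  also have "\<dots> = bounded_sum n r (\<lambda>w. parity_alternant n e
      (\<lambda>i. (real (n - 1 - i) + c + real r / 2) + (w i - real r / 2)))"
    by (simp add: algebra_simps)
  finally show ?thesis unfolding bounded_sum_parity_alternant[OF assms] .
qed

text \<open>
  The points \<open>y\<^sub>i = \<nu>\<^sub>i + n - i - 1/2 - r/2\<close> decrease strictly, and all candidates in the symmetric
  range from \<open>-(r - 1)/2\<close> to \<open>(r - 1)/2\<close> are permitted.  If some \<open>y\<^sub>i\<close> lies there, change the sign of the one
  with least absolute value: no other point lies in between, so the order is preserved, and the odd
  alternant changes its sign.  (If two absolute values agree or one is \<open>0\<close>, the alternant vanishes anyway.)  Only the partition with all parts equal to \<open>r\<close> has no point in that range.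
\<close>

lemma sum_partitions_odd_alternant:
  "(\<Sum>\<nu>\<in>partitions n r. parity_alternant n 1 (\<lambda>i. real (\<nu> i) + real (n - 1 - i) + (1 / 2 - real r / 2))) =
   parity_alternant n 1 (\<lambda>i. real (n - 1 - i) + 1 / 2 + real r / 2)"
proof (cases "n = 0")
  case True
  then have "partitions n r = {\<lambda>_. 0}" by (auto simp: partitions_def fun_eq_iff)
  then show ?thesis using True by (simp add: parity_alternant_eq_prod)
next
  case False
  \<comment> \<open>Twice the points, to stay within the integers.\<close>
  define Y where "Y = (\<lambda>\<nu> i. 2 * (int (\<nu> i) + int (n - 1 - i)) + 1 - int r)"
  define V where "V = (\<lambda>\<nu>. parity_alternant n 1 (\<lambda>i. real_of_int (Y \<nu> i) / 2))"
  define k where "k = (\<lambda>\<nu>. ARG_MIN (\<lambda>i. nat \<bar>Y \<nu> i\<bar>) i. i < n)"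
  define \<phi> where "\<phi> = (\<lambda>\<nu>. \<nu>(k \<nu> := nat (int (\<nu> (k \<nu>)) - Y \<nu> (k \<nu>))))"
  define T where "T = {\<nu> \<in> partitions n r. V \<nu> \<noteq> 0 \<and> \<nu> (n - 1) < r}"
  define top where "top = (\<lambda>i. if i < n then r else 0)"
  have V_eq: "parity_alternant n 1 (\<lambda>i. real (\<nu> i) + real (n - 1 - i) + (1 / 2 - real r / 2)) = V \<nu>" for \<nu>
    unfolding V_def by (rule arg_cong[where f = "parity_alternant n 1"]) (auto simp: Y_def field_simps)
  have V_prod: "V \<nu> = (\<Prod>i<n. real_of_int (Y \<nu> i) / 2) *
     (\<Prod>j<n. \<Prod>i<j. ((real_of_int (Y \<nu> j) / 2)\<^sup>2 - (real_of_int (Y \<nu> i) / 2)\<^sup>2))" for \<nu>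
    unfolding V_def parity_alternant_eq_prod by simp
  have phi: "\<phi> \<nu> \<in> T \<and> \<phi> (\<phi> \<nu>) = \<nu> \<and> V (\<phi> \<nu>) = - V \<nu>" if "\<nu> \<in> T" for \<nu>
  proof -
    define m where "m = k \<nu>"
    have nu: "\<nu> \<in> partitions n r" "V \<nu> \<noteq> 0" "\<nu> (n - 1) < r" using that by (auto simp: T_def)
    have nz: "\<And>i. i < n \<Longrightarrow> Y \<nu> i \<noteq> 0"
      and sq: "\<And>i j. i < j \<Longrightarrow> j < n \<Longrightarrow> (real_of_int (Y \<nu> j) / 2)\<^sup>2 \<noteq> (real_of_int (Y \<nu> i) / 2)\<^sup>2"
      using nu(2) unfolding V_prod by auto
    have distinct: "\<bar>Y \<nu> i\<bar> \<noteq> \<bar>Y \<nu> j\<bar>" if "i < n" "j < n" "i \<noteq> j" for i j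
    proof
      assume "\<bar>Y \<nu> i\<bar> = \<bar>Y \<nu> j\<bar>"
      then have "(Y \<nu> i)\<^sup>2 = (Y \<nu> j)\<^sup>2" by (metis power2_abs)
      then have "(real_of_int (Y \<nu> i))\<^sup>2 = (real_of_int (Y \<nu> j))\<^sup>2" by (metis of_int_power)
      then show False using sq[of i j] sq[of j i] that by (cases i j rule: linorder_cases) (auto simp: power_divide)
    qed
    have m: "m < n" and min: "\<And>i. i < n \<Longrightarrow> \<bar>Y \<nu> m\<bar> \<le> \<bar>Y \<nu> i\<bar>"
      using arg_min_nat_lemma[of "\<lambda>i. i < n" 0 "\<lambda>i. nat \<bar>Y \<nu> i\<bar>"] False
      unfolding m_def k_def by auto
    have min': "\<bar>Y \<nu> m\<bar> < \<bar>Y \<nu> i\<bar>" if "i < n" "i \<noteq> m" for i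
      using min[OF that(1)] distinct[OF that(1) m that(2)] by simp
    have dec: "\<nu> (Suc i) \<le> \<nu> i" for i using nu(1) by (simp add: partitions_def)
    have small: "\<bar>Y \<nu> m\<bar> \<le> int r - 1"
    proof -
      have "\<bar>Y \<nu> (n - 1)\<bar> \<le> int r - 1" using nu(3) by (auto simp: Y_def)
      then show ?thesis using min[of "n - 1"] False by simp
    qed
    have up: "\<bar>Y \<nu> m\<bar> < Y \<nu> (m - 1)" if "m \<noteq> 0"
    proof -
      have "Y \<nu> m < Y \<nu> (m - 1)" using dec[of "m - 1"] that m by (simp add: Y_def)
      then show ?thesis using min'[of "m - 1"] that m by linarith
    qed
    have down: "Y \<nu> (Suc m) < - \<bar>Y \<nu> m\<bar>" if "Suc m < n"
    proof -
      have "Y \<nu> (Suc m) < Y \<nu> m" using dec[of m] that m by (simp add: Y_def)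
      then show ?thesis using min'[of "Suc m"] that m by linarith
    qed
    have nonneg: "int (\<nu> (Suc m)) \<le> int (\<nu> m) - Y \<nu> m"
    proof (cases "Suc m < n")
      case True
      then show ?thesis using down unfolding Y_def by simp
    next
      case F: False
      then have "\<nu> (Suc m) = 0" "m = n - 1" using nu(1) m by (auto simp: partitions_def)
      then show ?thesis using nu(3) unfolding Y_def by simp
    qed
    have phi: "\<phi> \<nu> = \<nu>(m := nat (int (\<nu> m) - Y \<nu> m))" by (simp add: \<phi>_def m_def)
    have phi_m: "int (\<phi> \<nu> m) = int (\<nu> m) - Y \<nu> m" using nonneg by (simp add: phi)
    have phi_other: "\<phi> \<nu> i = \<nu> i" if "i \<noteq> m" for i using that by (simp add: phi)
    have Ym: "Y (\<phi> \<nu>) m = - Y \<nu> m" using phi_m unfolding Y_def by simp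
    have Yo: "Y (\<phi> \<nu>) i = Y \<nu> i" if "i \<noteq> m" for i using phi_other[OF that] unfolding Y_def by simp
    have abs_Y: "\<bar>Y (\<phi> \<nu>) i\<bar> = \<bar>Y \<nu> i\<bar>" for i using Ym Yo[of i] by (cases "i = m") auto
    have k_phi: "k (\<phi> \<nu>) = m" unfolding m_def k_def abs_Y ..
    have "\<phi> (\<phi> \<nu>) = (\<phi> \<nu>)(m := nat (int (\<phi> \<nu> m) - Y (\<phi> \<nu>) m))"
      unfolding k_phi[symmetric] by (simp only: \<phi>_def)
    also have "\<dots> = \<nu>" unfolding Ym phi_m by (auto simp: phi)
    finally have inv: "\<phi> (\<phi> \<nu>) = \<nu>" .
    have neg: "V (\<phi> \<nu>) = - V \<nu>"
    proof -
      have sq: "(real_of_int (Y (\<phi> \<nu>) i) / 2)\<^sup>2 = (real_of_int (Y \<nu> i) / 2)\<^sup>2" for i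
        using Ym Yo[of i] by (cases "i = m") (auto simp: power_divide)
      have "(\<Prod>i<n. real_of_int (Y (\<phi> \<nu>) i) / 2) = - (\<Prod>i<n. real_of_int (Y \<nu> i) / 2)"
        using m prod.remove[of "{..<n}" m "\<lambda>i. real_of_int (Y (\<phi> \<nu>) i) / 2"]
          prod.remove[of "{..<n}" m "\<lambda>i. real_of_int (Y \<nu> i) / 2"] Ym
          prod.cong[of "{..<n} - {m}" "{..<n} - {m}" "\<lambda>i. real_of_int (Y (\<phi> \<nu>) i) / 2" "\<lambda>i. real_of_int (Y \<nu> i) / 2"]
        by (simp add: Yo)
      then show ?thesis unfolding V_prod sq by simp
    qed
    have "\<phi> \<nu> \<in> partitions n r"
      unfolding partitions_def
    proof (intro CollectI conjI allI impI)
      fix i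
      show "\<phi> \<nu> (Suc i) \<le> \<phi> \<nu> i"
      proof -
        consider "i = m" | "Suc i = m" | "i \<noteq> m" "Suc i \<noteq> m" by blast
        then show ?thesis
        proof cases
          case 1
          then show ?thesis using nonneg phi_m phi_other[of "Suc m"] by simp
        next
          case 2
          then have "int (\<nu> m) - Y \<nu> m \<le> int (\<nu> i)"
            using up m unfolding Y_def by (auto simp: of_nat_diff)
          then show ?thesis using phi_m phi_other[of i] 2 by simp
        next
          case 3
          then show ?thesis using phi_other dec by simp
        qed
      qed
      show "\<phi> \<nu> i = 0" if "n \<le> i" using that m phi_other[of i] nu(1) by (auto simp: partitions_def)
      show "\<phi> \<nu> 0 \<le> r"
      proof (cases "m = 0")
        case True
        then show ?thesis using phi_m small unfolding Y_def by simp
      next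
        case False
        then show ?thesis using phi_other[of 0] nu(1) by (simp add: partitions_def)
      qed
    qed
    moreover have "\<phi> \<nu> (n - 1) < r"
    proof (cases "m = n - 1")
      case True
      then show ?thesis using phi_m nu(3) unfolding Y_def by simp
    next
      case F: False
      then show ?thesis using phi_other[of "n - 1"] nu(3) by simp
    qed
    ultimately have "\<phi> \<nu> \<in> T" using neg nu(2) by (simp add: T_def)
    then show ?thesis using inv neg by blast
  qed
  have "(\<Sum>\<nu>\<in>partitions n r. V \<nu>) = (\<Sum>\<nu>\<in>insert top T. V \<nu>)"
  proof (rule sum.mono_neutral_right)
    show "insert top T \<subseteq> partitions n r" using False by (auto simp: T_def top_def partitions_def)
    show "\<forall>\<nu>\<in>partitions n r - insert top T. V \<nu> = 0"
    proof
      fix \<nu> assume nu: "\<nu> \<in> partitions n r - insert top T"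
      show "V \<nu> = 0"
      proof (rule ccontr)
        assume "V \<nu> \<noteq> 0"
        then have r: "r \<le> \<nu> (n - 1)" using nu by (auto simp: T_def)
        have "\<nu> i = r" if "i < n" for i
        proof (rule antisym)
          show "\<nu> i \<le> r" using nu by (intro partitions_le[of \<nu> n]) simp
          have "\<nu> (n - 1) \<le> \<nu> i" using nu that by (intro partitions_antimono[of \<nu> n r]) simp_all
          with r show "r \<le> \<nu> i" by simp
        qed
        then have "\<nu> = top" using nu by (auto simp: top_def fun_eq_iff partitions_def)
        then show False using nu by simp
      qed
    qed
  qed simp
  also have "\<dots> = V top + sum V T"
    by (rule sum.insert) (use False in \<open>auto simp: T_def top_def intro: finite_subset[of _ "partitions n r"]\<close>)
  also have "sum V T = 0"
    by (rule sum_eq_0_if_sign_reversing[where \<phi> = \<phi>]) (use phi in auto)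
  also have "V top = parity_alternant n 1 (\<lambda>i. real (n - 1 - i) + 1 / 2 + real r / 2)"
    unfolding V_def parity_alternant_def
    by (rule alternant_cong) (simp add: Y_def top_def field_simps)
  finally show ?thesis unfolding V_eq by simp
qed

section \<open>Symplectic fillings\<close>

text \<open>
  Shapes have a row for every natural number, almost all of them empty, so that removing a letter
  never removes a row.
\<close>

definition fillings :: "letter set \<Rightarrow> (nat \<Rightarrow> nat) \<Rightarrow> (nat \<Rightarrow> letter list) set" where
  "fillings A \<mu> = {f. (\<forall>i. length (f i) = \<mu> i \<and> sorted (f i) \<and> set (f i) \<subseteq> A \<and>
      (\<forall>x\<in>set (f i). Unbarred (Suc i) \<le> x)) \<and>
     (\<forall>i j. j < \<mu> (Suc i) \<longrightarrow> f i ! j < f (Suc i) ! j)}"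

lemma sorted_split_off_max:
  fixes a :: "'a :: linorder"
  assumes "sorted xs" "\<And>x. x \<in> set xs \<Longrightarrow> x \<le> a"
  shows "xs = filter (\<lambda>x. x \<noteq> a) xs @ replicate (length xs - length (filter (\<lambda>x. x \<noteq> a) xs)) a"
  using assms
proof (induction xs)
  case (Cons x xs)
  show ?case
  proof (cases "x = a")
    case True
    then have "\<forall>y\<in>set xs. y = a" using Cons.prems by force
    then have "filter (\<lambda>x. x \<noteq> a) xs = []" "xs = replicate (length xs) a"
      by (auto simp: filter_empty_conv intro: replicate_eqI)
    then show ?thesis using True by simp
  next
    case False
    then show ?thesis using Cons by simp
  qed
qed simp

lemma replicate_tail_nth:
  assumes "length g \<le> m" "j < m"
  shows "(g @ replicate (m - length g) a) ! j = (if j < length g then g ! j else a)"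
  using assms by (auto simp: nth_append)

lemma filter_append_replicate:
  "a \<notin> set g \<Longrightarrow> filter (\<lambda>x. x \<noteq> a) (g @ replicate m a) = g"
  by (auto simp: filter_id_conv filter_empty_conv)

text \<open>
  Column strictness forces each copy of \<open>a\<close> to stand below a smaller letter; that is the interlacing
  condition for the remaining shape.
\<close>

lemma bij_betw_remove_largest_letter:
  assumes a: "\<And>x. x \<in> A \<Longrightarrow> x < a" and lb: "\<And>i. i < n \<Longrightarrow> Unbarred (Suc i) \<le> a"
    and dec: "\<And>i. \<nu> (Suc i) \<le> \<nu> i" and zero: "\<And>i. n \<le> i \<Longrightarrow> \<nu> i = 0"
  shows "bij_betw (\<lambda>f i. filter (\<lambda>x. x \<noteq> a) (f i)) (fillings (insert a A) \<nu>)
           (\<Union>\<mu>\<in>below n \<nu>. fillings A \<mu>)"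
proof (rule bij_betw_byWitness[where f' = "\<lambda>g i. g i @ replicate (\<nu> i - length (g i)) a"])
  have notin: "a \<notin> A" using a by auto
  have fwd: "f i = filter (\<lambda>x. x \<noteq> a) (f i) @ replicate (\<nu> i - length (filter (\<lambda>x. x \<noteq> a) (f i))) a"
    if "f \<in> fillings (insert a A) \<nu>" for f i
  proof -
    have "sorted (f i)" "\<And>x. x \<in> set (f i) \<Longrightarrow> x \<le> a" "length (f i) = \<nu> i"
      using that a unfolding fillings_def by (auto intro: less_imp_le)
    then show ?thesis using sorted_split_off_max[of "f i" a] by simp
  qed
  show "\<forall>f\<in>fillings (insert a A) \<nu>.
      (\<lambda>i. filter (\<lambda>x. x \<noteq> a) (f i) @ replicate (\<nu> i - length (filter (\<lambda>x. x \<noteq> a) (f i))) a) = f"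
    using fwd[symmetric] by blast
  show "\<forall>g\<in>(\<Union>\<mu>\<in>below n \<nu>. fillings A \<mu>).
      (\<lambda>i. filter (\<lambda>x. x \<noteq> a) (g i @ replicate (\<nu> i - length (g i)) a)) = g"
  proof
    fix g assume "g \<in> (\<Union>\<mu>\<in>below n \<nu>. fillings A \<mu>)"
    then have "a \<notin> set (g i)" for i using notin by (auto simp: fillings_def)
    then show "(\<lambda>i. filter (\<lambda>x. x \<noteq> a) (g i @ replicate (\<nu> i - length (g i)) a)) = g"
      by (intro ext filter_append_replicate)
  qed
  show "(\<lambda>f i. filter (\<lambda>x. x \<noteq> a) (f i)) ` fillings (insert a A) \<nu> \<subseteq> (\<Union>\<mu>\<in>below n \<nu>. fillings A \<mu>)"
  proof safe
    fix f assume f: "f \<in> fillings (insert a A) \<nu>"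
    define g where "g = (\<lambda>i. filter (\<lambda>x. x \<noteq> a) (f i))"
    define \<mu> where "\<mu> = (\<lambda>i. length (g i))"
    have len: "length (f i) = \<nu> i" and "sorted (f i)" and sub: "set (f i) \<subseteq> insert a A"
      and "\<forall>x\<in>set (f i). Unbarred (Suc i) \<le> x" for i
      using f by (auto simp: fillings_def)
    have col: "f i ! j < f (Suc i) ! j" if "j < \<nu> (Suc i)" for i j
      using f that by (auto simp: fillings_def)
    have mu_le: "\<mu> i \<le> \<nu> i" for i unfolding \<mu>_def g_def len[symmetric] by (rule length_filter_le)
    have nth: "f i ! j = (if j < \<mu> i then g i ! j else a)" if "j < \<nu> i" for i j
    proof -
      have "f i = g i @ replicate (\<nu> i - length (g i)) a" using fwd[OF f, of i] unfolding g_def .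
      then have "f i ! j = (g i @ replicate (\<nu> i - length (g i)) a) ! j" by (rule arg_cong)
      then show ?thesis
        using replicate_tail_nth[of "g i" "\<nu> i" j a] mu_le[of i] that unfolding \<mu>_def by simp
    qed
    have le_a: "f i ! j \<le> a" if "j < \<nu> i" for i j
    proof -
      have "f i ! j \<in> set (f i)" using that len[of i] by simp
      then have "f i ! j \<in> insert a A" using sub[of i] by blast
      then show ?thesis using a by (auto intro: less_imp_le)
    qed
    have strip: "\<nu> (Suc i) \<le> \<mu> i" for i
    proof (rule ccontr)
      assume "\<not> \<nu> (Suc i) \<le> \<mu> i"
      then have "\<mu> i < \<nu> (Suc i)" by simp
      then have "f i ! \<mu> i < a" "f i ! \<mu> i = a"
        using col[of "\<mu> i" i] le_a[of "\<mu> i" "Suc i"] nth[of "\<mu> i" i] dec[of i] by auto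
      then show False by simp
    qed
    have "\<mu> \<in> below n \<nu>"
      using strip mu_le zero by (auto simp: below_def box_def \<mu>_def intro: le_trans) (metis le_zero_eq mu_le \<mu>_def length_0_conv)
    moreover have "g \<in> fillings A \<mu>"
    proof -
      have "g i ! j < g (Suc i) ! j" if "j < \<mu> (Suc i)" for i j
        using col[of j i] nth[of j i] nth[of j "Suc i"] that mu_le[of "Suc i"] strip[of i] dec[of i] by auto
      then show ?thesis using f
        by (auto simp: fillings_def g_def \<mu>_def sorted_wrt_filter)
    qed
    ultimately show "(\<lambda>i. filter (\<lambda>x. x \<noteq> a) (f i)) \<in> (\<Union>\<mu>\<in>below n \<nu>. fillings A \<mu>)"
      unfolding g_def by blast
  qed
  show "(\<lambda>g i. g i @ replicate (\<nu> i - length (g i)) a) ` (\<Union>\<mu>\<in>below n \<nu>. fillings A \<mu>) \<subseteq> fillings (insert a A) \<nu>"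
  proof safe
    fix g \<mu> assume mu: "\<mu> \<in> below n \<nu>" and g: "g \<in> fillings A \<mu>"
    have len: "length (g i) = \<mu> i" for i using g by (simp add: fillings_def)
    have mu_le: "\<mu> i \<le> \<nu> i" for i using mu zero[of i] by (cases "i < n") (auto simp: below_def box_def)
    have strip: "\<nu> (Suc i) \<le> \<mu> i" for i
      using mu zero[of "Suc i"] by (cases "i < n") (auto simp: below_def box_def)
    have mem: "g i ! j < a" if "j < \<mu> i" for i j
    proof -
      have "g i ! j \<in> set (g i)" using that len[of i] by simp
      moreover have "set (g i) \<subseteq> A" using g by (simp add: fillings_def)
      ultimately show ?thesis using a by blast
    qed
    have nth: "(g i @ replicate (\<nu> i - length (g i)) a) ! j = (if j < \<mu> i then g i ! j else a)"
      if "j < \<nu> i" for i j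
      using replicate_tail_nth[of "g i" "\<nu> i" j a] that mu_le[of i] len[of i] by simp
    have "(g i @ replicate (\<nu> i - length (g i)) a) ! j < (g (Suc i) @ replicate (\<nu> (Suc i) - length (g (Suc i))) a) ! j"
      if "j < \<nu> (Suc i)" for i j
      unfolding nth[OF that] using nth[of j i] that dec[of i] strip[of i] mem[of j i] g
      by (auto simp: fillings_def)
    moreover have "sorted (g i @ replicate (\<nu> i - length (g i)) a)" for i
      using g a by (auto simp: fillings_def sorted_append intro: less_imp_le)
    moreover have "Unbarred (Suc i) \<le> x" if "x \<in> set (g i @ replicate (\<nu> i - length (g i)) a)" for x i
      using that g lb[of i] zero[of i] by (cases "i < n") (auto simp: fillings_def split: if_splits)
    moreover have "set (g i @ replicate (\<nu> i - length (g i)) a) \<subseteq> insert a A" for i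
      using g by (auto simp: fillings_def)
    ultimately show "(\<lambda>i. g i @ replicate (\<nu> i - length (g i)) a) \<in> fillings (insert a A) \<nu>"
      using mu_le len by (simp add: fillings_def)
  qed
qed

lemma disjoint_fillings: "\<mu> \<noteq> \<mu>' \<Longrightarrow> fillings A \<mu> \<inter> fillings A \<mu>' = {}"
  by (auto simp: fillings_def fun_eq_iff)

lemma card_fillings_insert:
  assumes "\<And>x. x \<in> A \<Longrightarrow> x < a" "\<And>i. i < n \<Longrightarrow> Unbarred (Suc i) \<le> a"
    "\<And>i. \<nu> (Suc i) \<le> \<nu> i" "\<And>i. n \<le> i \<Longrightarrow> \<nu> i = 0"
    and fin: "\<And>\<mu>. \<mu> \<in> below n \<nu> \<Longrightarrow> finite (fillings A \<mu>)"
  shows "finite (fillings (insert a A) \<nu>)"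
    "card (fillings (insert a A) \<nu>) = (\<Sum>\<mu>\<in>below n \<nu>. card (fillings A \<mu>))"
proof -
  note bij = bij_betw_remove_largest_letter[of A a n \<nu>, OF assms(1-4)]
  have "finite (\<Union>\<mu>\<in>below n \<nu>. fillings A \<mu>)" using fin by auto
  then show "finite (fillings (insert a A) \<nu>)" using bij_betw_finite[OF bij] by simp
  have "card (fillings (insert a A) \<nu>) = card (\<Union>\<mu>\<in>below n \<nu>. fillings A \<mu>)"
    by (rule bij_betw_same_card[OF bij])
  also have "\<dots> = (\<Sum>\<mu>\<in>below n \<nu>. card (fillings A \<mu>))"
    by (rule card_UN_disjoint) (use fin disjoint_fillings in auto)
  finally show "card (fillings (insert a A) \<nu>) = (\<Sum>\<mu>\<in>below n \<nu>. card (fillings A \<mu>))" .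
qed

definition symplectic_letters :: "nat \<Rightarrow> letter set" where
  "symplectic_letters k = Unbarred ` {1..k} \<union> Barred ` {1..k}"

lemma sum_binomial_interval:
  assumes "a \<le> b"
  shows "(\<Sum>x=a..b. real ((x + s) choose t)) = real ((b + s + 1) choose (t + 1)) - real ((a + s) choose (t + 1))"
  using assms by (induction b rule: dec_induct) auto

text \<open>
  After taking differences of consecutive rows, only the last entry of the first column survives.
  This raises the size of the determinant when a new row becomes available.
\<close>

lemma det_first_column_ones:
  fixes a :: "nat \<Rightarrow> nat \<Rightarrow> real"
  assumes "\<And>i. i \<le> k \<Longrightarrow> a i 0 = 1"
  shows "det (mat (Suc k) (Suc k) (\<lambda>(i,j). a i j)) =
         (-1) ^ k * det (mat k k (\<lambda>(i,j). a i (Suc j) - a (Suc i) (Suc j)))"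
proof -
  define M where "M = mat (Suc k) (Suc k) (\<lambda>(i,j). a i j - (if Suc i < Suc k then a (Suc i) j else 0))"
  have M: "M \<in> carrier_mat (Suc k) (Suc k)" by (simp add: M_def)
  have "det (mat (Suc k) (Suc k) (\<lambda>(i,j). a i j)) = det M"
    unfolding M_def by (rule det_row_differences[symmetric])
  also have "\<dots> = (\<Sum>i<Suc k. M $$ (i, 0) * cofactor M i 0)"
    by (rule laplace_expansion_column[OF M]) simp
  also have "\<dots> = (\<Sum>i<Suc k. if i = k then cofactor M k 0 else 0)"
    by (rule sum.cong) (auto simp: M_def assms)
  also have "\<dots> = cofactor M k 0" by simp
  also have "mat_delete M k 0 = mat k k (\<lambda>(i,j). a i (Suc j) - a (Suc i) (Suc j))"
    by (rule eq_matI) (auto simp: mat_delete_def M_def)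
  then have "cofactor M k 0 = (-1) ^ k * det (mat k k (\<lambda>(i,j). a i (Suc j) - a (Suc i) (Suc j)))"
    by (simp add: cofactor_def)
  finally show ?thesis .
qed

lemma below_antimono:
  assumes "\<mu> \<in> below n \<nu>" "\<And>i. \<nu> (Suc i) \<le> \<nu> i"
  shows "\<mu> (Suc i) \<le> \<mu> i"
  using assms(1) by (cases "Suc i < n") (auto simp: below_def box_def intro: le_trans)

lemma Suc_choose_two: "Suc k choose 2 = (k choose 2) + k"
  by (simp add: numeral_2_eq_2)

text \<open>
  Adding the letter \<open>k + 1\<close> makes a new row available, but below that row the shape in the smaller letters is
  confined to \<open>k\<close> rows.  The interlacing sums of \<open>(l + j choose 2 j + 1)\<close> telescope to differences of
  \<open>(y + j choose 2 j)\<close>, whose column \<open>j = 0\<close> consists of ones.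
\<close>

lemma card_fillings_odd_step:
  assumes IH: "\<And>\<mu>. (\<And>i. \<mu> (Suc i) \<le> \<mu> i) \<Longrightarrow> (\<And>i. k \<le> i \<Longrightarrow> \<mu> i = 0) \<Longrightarrow>
      finite (fillings (symplectic_letters k) \<mu>) \<and>
      real (card (fillings (symplectic_letters k) \<mu>)) =
        (-1) ^ (k choose 2) * alternant k (\<lambda>j l. real ((l + j) choose (2 * j + 1))) (\<lambda>i. \<mu> i + (k - i))"
    and dec: "\<And>i. \<nu> (Suc i) \<le> \<nu> i" and zero: "\<And>i. Suc k \<le> i \<Longrightarrow> \<nu> i = 0"
  shows "finite (fillings (insert (Unbarred (Suc k)) (symplectic_letters k)) \<nu>) \<and>
      real (card (fillings (insert (Unbarred (Suc k)) (symplectic_letters k)) \<nu>)) =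
        (-1) ^ (Suc k choose 2) * alternant (Suc k) (\<lambda>j l. real ((l + j) choose (2 * j))) (\<lambda>i. \<nu> i + (k - i))"
proof -
  let ?A = "symplectic_letters k"
  have less: "x < Unbarred (Suc k)" if "x \<in> ?A" for x
    using that by (auto simp: symplectic_letters_def)
  have empty: "fillings ?A \<mu> = {}" if "\<mu> k \<noteq> 0" for \<mu>
  proof (rule ccontr)
    assume "fillings ?A \<mu> \<noteq> {}"
    then obtain f where f: "f \<in> fillings ?A \<mu>" by auto
    then have "length (f k) \<noteq> 0" using that by (simp add: fillings_def)
    then have "hd (f k) \<in> set (f k)" by simp
    then have "hd (f k) < Unbarred (Suc k)" "Unbarred (Suc k) \<le> hd (f k)"
      using f less by (auto simp: fillings_def)
    then show False by simp
  qed
  have sub: "{\<mu> \<in> below (Suc k) \<nu>. \<mu> k = 0} = below k \<nu>"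
  proof (intro equalityI subsetI)
    fix \<mu> assume "\<mu> \<in> {\<mu> \<in> below (Suc k) \<nu>. \<mu> k = 0}"
    then have mu: "\<And>i. i < Suc k \<Longrightarrow> \<nu> (Suc i) \<le> \<mu> i \<and> \<mu> i \<le> \<nu> i"
        "\<And>i. Suc k \<le> i \<Longrightarrow> \<mu> i = 0" "\<mu> k = 0"
      by (auto simp: below_def box_def)
    have "\<mu> i = 0" if "k \<le> i" for i using mu(2)[of i] mu(3) that by (cases "i = k") auto
    then show "\<mu> \<in> below k \<nu>" using mu(1) by (simp add: below_def box_def)
  next
    fix \<mu> assume "\<mu> \<in> below k \<nu>"
    then have mu: "\<And>i. i < k \<Longrightarrow> \<nu> (Suc i) \<le> \<mu> i \<and> \<mu> i \<le> \<nu> i" "\<And>i. k \<le> i \<Longrightarrow> \<mu> i = 0"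
      by (auto simp: below_def box_def)
    then show "\<mu> \<in> {\<mu> \<in> below (Suc k) \<nu>. \<mu> k = 0}"
      using zero[of "Suc k"] by (auto simp: below_def box_def less_Suc_eq)
  qed
  have fin: "finite (fillings ?A \<mu>)" if "\<mu> \<in> below (Suc k) \<nu>" for \<mu>
  proof (cases "\<mu> k = 0")
    case True
    then have "\<mu> \<in> below k \<nu>" using that sub by blast
    then show ?thesis
      using IH[of \<mu>] below_antimono[of \<mu> "Suc k" \<nu>, OF that dec] by (auto simp: below_def box_def)
  qed (simp add: empty)
  have lb: "Unbarred (Suc i) \<le> Unbarred (Suc k)" if "i < Suc k" for i
    using that by (auto simp: less_eq_letter_def)
  note step = card_fillings_insert[of ?A "Unbarred (Suc k)" "Suc k" \<nu>, OF less lb dec zero fin]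
  have "real (card (fillings (insert (Unbarred (Suc k)) ?A) \<nu>)) =
        (\<Sum>\<mu>\<in>below (Suc k) \<nu>. real (card (fillings ?A \<mu>)))"
    using step(2) by simp
  also have "\<dots> = (\<Sum>\<mu>\<in>below k \<nu>. real (card (fillings ?A \<mu>)))"
    unfolding sub[symmetric] by (rule sum.mono_neutral_right) (auto simp: empty)
  also have "\<dots> = (\<Sum>\<mu>\<in>below k \<nu>. (-1) ^ (k choose 2) *
      det (mat k k (\<lambda>(i,j). real ((\<mu> i + (k - i) + j) choose (2 * j + 1)))))"
  proof (rule sum.cong[OF refl])
    fix \<mu> assume mu: "\<mu> \<in> below k \<nu>"
    then have "\<And>i. k \<le> i \<Longrightarrow> \<mu> i = 0" by (auto simp: below_def box_def)
    then show "real (card (fillings ?A \<mu>)) = (-1) ^ (k choose 2) *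
      det (mat k k (\<lambda>(i,j). real ((\<mu> i + (k - i) + j) choose (2 * j + 1))))"
      using IH[of \<mu>] below_antimono[of \<mu> k \<nu>, OF mu dec] by (simp add: alternant_def)
  qed
  also have "\<dots> = (-1) ^ (k choose 2) *
      det (mat k k (\<lambda>(i,j). \<Sum>x=\<nu> (Suc i)..\<nu> i. real ((x + (k - i) + j) choose (2 * j + 1))))"
    unfolding sum_distrib_left[symmetric] below_def
    by (subst det_sum_rows[where g = "\<lambda>i j x. real ((x + (k - i) + j) choose (2 * j + 1))"]) (rule refl)
  also have "mat k k (\<lambda>(i,j). \<Sum>x=\<nu> (Suc i)..\<nu> i. real ((x + (k - i) + j) choose (2 * j + 1))) =
     mat k k (\<lambda>(i,j). real ((\<nu> i + (k - i) + Suc j) choose (2 * Suc j)) -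
                       real ((\<nu> (Suc i) + (k - Suc i) + Suc j) choose (2 * Suc j)))"
  proof (rule eq_matI, goal_cases)
    case (1 i j)
    have "k - i + j = Suc (k - Suc i + j)" using 1 by simp
    then show ?case using 1 sum_binomial_interval[OF dec[of i], of "k - i + j" "2 * j + 1"]
      by (simp add: add.assoc)
  qed simp_all
  also have "(-1) ^ (k choose 2) * det \<dots> = (-1) ^ (Suc k choose 2) *
      det (mat (Suc k) (Suc k) (\<lambda>(i,j). real ((\<nu> i + (k - i) + j) choose (2 * j))))"
    by (subst det_first_column_ones) (simp_all add: Suc_choose_two power_add mult.assoc[symmetric])
  finally show ?thesis using step(1) by (simp add: alternant_def)
qed

text \<open>
  Adding the barred letter keeps the number of rows; the last interlacing interval starts at \<open>0\<close>,
  where \<open>(l + j choose 2 j + 1)\<close> vanishes, so the matrix consists of full row differences.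
\<close>

lemma card_fillings_even_step:
  assumes IH: "\<And>\<mu>. (\<And>i. \<mu> (Suc i) \<le> \<mu> i) \<Longrightarrow> (\<And>i. Suc k \<le> i \<Longrightarrow> \<mu> i = 0) \<Longrightarrow>
      finite (fillings (insert (Unbarred (Suc k)) (symplectic_letters k)) \<mu>) \<and>
      real (card (fillings (insert (Unbarred (Suc k)) (symplectic_letters k)) \<mu>)) =
        (-1) ^ (Suc k choose 2) * alternant (Suc k) (\<lambda>j l. real ((l + j) choose (2 * j))) (\<lambda>i. \<mu> i + (k - i))"
    and dec: "\<And>i. \<nu> (Suc i) \<le> \<nu> i" and zero: "\<And>i. Suc k \<le> i \<Longrightarrow> \<nu> i = 0"
  shows "finite (fillings (symplectic_letters (Suc k)) \<nu>) \<and>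
      real (card (fillings (symplectic_letters (Suc k)) \<nu>)) =
        (-1) ^ (Suc k choose 2) * alternant (Suc k) (\<lambda>j l. real ((l + j) choose (2 * j + 1))) (\<lambda>i. \<nu> i + (Suc k - i))"
proof -
  let ?A = "insert (Unbarred (Suc k)) (symplectic_letters k)"
  have letters: "symplectic_letters (Suc k) = insert (Barred (Suc k)) ?A"
    unfolding symplectic_letters_def atLeastAtMostSuc_conv[of 1 k, simplified] by auto
  have less: "x < Barred (Suc k)" if "x \<in> ?A" for x
    using that by (auto simp: symplectic_letters_def)
  have mu0: "\<And>i. Suc k \<le> i \<Longrightarrow> \<mu> i = 0" if "\<mu> \<in> below (Suc k) \<nu>" for \<mu>
    using that by (auto simp: below_def box_def)
  have fin: "finite (fillings ?A \<mu>)" if "\<mu> \<in> below (Suc k) \<nu>" for \<mu>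
    using IH[of \<mu>, OF below_antimono[of \<mu> "Suc k" \<nu>, OF that dec] mu0[OF that]] by blast
  have lb: "Unbarred (Suc i) \<le> Barred (Suc k)" if "i < Suc k" for i
    using that by (auto simp: less_eq_letter_def)
  note step = card_fillings_insert[of ?A "Barred (Suc k)" "Suc k" \<nu>, OF less lb dec zero fin]
  have "real (card (fillings (symplectic_letters (Suc k)) \<nu>)) =
        (\<Sum>\<mu>\<in>below (Suc k) \<nu>. real (card (fillings ?A \<mu>)))"
    using step(2) unfolding letters by simp
  also have "\<dots> = (\<Sum>\<mu>\<in>below (Suc k) \<nu>. (-1) ^ (Suc k choose 2) *
      det (mat (Suc k) (Suc k) (\<lambda>(i,j). real ((\<mu> i + (k - i) + j) choose (2 * j)))))"
  proof (rule sum.cong[OF refl])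
    fix \<mu> assume mu: "\<mu> \<in> below (Suc k) \<nu>"
    show "real (card (fillings ?A \<mu>)) = (-1) ^ (Suc k choose 2) *
      det (mat (Suc k) (Suc k) (\<lambda>(i,j). real ((\<mu> i + (k - i) + j) choose (2 * j))))"
      using IH[of \<mu>, OF below_antimono[of \<mu> "Suc k" \<nu>, OF mu dec] mu0[OF mu]]
      by (simp add: alternant_def)
  qed
  also have "\<dots> = (-1) ^ (Suc k choose 2) *
      det (mat (Suc k) (Suc k) (\<lambda>(i,j). \<Sum>x=\<nu> (Suc i)..\<nu> i. real ((x + (k - i) + j) choose (2 * j))))"
    unfolding sum_distrib_left[symmetric] below_def
    by (subst det_sum_rows[where g = "\<lambda>i j x. real ((x + (k - i) + j) choose (2 * j))"]) (rule refl)
  also have "mat (Suc k) (Suc k) (\<lambda>(i,j). \<Sum>x=\<nu> (Suc i)..\<nu> i. real ((x + (k - i) + j) choose (2 * j))) =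
     mat (Suc k) (Suc k) (\<lambda>(i,j). real ((\<nu> i + (Suc k - i) + j) choose (2 * j + 1)) -
        (if Suc i < Suc k then real ((\<nu> (Suc i) + (Suc k - Suc i) + j) choose (2 * j + 1)) else 0))"
  proof (rule eq_matI, goal_cases)
    case (1 i j)
    then have i: "i \<le> k" by simp
    show ?case
    proof (cases "i = k")
      case True
      then show ?thesis using 1 zero[of "Suc k"] sum_binomial_interval[OF dec[of k], of "j" "2 * j"]
        by simp
    next
      case False
      then have "Suc k - i = Suc (k - i)" using i by simp
      then show ?thesis using 1 False i sum_binomial_interval[OF dec[of i], of "k - i + j" "2 * j"]
        by (simp add: add.assoc)
    qed
  qed simp_all
  also have "det \<dots> = det (mat (Suc k) (Suc k) (\<lambda>(i,j). real ((\<nu> i + (Suc k - i) + j) choose (2 * j + 1))))"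
    by (rule det_row_differences)
  finally show ?thesis using step(1) unfolding letters by (simp add: alternant_def)
qed

text \<open>
  The dimension formula for the irreducible representations of \<open>Sp(2k)\<close>.  The sign arises because
  the arguments decrease while the degrees increase.
\<close>

lemma card_fillings_symplectic:
  assumes "\<And>i. \<nu> (Suc i) \<le> \<nu> i" "\<And>i. k \<le> i \<Longrightarrow> \<nu> i = 0"
  shows "finite (fillings (symplectic_letters k) \<nu>) \<and>
      real (card (fillings (symplectic_letters k) \<nu>)) =
        (-1) ^ (k choose 2) * alternant k (\<lambda>j l. real ((l + j) choose (2 * j + 1))) (\<lambda>i. \<nu> i + (k - i))"
  using assms
proof (induction k arbitrary: \<nu>)
  case 0
  then have "fillings (symplectic_letters 0) \<nu> = {\<lambda>_. []}"
    by (auto simp: fillings_def symplectic_letters_def fun_eq_iff)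
  then show ?case by (simp add: alternant_def numeral_2_eq_2)
next
  case (Suc k)
  show ?case
    by (rule card_fillings_even_step, rule card_fillings_odd_step) (use Suc in blast)+
qed

section \<open>Vertical strips and sign-reversing toggles\<close>

definition vertical_strips :: "nat \<Rightarrow> (nat \<Rightarrow> nat) \<Rightarrow> (nat \<Rightarrow> nat) set" where
  "vertical_strips n \<nu> = {\<mu> \<in> box n (\<lambda>i. \<nu> i - 1) \<nu>. \<forall>i. \<mu> (Suc i) \<le> \<mu> i}"

lemma finite_vertical_strips [simp, intro]: "finite (vertical_strips n \<nu>)"
  by (simp add: vertical_strips_def)

lemma vertical_stripsD:
  assumes "\<mu> \<in> vertical_strips n \<nu>"
  shows "i < n \<Longrightarrow> \<nu> i \<le> Suc (\<mu> i)" "i < n \<Longrightarrow> \<mu> i \<le> \<nu> i" "n \<le> i \<Longrightarrow> \<mu> i = 0" "\<mu> (Suc i) \<le> \<mu> i"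
  using assms by (auto simp: vertical_strips_def box_def)

text \<open>
  Every choice of \<open>\<epsilon>\<^sub>i \<in> {0, 1}\<close> may be admitted in \<open>\<mu> = \<nu> - \<epsilon>\<close>: if the result is not a partition, then either two rows
  of the determinant coincide, or its last argument is \<open>0\<close>, where all binomials vanish.  The unrestricted sum is
  evaluated row by row.
\<close>

lemma sum_vertical_strips_alternant:
  assumes nu: "\<nu> \<in> partitions n r"
  shows "(\<Sum>\<mu>\<in>vertical_strips n \<nu>. t ^ (\<Sum>i<n. \<nu> i - \<mu> i) *
           alternant n (\<lambda>j l. real ((l + j) choose (2 * j + 1))) (\<lambda>i. \<mu> i + (n - i))) =
         alternant n (\<lambda>j l. real ((l + j) choose (2 * j + 1)) + t * real ((l - 1 + j) choose (2 * j + 1)))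
           (\<lambda>i. \<nu> i + (n - i))"
proof -
  let ?p = "\<lambda>j l. real ((l + j) choose (2 * j + 1))"
  let ?l = "\<lambda>i. \<nu> i + (n - i)"
  define E where "E = box n (\<lambda>_. 0) (\<lambda>_. 1)"
  define H where "H = (\<lambda>\<epsilon>. (\<Prod>i<n. t ^ \<epsilon> i) * alternant n ?p (\<lambda>i. ?l i - \<epsilon> i))"
  define E' where "E' = {\<epsilon> \<in> E. (\<forall>i<n. \<epsilon> i \<le> \<nu> i) \<and> (\<forall>i. \<nu> (Suc i) - \<epsilon> (Suc i) \<le> \<nu> i - \<epsilon> i)}"
  have dec: "\<nu> (Suc i) \<le> \<nu> i" and zero: "n \<le> i \<Longrightarrow> \<nu> i = 0" for i
    using nu by (auto simp: partitions_def)
  have inE: "\<epsilon> i \<le> 1" "n \<le> i \<Longrightarrow> \<epsilon> i = 0" if "\<epsilon> \<in> E" for \<epsilon> i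
    using that by (cases "i < n"; auto simp: E_def box_def)+
  have vanish: "H \<epsilon> = 0" if eps: "\<epsilon> \<in> E" "\<epsilon> \<notin> E'" for \<epsilon>
  proof (cases "\<exists>i. Suc i < n \<and> \<nu> (Suc i) = \<nu> i \<and> \<epsilon> i = 1 \<and> \<epsilon> (Suc i) = 0")
    case True
    then obtain i where i: "Suc i < n" "\<nu> (Suc i) = \<nu> i" "\<epsilon> i = 1" "\<epsilon> (Suc i) = 0" by blast
    then have "?l i - \<epsilon> i = ?l (Suc i) - \<epsilon> (Suc i)" by simp
    then have "alternant n ?p (\<lambda>i. ?l i - \<epsilon> i) = 0"
      using i(1) by (intro alternant_eq_rows[of i n "Suc i"]) auto
    then show ?thesis by (simp add: H_def)
  next
    case False
    have down: "\<epsilon> (Suc i) = 1" if "Suc i < n" "\<nu> (Suc i) = \<nu> i" "\<epsilon> i = 1" for i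
    proof -
      have "\<epsilon> (Suc i) \<noteq> 0"
      proof
        assume "\<epsilon> (Suc i) = 0"
        with that have "Suc i < n \<and> \<nu> (Suc i) = \<nu> i \<and> \<epsilon> i = 1 \<and> \<epsilon> (Suc i) = 0" by simp
        then show False by (rule notE[OF False exI])
      qed
      then show ?thesis using inE(1)[OF eps(1), of "Suc i"] by simp
    qed
    have "\<exists>i<n. \<nu> i = 0 \<and> \<epsilon> i = 1"
    proof (rule ccontr)
      assume neg: "\<not> (\<exists>i<n. \<nu> i = 0 \<and> \<epsilon> i = 1)"
      have le: "\<epsilon> i \<le> \<nu> i" if "i < n" for i
        using neg that inE(1)[OF eps(1), of i] by (cases "\<epsilon> i = 0") auto
      have "\<nu> (Suc i) - \<epsilon> (Suc i) \<le> \<nu> i - \<epsilon> i" for i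
      proof (cases "Suc i < n \<and> \<nu> (Suc i) = \<nu> i \<and> \<epsilon> i = 1")
        case True
        then show ?thesis using down[of i] by simp
      next
        case F: False
        then show ?thesis
          using dec[of i] inE[OF eps(1), of i] inE[OF eps(1), of "Suc i"] zero[of "Suc i"]
          by (cases "Suc i < n"; cases "\<epsilon> i = 1") auto
      qed
      then show False using le eps by (auto simp: E'_def)
    qed
    then obtain i where i: "i < n" "\<nu> i = 0" "\<epsilon> i = 1" by blast
    have "\<epsilon> k = 1 \<and> \<nu> k = 0" if "i \<le> k" "k < n" for k
      using that
    proof (induction k rule: dec_induct)
      case (step k)
      then show ?case using down[of k] dec[of k] by auto
    qed (use i in simp)
    from this[of "n - 1"] have "\<nu> (n - 1) = 0" "\<epsilon> (n - 1) = 1" using i(1) by auto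
    then have "alternant n ?p (\<lambda>i. ?l i - \<epsilon> i) = 0"
      using i(1) by (intro alternant_zero_row[of "n - 1"]) auto
    then show ?thesis by (simp add: H_def)
  qed
  have "(\<Sum>\<mu>\<in>vertical_strips n \<nu>. t ^ (\<Sum>i<n. \<nu> i - \<mu> i) * alternant n ?p (\<lambda>i. \<mu> i + (n - i))) = (\<Sum>\<epsilon>\<in>E'. H \<epsilon>)"
  proof (rule sum.reindex_bij_witness[where i = "\<lambda>\<epsilon> i. \<nu> i - \<epsilon> i" and j = "\<lambda>\<mu> i. \<nu> i - \<mu> i"])
    fix \<mu> assume mu: "\<mu> \<in> vertical_strips n \<nu>"
    have le: "\<mu> i \<le> \<nu> i" for i
      using vertical_stripsD[OF mu, of i] zero[of i] by (cases "i < n") auto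
    show inv: "(\<lambda>i. \<nu> i - (\<nu> i - \<mu> i)) = \<mu>" using le by (auto simp: fun_eq_iff)
    have "\<nu> i - \<mu> i \<le> 1" "n \<le> i \<Longrightarrow> \<nu> i - \<mu> i = 0" if "True" for i
      using vertical_stripsD[OF mu, of i] zero[of i] by (cases "i < n"; auto)+
    then show "(\<lambda>i. \<nu> i - \<mu> i) \<in> E'"
      using vertical_stripsD(4)[OF mu] le by (simp add: E'_def E_def box_def)
    show "H (\<lambda>i. \<nu> i - \<mu> i) = t ^ (\<Sum>i<n. \<nu> i - \<mu> i) * alternant n ?p (\<lambda>i. \<mu> i + (n - i))"
    proof -
      have "?l i - (\<nu> i - \<mu> i) = \<mu> i + (n - i)" for i using le[of i] by simp
      then show ?thesis by (simp only: H_def power_sum)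
    qed
  next
    fix \<epsilon> assume eps: "\<epsilon> \<in> E'"
    then have E: "\<epsilon> \<in> E" and le: "\<And>i. i < n \<Longrightarrow> \<epsilon> i \<le> \<nu> i"
      and d: "\<And>i. \<nu> (Suc i) - \<epsilon> (Suc i) \<le> \<nu> i - \<epsilon> i" by (auto simp: E'_def)
    show "(\<lambda>i. \<nu> i - (\<nu> i - \<epsilon> i)) = \<epsilon>"
    proof
      fix i show "\<nu> i - (\<nu> i - \<epsilon> i) = \<epsilon> i"
        using le[of i] zero[of i] inE(2)[OF E, of i] by (cases "i < n") auto
    qed
    show "(\<lambda>i. \<nu> i - \<epsilon> i) \<in> vertical_strips n \<nu>"
      using d zero inE(1)[OF E] by (auto simp: vertical_strips_def box_def intro: diff_le_mono2)
  qed
  also have "\<dots> = (\<Sum>\<epsilon>\<in>E. H \<epsilon>)"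
    by (rule sum.mono_neutral_left) (use vanish in \<open>auto simp: E_def E'_def\<close>)
  also have "\<dots> = (\<Sum>\<epsilon>\<in>E. det (mat n n (\<lambda>(i,j). t ^ \<epsilon> i * ?p j (?l i - \<epsilon> i))))"
    unfolding H_def alternant_def
    by (rule sum.cong[OF refl], rule det_scale_rows[symmetric])
  also have "\<dots> = det (mat n n (\<lambda>(i,j). \<Sum>x=0..1. t ^ x * ?p j (?l i - x)))"
    unfolding E_def by (rule det_sum_rows[where g = "\<lambda>i j x. t ^ x * ?p j (?l i - x)"])
  also have "\<dots> = alternant n (\<lambda>j l. ?p j l + t * ?p j (l - 1)) ?l"
    unfolding alternant_def by (simp add: numeral_2_eq_2 cong: if_cong)
  finally show ?thesis .
qed

lemma binomial_Suc_lower: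
  "real (n choose Suc k) * (real k + 1) = real (n choose k) * (real n - real k)"
proof -
  have "real (Suc k * (Suc n choose Suc k)) = real (Suc n * (n choose k))"
    by (simp only: Suc_times_binomial)
  then show ?thesis by (simp add: algebra_simps)
qed

lemma binomial_Suc_upper:
  "real (Suc n choose Suc k) * (real k + 1) = real (n choose k) * (real n + 1)"
proof -
  have "real (Suc k * (Suc n choose Suc k)) = real (Suc n * (n choose k))"
    by (simp only: Suc_times_binomial)
  then show ?thesis by (simp add: algebra_simps)
qed

lemma central_binomial_product:
  "real ((a + j) choose (2 * j)) * fact (2 * j) =
   (\<Prod>m<j. ((real a + 1 / 2)\<^sup>2 - (real m + 1 / 2)\<^sup>2))"
proof (induction j)
  case (Suc j)
  have 1: "real (Suc (a + j) choose Suc (Suc (2 * j))) * (2 * real j + 2) =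
        real ((a + j) choose Suc (2 * j)) * (real a + real j + 1)"
    using binomial_Suc_upper[of "a + j" "Suc (2 * j)"] by (simp add: algebra_simps)
  have 2: "real ((a + j) choose Suc (2 * j)) * (2 * real j + 1) =
        real ((a + j) choose (2 * j)) * (real a - real j)"
    using binomial_Suc_lower[of "a + j" "2 * j"] by (simp add: algebra_simps)
  have "real ((a + Suc j) choose (2 * Suc j)) * fact (2 * Suc j) =
        (real (Suc (a + j) choose Suc (Suc (2 * j))) * (2 * real j + 2)) * (2 * real j + 1) * fact (2 * j)"
    by (simp add: algebra_simps)
  also have "\<dots> = (real ((a + j) choose Suc (2 * j)) * (2 * real j + 1)) * (real a + real j + 1) * fact (2 * j)"
    unfolding 1 by simp
  also have "\<dots> = (real ((a + j) choose (2 * j)) * fact (2 * j)) * ((real a - real j) * (real a + real j + 1))"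
    unfolding 2 by simp
  also have "(real a - real j) * (real a + real j + 1) = (real a + 1 / 2)\<^sup>2 - (real j + 1 / 2)\<^sup>2"
    by (simp add: power2_eq_square algebra_simps)
  finally show ?case using Suc by simp
qed simp

text \<open>
  With \<open>l = a + 1\<close>, both binomials are multiples of \<open>(a + j choose 2 j)\<close>, by \<open>(a + 1 + j) / (2 j + 1)\<close> and
  \<open>(a - j) / (2 j + 1)\<close>; the numerators add up to \<open>2 a + 1\<close>, which is \<open>2 y\<close>, and their difference cancels the denominator.
\<close>

lemma strip_polynomials:
  assumes "l \<ge> 1"
  shows "real ((l + j) choose (2 * j + 1)) + real ((l - 1 + j) choose (2 * j + 1)) =
      2 / fact (2 * j + 1) * ((real l - 1 / 2) ^ 1 * (\<Prod>m<j. ((real l - 1 / 2)\<^sup>2 - (real m + 1 / 2)\<^sup>2)))"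
    and "real ((l + j) choose (2 * j + 1)) - real ((l - 1 + j) choose (2 * j + 1)) =
      1 / fact (2 * j) * ((real l - 1 / 2) ^ 0 * (\<Prod>m<j. ((real l - 1 / 2)\<^sup>2 - (real m + 1 / 2)\<^sup>2)))"
proof -
  obtain a where a: "l = Suc a" using assms by (cases l) auto
  have la: "real l - 1 / 2 = real a + 1 / 2" using a by simp
  have prod: "(\<Prod>m<j. ((real l - 1 / 2)\<^sup>2 - (real m + 1 / 2)\<^sup>2)) = real ((a + j) choose (2 * j)) * fact (2 * j)"
    unfolding la by (rule central_binomial_product[symmetric])
  have pascal: "real ((l + j) choose (2 * j + 1)) =
      real ((a + j) choose (2 * j)) + real ((a + j) choose (2 * j + 1))"
    using a by simp
  have lower: "real ((a + j) choose (2 * j + 1)) * (2 * real j + 1) =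
      real ((a + j) choose (2 * j)) * (real a - real j)"
    using binomial_Suc_lower[of "a + j" "2 * j"] by (simp add: algebra_simps)
  have l1: "l - 1 + j = a + j" using a by simp
  show "real ((l + j) choose (2 * j + 1)) - real ((l - 1 + j) choose (2 * j + 1)) =
      1 / fact (2 * j) * ((real l - 1 / 2) ^ 0 * (\<Prod>m<j. ((real l - 1 / 2)\<^sup>2 - (real m + 1 / 2)\<^sup>2)))"
    unfolding prod pascal l1 by simp
  have "(real ((a + j) choose (2 * j)) + 2 * real ((a + j) choose (2 * j + 1))) * (2 * real j + 1) =
        real ((a + j) choose (2 * j)) * (2 * (real a + 1 / 2))"
    using lower by (simp add: algebra_simps)
  then have "real ((a + j) choose (2 * j)) + 2 * real ((a + j) choose (2 * j + 1)) =
        real ((a + j) choose (2 * j)) * (2 * (real a + 1 / 2)) / (2 * real j + 1)"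
    by (simp add: field_simps)
  moreover define F :: real where "F = fact (2 * j)"
  moreover have "fact (2 * j + 1) = (2 * real j + 1) * F" "F \<noteq> 0" by (simp_all add: F_def)
  moreover have "2 * real j + 1 \<noteq> 0" by linarith
  ultimately have "real ((a + j) choose (2 * j)) + 2 * real ((a + j) choose (2 * j + 1)) =
      2 / fact (2 * j + 1) * ((real a + 1 / 2) ^ 1 * (real ((a + j) choose (2 * j)) * fact (2 * j)))"
    by (simp only: F_def[symmetric]) (simp add: divide_simps)
  then show "real ((l + j) choose (2 * j + 1)) + real ((l - 1 + j) choose (2 * j + 1)) =
      2 / fact (2 * j + 1) * ((real l - 1 / 2) ^ 1 * (\<Prod>m<j. ((real l - 1 / 2)\<^sup>2 - (real m + 1 / 2)\<^sup>2)))"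
    unfolding prod pascal l1 unfolding la by linarith
qed

lemma strip_alternant_eq_parity_alternant:
  assumes "t = 1 \<and> e = 1 \<or> t = -1 \<and> e = 0"
  obtains K where "\<And>\<nu>. alternant n (\<lambda>j l. real ((l + j) choose (2 * j + 1)) + t * real ((l - 1 + j) choose (2 * j + 1)))
           (\<lambda>i. \<nu> i + (n - i)) =
         K * parity_alternant n e (\<lambda>i. real (\<nu> i) + real (n - 1 - i) + 1 / 2)"
proof
  define c where "c = (\<lambda>j. if t = 1 then 2 / fact (2 * j + 1) else 1 / fact (2 * j) :: real)"
  fix \<nu> :: "nat \<Rightarrow> nat"
  have "alternant n (\<lambda>j l. real ((l + j) choose (2 * j + 1)) + t * real ((l - 1 + j) choose (2 * j + 1)))
           (\<lambda>i. \<nu> i + (n - i)) =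
        alternant n (\<lambda>j x. c j * (x ^ e * (\<Prod>m<j. (x\<^sup>2 - (real m + 1 / 2)\<^sup>2))))
           (\<lambda>i. real (\<nu> i) + real (n - 1 - i) + 1 / 2)"
  proof (rule alternant_cong)
    fix i j assume "i < n" "j < n"
    then have l: "\<nu> i + (n - i) \<ge> 1" and y: "real (\<nu> i + (n - i)) - 1 / 2 = real (\<nu> i) + real (n - 1 - i) + 1 / 2"
      by (auto simp: of_nat_diff)
    show "real ((\<nu> i + (n - i) + j) choose (2 * j + 1)) + t * real ((\<nu> i + (n - i) - 1 + j) choose (2 * j + 1)) =
      c j * ((real (\<nu> i) + real (n - 1 - i) + 1 / 2) ^ e *
        (\<Prod>m<j. ((real (\<nu> i) + real (n - 1 - i) + 1 / 2)\<^sup>2 - (real m + 1 / 2)\<^sup>2)))"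
      using strip_polynomials[OF l, of j] assms unfolding y c_def by auto
  qed
  then show "alternant n (\<lambda>j l. real ((l + j) choose (2 * j + 1)) + t * real ((l - 1 + j) choose (2 * j + 1)))
           (\<lambda>i. \<nu> i + (n - i)) =
       (\<Prod>j<n. c j) * parity_alternant n e (\<lambda>i. real (\<nu> i) + real (n - 1 - i) + 1 / 2)"
    unfolding alternant_squares parity_alternant_eq_prod .
qed

text \<open>
  The constant in front of the alternant is found without computation, because there is exactly one
  tableau of empty shape.
\<close>

lemma sum_vertical_strips_card:
  assumes te: "t = 1 \<and> e = 1 \<or> t = -1 \<and> e = 0"
    and nu: "\<nu> \<in> partitions n r"
  shows "parity_alternant n e (\<lambda>i. real (n - 1 - i) + 1 / 2) \<noteq> 0"
    and "(\<Sum>\<mu>\<in>vertical_strips n \<nu>. t ^ (\<Sum>i<n. \<nu> i - \<mu> i) * real (card (fillings (symplectic_letters n) \<mu>))) =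
      parity_alternant n e (\<lambda>i. real (\<nu> i) + real (n - 1 - i) + 1 / 2) /
      parity_alternant n e (\<lambda>i. real (n - 1 - i) + 1 / 2)"
proof -
  obtain K where K: "\<And>\<nu>. alternant n (\<lambda>j l. real ((l + j) choose (2 * j + 1)) + t * real ((l - 1 + j) choose (2 * j + 1)))
           (\<lambda>i. \<nu> i + (n - i)) =
         K * parity_alternant n e (\<lambda>i. real (\<nu> i) + real (n - 1 - i) + 1 / 2)"
    using strip_alternant_eq_parity_alternant[OF te] by blast
  let ?s = "(-1) ^ (n choose 2) :: real"
  have val: "(\<Sum>\<mu>\<in>vertical_strips n \<nu>. t ^ (\<Sum>i<n. \<nu> i - \<mu> i) * real (card (fillings (symplectic_letters n) \<mu>))) =
     ?s * K * parity_alternant n e (\<lambda>i. real (\<nu> i) + real (n - 1 - i) + 1 / 2)"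
    if "\<nu> \<in> partitions n r" for \<nu> r
  proof -
    have "real (card (fillings (symplectic_letters n) \<mu>)) =
        ?s * alternant n (\<lambda>j l. real ((l + j) choose (2 * j + 1))) (\<lambda>i. \<mu> i + (n - i))"
      if "\<mu> \<in> vertical_strips n \<nu>" for \<mu>
      using card_fillings_symplectic[of \<mu> n] vertical_stripsD[OF that] by blast
    then have "(\<Sum>\<mu>\<in>vertical_strips n \<nu>. t ^ (\<Sum>i<n. \<nu> i - \<mu> i) * real (card (fillings (symplectic_letters n) \<mu>))) =
      ?s * (\<Sum>\<mu>\<in>vertical_strips n \<nu>. t ^ (\<Sum>i<n. \<nu> i - \<mu> i) *
           alternant n (\<lambda>j l. real ((l + j) choose (2 * j + 1))) (\<lambda>i. \<mu> i + (n - i)))"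
      unfolding sum_distrib_left by (intro sum.cong) auto
    also have "\<dots> = ?s * K * parity_alternant n e (\<lambda>i. real (\<nu> i) + real (n - 1 - i) + 1 / 2)"
      unfolding sum_vertical_strips_alternant[OF that] K by simp
    finally show ?thesis .
  qed
  have "vertical_strips n (\<lambda>_. 0) = {\<lambda>_. 0}"
    by (auto simp: vertical_strips_def box_def fun_eq_iff) (metis not_le)
  moreover have "fillings (symplectic_letters n) (\<lambda>_. 0) = {\<lambda>_. []}"
    by (auto simp: fillings_def fun_eq_iff)
  ultimately have norm: "?s * K * parity_alternant n e (\<lambda>i. real (n - 1 - i) + 1 / 2) = 1"
    using val[of "\<lambda>_. 0" 0] by (simp add: partitions_def)
  then show "parity_alternant n e (\<lambda>i. real (n - 1 - i) + 1 / 2) \<noteq> 0" by auto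
  then show "(\<Sum>\<mu>\<in>vertical_strips n \<nu>. t ^ (\<Sum>i<n. \<nu> i - \<mu> i) * real (card (fillings (symplectic_letters n) \<mu>))) =
      parity_alternant n e (\<lambda>i. real (\<nu> i) + real (n - 1 - i) + 1 / 2) /
      parity_alternant n e (\<lambda>i. real (n - 1 - i) + 1 / 2)"
    using norm unfolding val[OF nu] by (simp add: field_simps)
qed

text \<open>
  The differences \<open>y\<^sub>j - y\<^sub>i\<close> are unaffected by the shift by \<open>r/2\<close> and cancel; the sums \<open>y\<^sub>i + y\<^sub>j\<close> remain.
\<close>

lemma parity_alternant_ratio:
  assumes nz: "parity_alternant n e (\<lambda>i. real (n - 1 - i) + 1 / 2) \<noteq> 0"
  shows "parity_alternant n e (\<lambda>i. real (n - 1 - i) + 1 / 2 + real r / 2) /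
      parity_alternant n e (\<lambda>i. real (n - 1 - i) + 1 / 2) =
    (\<Prod>i=1..n. (2 * real i + real r - 1) / (2 * real i - 1)) ^ e *
    (\<Prod>j=1..n. \<Prod>i=Suc j..n. (real i + real j + real r - 1) / (real i + real j - 1))"
proof -
  let ?\<rho> = "\<lambda>i. real (n - 1 - i) + 1 / 2" and ?b = "\<lambda>i. real (n - 1 - i) + 1 / 2 + real r / 2"
  have "parity_alternant n e ?b / parity_alternant n e ?\<rho> =
     (\<Prod>i<n. (?b i / ?\<rho> i) ^ e) * (\<Prod>j<n. \<Prod>i<j. ((?b j)\<^sup>2 - (?b i)\<^sup>2) / ((?\<rho> j)\<^sup>2 - (?\<rho> i)\<^sup>2))"
    unfolding parity_alternant_eq_prod by (simp add: prod_dividef power_divide)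
  also have "(\<Prod>i<n. (?b i / ?\<rho> i) ^ e) = (\<Prod>i=1..n. (2 * real i + real r - 1) / (2 * real i - 1)) ^ e"
    unfolding prod_power_distrib[symmetric]
    by (rule arg_cong[where f = "\<lambda>x. x ^ e"],
        rule prod.reindex_bij_witness[where i = "\<lambda>i. n - i" and j = "\<lambda>i. n - i"])
       (auto simp: of_nat_diff field_simps)
  also have "(\<Prod>j<n. \<Prod>i<j. ((?b j)\<^sup>2 - (?b i)\<^sup>2) / ((?\<rho> j)\<^sup>2 - (?\<rho> i)\<^sup>2)) =
    (\<Prod>j=1..n. \<Prod>i=Suc j..n. (real i + real j + real r - 1) / (real i + real j - 1))"
  proof (rule prod.reindex_bij_witness[where i = "\<lambda>i. n - i" and j = "\<lambda>i. n - i"])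
    fix j assume j: "j \<in> {..<n}"
    show "(\<Prod>i=Suc (n - j)..n. (real i + real (n - j) + real r - 1) / (real i + real (n - j) - 1)) =
        (\<Prod>i<j. ((?b j)\<^sup>2 - (?b i)\<^sup>2) / ((?\<rho> j)\<^sup>2 - (?\<rho> i)\<^sup>2))"
    proof (rule prod.reindex_bij_witness[where i = "\<lambda>i. n - i" and j = "\<lambda>i. n - i"])
      fix i assume i: "i \<in> {Suc (n - j)..n}"
      define x where "x = real i"
      define y where "y = real (n - j)"
      have ri: "?\<rho> (n - i) = x - 1 / 2" and rj: "?\<rho> j = y - 1 / 2"
        using i j by (auto simp: x_def y_def of_nat_diff)
      have ne: "y - x \<noteq> 0" using i j by (auto simp: x_def y_def)
      have pos: "x + y - 1 \<noteq> 0" using i j by (auto simp: x_def y_def of_nat_diff)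
      have "(y - 1 / 2 + real r / 2)\<^sup>2 - (x - 1 / 2 + real r / 2)\<^sup>2 = (y - x) * (x + y + real r - 1)"
        by (simp add: power2_eq_square algebra_simps)
      moreover have "(y - 1 / 2)\<^sup>2 - (x - 1 / 2)\<^sup>2 = (y - x) * (x + y - 1)"
        by (simp add: power2_eq_square algebra_simps)
      ultimately show "((?b j)\<^sup>2 - (?b (n - i))\<^sup>2) / ((?\<rho> j)\<^sup>2 - (?\<rho> (n - i))\<^sup>2) =
           (real i + real (n - j) + real r - 1) / (real i + real (n - j) - 1)"
        unfolding ri rj x_def[symmetric] y_def[symmetric] using ne by simp
    qed (use j in auto)
  qed auto
  finally show ?thesis .
qed

lemma prod_square_symmetric:
  fixes g :: "nat \<Rightarrow> nat \<Rightarrow> real"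
  assumes "\<And>i j. g i j = g j i"
  shows "(\<Prod>i=1..n. \<Prod>j=1..n. g i j) = (\<Prod>i=1..n. g i i) * (\<Prod>j=1..n. \<Prod>i=Suc j..n. g i j)\<^sup>2"
proof (induction n)
  case (Suc n)
  have "(\<Prod>j=1..Suc n. \<Prod>i=Suc j..Suc n. g i j) = (\<Prod>j=1..n. (\<Prod>i=Suc j..n. g i j) * g (Suc n) j)"
    by (simp add: mult.commute)
  then have 1: "(\<Prod>j=1..Suc n. \<Prod>i=Suc j..Suc n. g i j) =
      (\<Prod>j=1..n. \<Prod>i=Suc j..n. g i j) * (\<Prod>j=1..n. g (Suc n) j)"
    by (simp add: prod.distrib)
  have "(\<Prod>i=1..Suc n. \<Prod>j=1..Suc n. g i j) =
     (\<Prod>i=1..n. \<Prod>j=1..n. g i j) * (\<Prod>i=1..n. g i (Suc n)) * (\<Prod>j=1..n. g (Suc n) j) * g (Suc n) (Suc n)"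
    by (simp add: prod.distrib mult_ac)
  also have "(\<Prod>i=1..n. g i (Suc n)) = (\<Prod>j=1..n. g (Suc n) j)"
    by (simp add: assms[of _ "Suc n"])
  finally show ?case unfolding 1 Suc by (simp add: power2_eq_square mult_ac)
qed simp

text \<open>
  The two signs differ by the factor \<open>(-1) ^ \<bar>\<mu>\<bar>\<close>, so only pairs with \<open>\<bar>\<mu>\<bar> + r n\<close> odd have to cancel.  Consider the rows
  at odd distance from row \<open>n\<close>; whether the strip can be toggled in one of them depends on the two
  neighbouring rows of \<open>\<nu>\<close> and on \<open>\<mu>\<close> alone, so toggling the first possible one is an involution.  If no such row can be
  toggled, then, from the bottom upwards, the rows of \<open>\<mu>\<close> are equal in pairs, and for odd \<open>n\<close> the first row has
  length \<open>r\<close>; so \<open>\<bar>\<mu>\<bar>\<close> has the parity of \<open>r n\<close>.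
\<close>

lemma sum_neg_one_power_strips:
  fixes g :: "(nat \<Rightarrow> nat) \<Rightarrow> real"
  shows "(\<Sum>\<nu>\<in>partitions n r. \<Sum>\<mu>\<in>vertical_strips n \<nu>. (-1) ^ (\<Sum>i<n. \<nu> i) * g \<mu>) =
    (-1) ^ (r * n) * (\<Sum>\<nu>\<in>partitions n r. \<Sum>\<mu>\<in>vertical_strips n \<nu>. (-1) ^ (\<Sum>i<n. \<nu> i - \<mu> i) * g \<mu>)"
proof -
  let ?s = "\<lambda>\<nu>. \<Sum>i<n. \<nu> i :: nat"
  define P where "P = Sigma (partitions n r) (vertical_strips n)"
  define S where "S = {x \<in> P. odd (?s (snd x) + r * n)}"
  define free where "free = (\<lambda>(\<nu>, \<mu>) i. i < n \<and> odd (n - i) \<and> (if i = 0 then \<mu> 0 < r else \<mu> i < \<nu> (i - 1)) \<and> \<nu> (Suc i) \<le> \<mu> i)"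
  define row where "row = (\<lambda>x. LEAST i. free x i)"
  define \<phi> where "\<phi> = (\<lambda>x. ((fst x)(row x := 2 * snd x (row x) + 1 - fst x (row x)), snd x :: nat \<Rightarrow> nat))"
  define F where "F = (\<lambda>x. (-1) ^ ?s (fst x) * g (snd x))"
  have ex: "\<exists>i. free (\<nu>, \<mu>) i" if "(\<nu>, \<mu>) \<in> S" for \<nu> \<mu>
  proof (rule ccontr)
    assume "\<not> (\<exists>i. free (\<nu>, \<mu>) i)"
    then have stuck: "\<not> free (\<nu>, \<mu>) i" for i by blast
    have nu: "\<nu> \<in> partitions n r" and mu: "\<mu> \<in> vertical_strips n \<nu>" and par: "odd (?s \<mu> + r * n)"
      using that by (auto simp: S_def P_def)
    have mu_le: "\<mu> i \<le> \<nu> i" for i using vertical_stripsD(2,3)[OF mu, of i] by (cases "i < n") auto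
    \<comment> \<open>For \<open>q = 0\<close> this holds because both partitions vanish at \<open>n\<close>.\<close>
    have pairs: "\<nu> (n - 2 * q) = \<mu> (n - 2 * q) \<and> even (\<Sum>i=n - 2 * q..<n. \<mu> i)" if "2 * q \<le> n" for q
      using that
    proof (induction q)
      case 0
      then show ?case using nu mu by (auto simp: partitions_def vertical_strips_def box_def)
    next
      case (Suc q)
      define i where "i = n - 2 * q - 1"
      have i: "i < n" "odd (n - i)" "i \<noteq> 0" "Suc i = n - 2 * q" "i - 1 = n - 2 * Suc q" "Suc (i - 1) = i"
        using Suc.prems by (auto simp: i_def)
      have IH: "\<nu> (Suc i) = \<mu> (Suc i)" "even (\<Sum>i=Suc i..<n. \<mu> i)" using Suc i(4) by auto
      have "\<nu> (i - 1) \<le> \<mu> i"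
        using stuck[of i] i IH(1) vertical_stripsD(4)[OF mu, of i] by (auto simp: free_def)
      moreover have "\<mu> i \<le> \<mu> (i - 1)" using vertical_stripsD(4)[OF mu, of "i - 1"] i(6) by simp
      ultimately have eq: "\<mu> (i - 1) = \<mu> i" "\<nu> (i - 1) = \<mu> i" using mu_le[of "i - 1"] by auto
      have "(\<Sum>i=i - 1..<n. \<mu> i) = \<mu> (i - 1) + (\<mu> i + (\<Sum>i=Suc i..<n. \<mu> i))"
        using i(1,6) sum.atLeast_Suc_lessThan[of "i - 1" n \<mu>] sum.atLeast_Suc_lessThan[of i n \<mu>] by simp
      then show ?case unfolding i(5)[symmetric] using eq IH(2) by simp
    qed
    show False
    proof (cases "even n")
      case True
      then obtain q where "n = 2 * q" by (elim evenE)
      then show False using pairs[of q] par by (simp add: lessThan_atLeast0)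
    next
      case odd: False
      then obtain q where q: "n = 2 * q + 1" by (elim oddE)
      have one: "n - 2 * q = 1" and "n > 0" using q by auto
      then have IH: "\<nu> 1 = \<mu> 1" "even (\<Sum>i=1..<n. \<mu> i)" using pairs[of q] q by auto
      have "\<not> \<mu> 0 < r"
        using stuck[of 0] odd \<open>n > 0\<close> IH(1) vertical_stripsD(4)[OF mu, of 0] by (auto simp: free_def)
      moreover have "\<mu> 0 \<le> r" using mu_le[of 0] nu by (auto simp: partitions_def intro: le_trans)
      ultimately have "\<mu> 0 = r" by simp
      moreover have "?s \<mu> = \<mu> 0 + (\<Sum>i=1..<n. \<mu> i)"
        unfolding lessThan_atLeast0 using sum.atLeast_Suc_lessThan[of 0 n \<mu>] \<open>n > 0\<close> by simp
      ultimately show False using par IH(2) odd by simp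
    qed
  qed
  have phi: "\<phi> x \<in> S \<and> \<phi> (\<phi> x) = x \<and> F (\<phi> x) = - F x" if "x \<in> S" for x
  proof -
    obtain \<nu> \<mu> where x: "x = (\<nu>, \<mu>)" by (cases x)
    have nu: "\<nu> \<in> partitions n r" and mu: "\<mu> \<in> vertical_strips n \<nu>" and par: "odd (?s \<mu> + r * n)"
      using that by (auto simp: S_def P_def x)
    define k where "k = row x"
    have "free x k" unfolding k_def row_def using ex[of \<nu> \<mu>] that x by (metis LeastI)
    then have k: "k < n" "odd (n - k)" "k = 0 \<Longrightarrow> \<mu> 0 < r" "k \<noteq> 0 \<Longrightarrow> \<mu> k < \<nu> (k - 1)" "\<nu> (Suc k) \<le> \<mu> k"
      by (auto simp: free_def x split: if_splits)
    define \<nu>' where "\<nu>' = \<nu>(k := 2 * \<mu> k + 1 - \<nu> k)"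
    have phi_x: "\<phi> x = (\<nu>', \<mu>)" unfolding \<phi>_def k_def[symmetric] \<nu>'_def by (simp add: x)
    have nk: "\<nu> k = \<mu> k \<or> \<nu> k = Suc (\<mu> k)" using vertical_stripsD[OF mu, of k] k(1) by auto
    have dec: "\<nu> (Suc i) \<le> \<nu> i" for i using nu by (auto simp: partitions_def)
    have "\<nu>' \<in> partitions n r"
      unfolding partitions_def
    proof (intro CollectI conjI allI impI)
      fix i
      consider "i = k" | "Suc i = k" | "i \<noteq> k" "Suc i \<noteq> k" by blast
      then show "\<nu>' (Suc i) \<le> \<nu>' i"
        by cases (use k dec[of i] nk in \<open>auto simp: \<nu>'_def\<close>)
      show "\<nu>' 0 \<le> r" using k(3) nk nu by (auto simp: \<nu>'_def partitions_def)
      show "\<nu>' i = 0" if "n \<le> i" using that k(1) nu by (auto simp: \<nu>'_def partitions_def)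
    qed
    moreover have "\<mu> \<in> vertical_strips n \<nu>'"
      using mu nk k(1) unfolding vertical_strips_def box_def by (auto simp: \<nu>'_def)
    ultimately have inS: "\<phi> x \<in> S" using par by (simp add: phi_x S_def P_def)
    have free_eq: "free (\<phi> x) i = free x i" for i
    proof (cases "odd (n - i) \<and> i < n")
      case True
      then have "Suc i \<noteq> k" "i - 1 \<noteq> k \<or> i = 0" using k(1,2) by (auto simp: Suc_diff_le)
      then show ?thesis unfolding phi_x unfolding x by (auto simp: free_def \<nu>'_def)
    next
      case False
      then show ?thesis unfolding phi_x unfolding x by (auto simp: free_def)
    qed
    have "free (\<phi> x) = free x" by (rule ext) (rule free_eq)
    then have row_phi: "row (\<phi> x) = k" unfolding k_def row_def by simp
    have "\<phi> (\<phi> x) = ((fst (\<phi> x))(row (\<phi> x) := 2 * snd (\<phi> x) (row (\<phi> x)) + 1 - fst (\<phi> x) (row (\<phi> x))), snd (\<phi> x))"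
      by (simp only: \<phi>_def)
    also have "\<dots> = (\<nu>'(k := 2 * \<mu> k + 1 - \<nu>' k), \<mu>)"
      unfolding row_phi unfolding phi_x by simp
    also have "\<dots> = x" unfolding x using nk by (auto simp: \<nu>'_def fun_eq_iff)
    finally have inv: "\<phi> (\<phi> x) = x" .
    have "?s \<nu>' + ?s \<nu> = 2 * (sum \<nu> ({..<n} - {k}) + \<mu> k) + 1"
    proof -
      have "?s \<nu>' = \<nu>' k + sum \<nu>' ({..<n} - {k})" "?s \<nu> = \<nu> k + sum \<nu> ({..<n} - {k})"
        using k(1) by (simp_all add: sum.remove)
      moreover have "sum \<nu>' ({..<n} - {k}) = sum \<nu> ({..<n} - {k})"
        by (rule sum.cong) (auto simp: \<nu>'_def)
      ultimately show ?thesis using nk by (auto simp: \<nu>'_def)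
    qed
    then have "odd (?s \<nu>' + ?s \<nu>)" by simp
    then have "(-1) ^ ?s \<nu>' = - ((-1) ^ ?s \<nu> :: real)" by (auto simp: minus_one_power_iff)
    then have "F (\<phi> x) = - F x" unfolding F_def phi_x by (simp add: x)
    with inS inv show ?thesis by blast
  qed
  have S0: "(\<Sum>x\<in>S. F x) = 0"
    by (rule sum_eq_0_if_sign_reversing[where \<phi> = \<phi>]) (use phi in auto)
  have pt: "(-1) ^ ?s (fst x) * g (snd x) - (-1) ^ (r * n) * ((-1) ^ (\<Sum>i<n. fst x i - snd x i) * g (snd x)) =
        (if x \<in> S then 2 * F x else 0)" if "x \<in> P" for x
  proof -
    obtain \<nu> \<mu> where x: "x = (\<nu>, \<mu>)" by (cases x)
    have mu: "\<mu> \<in> vertical_strips n \<nu>" using that by (simp add: P_def x)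
    have "(\<Sum>i<n. \<nu> i - \<mu> i) + ?s \<mu> = ?s \<nu>"
      unfolding sum.distrib[symmetric]
      by (rule sum.cong) (use vertical_stripsD(2)[OF mu] in simp_all)
    then have "even (\<Sum>i<n. \<nu> i - \<mu> i) \<longleftrightarrow> (even (?s \<nu>) \<longleftrightarrow> even (?s \<mu>))" by (metis even_add)
    then show ?thesis using that by (auto simp: x S_def F_def minus_one_power_iff)
  qed
  have finP: "finite P" unfolding P_def by simp
  have "(\<Sum>x\<in>P. (-1) ^ ?s (fst x) * g (snd x)) -
        (-1) ^ (r * n) * (\<Sum>x\<in>P. (-1) ^ (\<Sum>i<n. fst x i - snd x i) * g (snd x)) =
        (\<Sum>x\<in>P. if x \<in> S then 2 * F x else 0)"
    unfolding sum_distrib_left sum_subtractf[symmetric] by (rule sum.cong) (simp_all only: pt)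
  also have "\<dots> = 2 * (\<Sum>x\<in>S. F x)"
  proof -
    have "(\<Sum>x\<in>P. if x \<in> S then 2 * F x else 0) = (\<Sum>x\<in>S. if x \<in> S then 2 * F x else 0)"
      by (rule sum.mono_neutral_right[OF finP]) (auto simp: S_def)
    then show ?thesis by (simp add: sum_distrib_left)
  qed
  finally have "(\<Sum>x\<in>P. (-1) ^ ?s (fst x) * g (snd x)) =
        (-1) ^ (r * n) * (\<Sum>x\<in>P. (-1) ^ (\<Sum>i<n. fst x i - snd x i) * g (snd x))"
    using S0 by simp
  then show ?thesis unfolding P_def by (simp add: sum.Sigma case_prod_unfold)
qed

section \<open>Sundaram tableaux as fillings with a vertical strip\<close>

text \<open>
  Sundaram tableaux of height at most \<open>n\<close> and width at most \<open>r\<close>, with empty rows appended.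
\<close>

definition padded_tableaux :: "nat \<Rightarrow> nat \<Rightarrow> (nat \<Rightarrow> letter list) set" where
  "padded_tableaux n r = {f. (\<lambda>i. length (f i)) \<in> partitions n r \<and>
     (\<forall>i. sorted (f i) \<and> set (f i) \<subseteq> alphabet n \<and> count_list (f i) Infty \<le> 1 \<and>
        (\<forall>x\<in>set (f i). Unbarred (Suc i) \<le> x)) \<and>
     (\<forall>i j. j < length (f (Suc i)) \<longrightarrow>
        f i ! j < f (Suc i) ! j \<or> f i ! j = Infty \<and> f (Suc i) ! j = Infty)}"

definition padded_rows :: "filling \<Rightarrow> nat \<Rightarrow> letter list" where
  "padded_rows T i = (if i < length T then T ! i else [])"

lemma padded_rows_in:
  assumes "T \<in> sundaram_tableaux n n r"
  shows "padded_rows T \<in> padded_tableaux n r"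
proof -
  have T: "sundaram_tableau n T" "length T \<le> n" "width T \<le> r"
    using assms by (auto simp: sundaram_tableaux_def height_def)
  have dec: "length (T ! Suc i) \<le> length (T ! i)" if "Suc i < length T" for i
    using T(1) that sorted_wrt_nth_less[of "(\<ge>)" "map length T" i "Suc i"]
    by (simp add: sundaram_tableau_def young_shape_def)
  have mem: "T ! i \<in> set T" if "i < length T" for i using that by simp
  have "(\<lambda>i. length (padded_rows T i)) \<in> partitions n r"
    using dec T(2,3) by (auto simp: partitions_def padded_rows_def width_def hd_conv_nth)
  moreover have "sorted (padded_rows T i) \<and> set (padded_rows T i) \<subseteq> alphabet n \<and>
      count_list (padded_rows T i) Infty \<le> 1 \<and> (\<forall>x\<in>set (padded_rows T i). Unbarred (Suc i) \<le> x)" for i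
    using T(1) mem[of i] by (auto simp: padded_rows_def sundaram_tableau_def)
  moreover have "padded_rows T i ! j < padded_rows T (Suc i) ! j \<or>
      padded_rows T i ! j = Infty \<and> padded_rows T (Suc i) ! j = Infty"
    if "j < length (padded_rows T (Suc i))" for i j
    using T(1) that by (auto simp: padded_rows_def sundaram_tableau_def split: if_splits)
  ultimately show ?thesis by (simp add: padded_tableaux_def)
qed

lemma bij_betw_padded_rows:
  "bij_betw padded_rows (sundaram_tableaux n n r) (padded_tableaux n r)"
proof (rule bij_betw_byWitness[where f' = "\<lambda>f. takeWhile (\<lambda>row. row \<noteq> []) (map f [0..<n])"])
  show "\<forall>T\<in>sundaram_tableaux n n r. takeWhile (\<lambda>row. row \<noteq> []) (map (padded_rows T) [0..<n]) = T"
  proof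
    fix T assume "T \<in> sundaram_tableaux n n r"
    then have T: "[] \<notin> set T" "length T \<le> n"
      by (auto simp: sundaram_tableaux_def height_def sundaram_tableau_def young_shape_def)
    have pad: "map (padded_rows T) [0..<n] = T @ replicate (n - length T) []"
      by (rule nth_equalityI) (use T(2) in \<open>auto simp: padded_rows_def nth_append\<close>)
    show "takeWhile (\<lambda>row. row \<noteq> []) (map (padded_rows T) [0..<n]) = T"
      unfolding pad using T(1) by (subst takeWhile_append2) (auto simp: takeWhile_replicate)
  qed
  show "padded_rows ` sundaram_tableaux n n r \<subseteq> padded_tableaux n r"
    using padded_rows_in by blast
  have inv: "padded_rows (takeWhile (\<lambda>row. row \<noteq> []) (map f [0..<n])) = f \<and>
      takeWhile (\<lambda>row. row \<noteq> []) (map f [0..<n]) \<in> sundaram_tableaux n n r"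
    if f: "f \<in> padded_tableaux n r" for f
  proof -
    define T where "T = takeWhile (\<lambda>row. row \<noteq> []) (map f [0..<n])"
    have part: "(\<lambda>i. length (f i)) \<in> partitions n r" using f by (simp add: padded_tableaux_def)
    have len: "length T \<le> n" using length_takeWhile_le[of _ "map f [0..<n]"] by (simp add: T_def)
    have nth: "T ! i = f i" if "i < length T" for i
      using that len takeWhile_nth[of i "\<lambda>row. row \<noteq> []" "map f [0..<n]"] by (simp add: T_def)
    have ne: "[] \<notin> set T" unfolding T_def by (auto dest: set_takeWhileD)
    have beyond: "f i = []" if "length T \<le> i" for i
    proof -
      have "f (length T) = []"
      proof (cases "length T < n")
        case True
        then show ?thesis
          using nth_length_takeWhile[of "\<lambda>row. row \<noteq> []" "map f [0..<n]"] by (simp add: T_def[symmetric])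
      next
        case False
        then show ?thesis using part by (simp add: partitions_def)
      qed
      then show ?thesis using partitions_antimono[OF part that] by simp
    qed
    have rows: "padded_rows T = f" using nth beyond by (auto simp: padded_rows_def fun_eq_iff)
    have anti: "length (f j) \<le> length (f i)" if "i \<le> j" for i j using partitions_antimono[OF part that] .
    have elem: "\<exists>i. i < length T \<and> row = f i" if "row \<in> set T" for row
      using that nth by (auto simp: in_set_conv_nth)
    have "young_shape T" unfolding young_shape_def
      using ne anti nth by (auto simp: sorted_wrt_iff_nth_less)
    moreover have "\<forall>row\<in>set T. set row \<subseteq> alphabet n" "\<forall>row\<in>set T. sorted row \<and> count_list row Infty \<le> 1"
      using elem f unfolding padded_tableaux_def by blast+
    moreover have "\<forall>i j. Suc i < length T \<and> j < length (T ! Suc i) \<longrightarrow>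
        T ! i ! j < T ! Suc i ! j \<or> (T ! i ! j = Infty \<and> T ! Suc i ! j = Infty)"
    proof (intro allI impI)
      fix i j assume ij: "Suc i < length T \<and> j < length (T ! Suc i)"
      have rows: "T ! i = f i" "T ! Suc i = f (Suc i)" using ij by (auto intro: nth)
      then have "j < length (f (Suc i))" using ij by simp
      then have "f i ! j < f (Suc i) ! j \<or> f i ! j = Infty \<and> f (Suc i) ! j = Infty"
        using f by (simp add: padded_tableaux_def)
      then show "T ! i ! j < T ! Suc i ! j \<or> (T ! i ! j = Infty \<and> T ! Suc i ! j = Infty)"
        unfolding rows .
    qed
    moreover have "\<forall>i < length T. \<forall>x \<in> set (T ! i). Unbarred (Suc i) \<le> x"
      using f nth by (simp add: padded_tableaux_def)
    ultimately have "sundaram_tableau n T" by (simp add: sundaram_tableau_def)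
    moreover have "width T \<le> r"
      using partitions_le[OF part, of 0] nth[of 0] by (cases T) (auto simp: width_def)
    ultimately show ?thesis using rows len unfolding T_def[symmetric]
      by (simp add: sundaram_tableaux_def height_def)
  qed
  show "\<forall>f\<in>padded_tableaux n r. padded_rows (takeWhile (\<lambda>row. row \<noteq> []) (map f [0..<n])) = f"
    using inv by blast
  show "(\<lambda>f. takeWhile (\<lambda>row. row \<noteq> []) (map f [0..<n])) ` padded_tableaux n r \<subseteq> sundaram_tableaux n n r"
    using inv by blast
qed

lemma count_list_eq_length_filter_diff:
  "count_list xs a = length xs - length (filter (\<lambda>x. x \<noteq> a) xs)"
proof -
  have "count_list xs a + length (filter (\<lambda>x. x \<noteq> a) xs) = length xs"
    by (induction xs) auto
  then show ?thesis by simp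
qed

lemma statistics_padded_rows:
  assumes "length T \<le> n"
  shows "num_squares T = (\<Sum>i<n. length (padded_rows T i))"
    and "m_infty T = (\<Sum>i<n. length (padded_rows T i) - length (filter (\<lambda>x. x \<noteq> Infty) (padded_rows T i)))"
proof -
  have pad: "(\<Sum>i<length T. h (T ! i)) = (\<Sum>i<n. h (padded_rows T i))" if "h [] = 0" for h :: "letter list \<Rightarrow> nat"
  proof -
    have "(\<Sum>i<n. h (padded_rows T i)) = (\<Sum>i<length T. h (padded_rows T i))"
      by (rule sum.mono_neutral_right) (use assms that in \<open>auto simp: padded_rows_def\<close>)
    then show ?thesis by (simp add: padded_rows_def)
  qed
  have sl: "sum_list (map h T) = (\<Sum>i<length T. h (T ! i))" for h :: "letter list \<Rightarrow> nat"
    by (simp add: sum_list_sum_nth lessThan_atLeast0)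
  show "num_squares T = (\<Sum>i<n. length (padded_rows T i))"
    unfolding num_squares_def sl by (rule pad) simp
  have "m_infty T = sum_list (map (\<lambda>row. count_list row Infty) T)"
    unfolding m_infty_def by (induction T) auto
  also have "\<dots> = (\<Sum>i<n. count_list (padded_rows T i) Infty)"
    unfolding sl by (rule pad) simp
  finally show "m_infty T = (\<Sum>i<n. length (padded_rows T i) - length (filter (\<lambda>x. x \<noteq> Infty) (padded_rows T i)))"
    by (simp only: count_list_eq_length_filter_diff)
qed

text \<open>
  At most one \<open>\<infinity>\<close> in each row, and any number in a column: the squares with \<open>\<infinity>\<close> form a vertical strip,
  and every vertical strip occurs.
\<close>

lemma bij_betw_split_infinity:
  "bij_betw (\<lambda>f. (\<lambda>i. length (f i), \<lambda>i. filter (\<lambda>x. x \<noteq> Infty) (f i))) (padded_tableaux n r)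
     (SIGMA \<nu>:partitions n r. \<Union>\<mu>\<in>vertical_strips n \<nu>. fillings (symplectic_letters n) \<mu>)"
proof (rule bij_betw_byWitness[where f' = "\<lambda>(\<nu>, g) i. g i @ replicate (\<nu> i - length (g i)) Infty"])
  let ?A = "symplectic_letters n"
  have alphabet: "alphabet n = insert Infty ?A" by (auto simp: alphabet_def symplectic_letters_def)
  have less: "x < Infty" if "x \<in> ?A" for x using that by (auto simp: symplectic_letters_def)
  have le_Infty: "x \<le> Infty" for x :: letter by (cases x) (auto simp: less_eq_letter_def)
  have notin: "Infty \<notin> ?A" by (auto simp: symplectic_letters_def)
  have fwd: "f i = filter (\<lambda>x. x \<noteq> Infty) (f i) @ replicate (length (f i) - length (filter (\<lambda>x. x \<noteq> Infty) (f i))) Infty"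
    if "f \<in> padded_tableaux n r" for f i
    by (rule sorted_split_off_max) (use that le_Infty in \<open>auto simp: padded_tableaux_def\<close>)
  show "\<forall>f\<in>padded_tableaux n r. (\<lambda>(\<nu>, g) i. g i @ replicate (\<nu> i - length (g i)) Infty)
       (\<lambda>i. length (f i), \<lambda>i. filter (\<lambda>x. x \<noteq> Infty) (f i)) = f"
    unfolding prod.case using fwd[symmetric] by blast
  show "\<forall>x\<in>(SIGMA \<nu>:partitions n r. \<Union>\<mu>\<in>vertical_strips n \<nu>. fillings ?A \<mu>).
      (\<lambda>f. (\<lambda>i. length (f i), \<lambda>i. filter (\<lambda>x. x \<noteq> Infty) (f i)))
        ((\<lambda>(\<nu>, g) i. g i @ replicate (\<nu> i - length (g i)) Infty) x) = x"
  proof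
    fix x assume "x \<in> (SIGMA \<nu>:partitions n r. \<Union>\<mu>\<in>vertical_strips n \<nu>. fillings ?A \<mu>)"
    then obtain \<nu> \<mu> g where x: "x = (\<nu>, g)" and nu: "\<nu> \<in> partitions n r"
      and mu: "\<mu> \<in> vertical_strips n \<nu>" and g: "g \<in> fillings ?A \<mu>" by auto
    have len: "length (g i) = \<mu> i" and sub: "set (g i) \<subseteq> ?A" for i using g by (auto simp: fillings_def)
    have "\<mu> i \<le> \<nu> i" for i using vertical_stripsD(2,3)[OF mu, of i] by (cases "i < n") auto
    then have "length (g i @ replicate (\<nu> i - length (g i)) Infty) = \<nu> i" for i by (simp add: len)
    moreover have "filter (\<lambda>x. x \<noteq> Infty) (g i @ replicate (\<nu> i - length (g i)) Infty) = g i" for i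
      by (rule filter_append_replicate) (use sub[of i] notin in blast)
    ultimately show "(\<lambda>f. (\<lambda>i. length (f i), \<lambda>i. filter (\<lambda>x. x \<noteq> Infty) (f i)))
        ((\<lambda>(\<nu>, g) i. g i @ replicate (\<nu> i - length (g i)) Infty) x) = x"
      unfolding x prod.case by (simp only:)
  qed
  show "(\<lambda>f. (\<lambda>i. length (f i), \<lambda>i. filter (\<lambda>x. x \<noteq> Infty) (f i))) ` padded_tableaux n r \<subseteq>
      (SIGMA \<nu>:partitions n r. \<Union>\<mu>\<in>vertical_strips n \<nu>. fillings ?A \<mu>)"
  proof safe
    fix f assume f: "f \<in> padded_tableaux n r"
    then show part: "(\<lambda>i. length (f i)) \<in> partitions n r" by (simp add: padded_tableaux_def)
    define \<nu> where "\<nu> = (\<lambda>i. length (f i))"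
    define g where "g = (\<lambda>i. filter (\<lambda>x. x \<noteq> Infty) (f i))"
    define \<mu> where "\<mu> = (\<lambda>i. length (g i))"
    have dec: "\<nu> (Suc i) \<le> \<nu> i" for i using part by (simp add: partitions_def \<nu>_def)
    have zero: "\<nu> i = 0" if "n \<le> i" for i using part that by (simp add: partitions_def \<nu>_def)
    have mu_le: "\<mu> i \<le> \<nu> i" for i unfolding \<mu>_def g_def \<nu>_def by (rule length_filter_le)
    have nu_le: "\<nu> i - 1 \<le> \<mu> i" for i
    proof -
      have "count_list (f i) Infty \<le> 1" using f by (simp add: padded_tableaux_def)
      then show ?thesis unfolding count_list_eq_length_filter_diff \<mu>_def g_def \<nu>_def by simp
    qed
    have nth: "f i ! j = (if j < \<mu> i then g i ! j else Infty)" if "j < \<nu> i" for i j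
    proof -
      have "f i = g i @ replicate (\<nu> i - length (g i)) Infty" using fwd[OF f, of i] unfolding g_def \<nu>_def .
      then have "f i ! j = (g i @ replicate (\<nu> i - length (g i)) Infty) ! j" by (rule arg_cong)
      then show ?thesis
        using replicate_tail_nth[of "g i" "\<nu> i" j Infty] mu_le[of i] that unfolding \<mu>_def by simp
    qed
    have g_ne: "g i ! j \<noteq> Infty" if "j < \<mu> i" for i j
    proof -
      have "g i ! j \<in> set (g i)" using that by (simp add: \<mu>_def)
      then show ?thesis by (simp add: g_def)
    qed
    have col: "f i ! j < f (Suc i) ! j \<or> f i ! j = Infty \<and> f (Suc i) ! j = Infty" if "j < \<nu> (Suc i)" for i j
      using f that by (simp add: padded_tableaux_def \<nu>_def)
    have mu_dec: "\<mu> (Suc i) \<le> \<mu> i" for i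
    proof (rule ccontr)
      assume "\<not> \<mu> (Suc i) \<le> \<mu> i"
      then have j: "\<mu> i < \<mu> (Suc i)" by simp
      then have "\<mu> i < \<nu> (Suc i)" using mu_le[of "Suc i"] by simp
      then have "f i ! \<mu> i = Infty" "f (Suc i) ! \<mu> i = g (Suc i) ! \<mu> i"
        using nth[of "\<mu> i" i] nth[of "\<mu> i" "Suc i"] dec[of i] j by auto
      then show False
        using col[OF \<open>\<mu> i < \<nu> (Suc i)\<close>] g_ne[OF j] le_Infty[of "g (Suc i) ! \<mu> i"] by auto
    qed
    have "\<mu> \<in> vertical_strips n \<nu>"
      using mu_le nu_le mu_dec zero mu_le by (auto simp: vertical_strips_def box_def) (metis le_zero_eq)
    moreover have "g \<in> fillings ?A \<mu>"
    proof -
      have "g i ! j < g (Suc i) ! j" if "j < \<mu> (Suc i)" for i j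
        using col[of j i] nth[of j i] nth[of j "Suc i"] that mu_le[of "Suc i"] mu_dec[of i] dec[of i]
          g_ne[of j "Suc i"] by auto
      then show ?thesis using f alphabet
        by (auto simp: fillings_def g_def \<mu>_def sorted_wrt_filter padded_tableaux_def)
    qed
    ultimately show "(\<lambda>i. filter (\<lambda>x. x \<noteq> Infty) (f i)) \<in>
        (\<Union>\<mu>\<in>vertical_strips n (\<lambda>i. length (f i)). fillings ?A \<mu>)"
      unfolding g_def \<nu>_def by blast
  qed
  show "(\<lambda>(\<nu>, g) i. g i @ replicate (\<nu> i - length (g i)) Infty) `
      (SIGMA \<nu>:partitions n r. \<Union>\<mu>\<in>vertical_strips n \<nu>. fillings ?A \<mu>) \<subseteq> padded_tableaux n r"
  proof safe
    fix \<nu> g \<mu> assume nu: "\<nu> \<in> partitions n r" and mu: "\<mu> \<in> vertical_strips n \<nu>" and g: "g \<in> fillings ?A \<mu>"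
    let ?f = "\<lambda>i. g i @ replicate (\<nu> i - length (g i)) Infty"
    have len: "length (g i) = \<mu> i" and sub: "set (g i) \<subseteq> ?A" for i using g by (auto simp: fillings_def)
    have mu_le: "\<mu> i \<le> \<nu> i" for i using vertical_stripsD(2,3)[OF mu, of i] by (cases "i < n") auto
    have nu_le: "\<nu> i \<le> Suc (\<mu> i)" for i
      using vertical_stripsD(1)[OF mu, of i] nu by (cases "i < n") (auto simp: partitions_def)
    have dec: "\<nu> (Suc i) \<le> \<nu> i" for i using nu by (simp add: partitions_def)
    have mem: "g i ! j < Infty" if "j < \<mu> i" for i j
    proof -
      have "g i ! j \<in> set (g i)" using that len[of i] by simp
      then show ?thesis using sub less by blast
    qed
    have len_f: "length (?f i) = \<nu> i" for i using mu_le[of i] by (simp add: len)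
    have nth: "?f i ! j = (if j < \<mu> i then g i ! j else Infty)" if "j < \<nu> i" for i j
      using replicate_tail_nth[of "g i" "\<nu> i" j Infty] that mu_le[of i] len[of i] by simp
    have "?f i ! j < ?f (Suc i) ! j \<or> ?f i ! j = Infty \<and> ?f (Suc i) ! j = Infty" if "j < \<nu> (Suc i)" for i j
    proof -
      have "j < \<nu> i" using that dec[of i] by simp
      moreover have "g i ! j < g (Suc i) ! j" if "j < \<mu> (Suc i)" using g that by (simp add: fillings_def)
      ultimately show ?thesis
        unfolding nth[OF that] nth[OF \<open>j < \<nu> i\<close>]
        using mem[of j i] vertical_stripsD(4)[OF mu, of i] by auto
    qed
    moreover have "sorted (?f i)" for i
      using g le_Infty by (auto simp: fillings_def sorted_append)
    moreover have "Unbarred (Suc i) \<le> x" if "x \<in> set (?f i)" for x i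
      using that g by (auto simp: fillings_def less_eq_letter_def split: if_splits)
    moreover have "set (?f i) \<subseteq> alphabet n" for i
      using sub[of i] alphabet by auto
    moreover have "count_list (?f i) Infty \<le> 1" for i
    proof -
      have "filter (\<lambda>x. x \<noteq> Infty) (?f i) = g i"
        by (rule filter_append_replicate) (use sub[of i] notin in blast)
      then show ?thesis unfolding count_list_eq_length_filter_diff len_f using len[of i] nu_le[of i] by simp
    qed
    ultimately show "?f \<in> padded_tableaux n r"
      using nu by (simp add: padded_tableaux_def len_f[simplified])
  qed
qed

lemma sum_sundaram_tableaux:
  fixes X :: "nat \<Rightarrow> nat \<Rightarrow> real"
  shows "(\<Sum>T\<in>sundaram_tableaux n n r. X (num_squares T) (m_infty T)) =
    (\<Sum>\<nu>\<in>partitions n r. \<Sum>\<mu>\<in>vertical_strips n \<nu>.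
       X (\<Sum>i<n. \<nu> i) (\<Sum>i<n. \<nu> i - \<mu> i) * real (card (fillings (symplectic_letters n) \<mu>)))"
proof -
  let ?A = "symplectic_letters n"
  let ?split = "\<lambda>f. (\<lambda>i. length (f i), \<lambda>i. filter (\<lambda>x. x \<noteq> Infty) (f i :: letter list))"
  let ?Y = "\<lambda>(\<nu>, g). X (\<Sum>i<n. \<nu> i) (\<Sum>i<n. \<nu> i - length (g i :: letter list))"
  let ?S = "\<lambda>\<nu>. \<Union>\<mu>\<in>vertical_strips n \<nu>. fillings ?A \<mu>"
  have fin: "finite (fillings ?A \<mu>)" if "\<mu> \<in> vertical_strips n \<nu>" for \<mu> \<nu>
    using card_fillings_symplectic[of \<mu> n] vertical_stripsD[OF that] by blast
  have "(\<Sum>T\<in>sundaram_tableaux n n r. X (num_squares T) (m_infty T)) =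
        (\<Sum>T\<in>sundaram_tableaux n n r. ?Y (?split (padded_rows T)))"
    by (rule sum.cong) (auto simp: statistics_padded_rows[of _ n] sundaram_tableaux_def height_def)
  also have "\<dots> = (\<Sum>f\<in>padded_tableaux n r. ?Y (?split f))"
    by (rule sum.reindex_bij_betw[OF bij_betw_padded_rows])
  also have "\<dots> = (\<Sum>x\<in>Sigma (partitions n r) ?S. ?Y x)"
    by (rule sum.reindex_bij_betw[OF bij_betw_split_infinity])
  also have "\<dots> = (\<Sum>\<nu>\<in>partitions n r. \<Sum>g\<in>?S \<nu>. ?Y (\<nu>, g))"
    by (subst sum.Sigma) (use fin in auto)
  also have "\<dots> = (\<Sum>\<nu>\<in>partitions n r. \<Sum>\<mu>\<in>vertical_strips n \<nu>. \<Sum>g\<in>fillings ?A \<mu>. ?Y (\<nu>, g))"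
    by (intro sum.cong refl sum.UNION_disjoint) (use fin disjoint_fillings in auto)
  also have "\<dots> = (\<Sum>\<nu>\<in>partitions n r. \<Sum>\<mu>\<in>vertical_strips n \<nu>.
       X (\<Sum>i<n. \<nu> i) (\<Sum>i<n. \<nu> i - \<mu> i) * real (card (fillings ?A \<mu>)))"
  proof (intro sum.cong refl)
    fix \<nu> \<mu>
    have "(\<Sum>g\<in>fillings ?A \<mu>. ?Y (\<nu>, g)) = (\<Sum>g\<in>fillings ?A \<mu>. X (\<Sum>i<n. \<nu> i) (\<Sum>i<n. \<nu> i - \<mu> i))"
      by (rule sum.cong) (auto simp: fillings_def)
    then show "(\<Sum>g\<in>fillings ?A \<mu>. ?Y (\<nu>, g)) = X (\<Sum>i<n. \<nu> i) (\<Sum>i<n. \<nu> i - \<mu> i) * real (card (fillings ?A \<mu>))"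
      by simp
  qed
  finally show ?thesis .
qed

text \<open>
  The number of patterns equals the quotient of odd alternants, so that both quotients contribute
  the same product over \<open>i < j\<close>; its square and the diagonal factors give the product over all \<open>i\<close> and \<open>j\<close>.
\<close>

lemma sum_partitions_strips:
  assumes te: "t = 1 \<and> e = 1 \<or> t = -1 \<and> e = 0"
  shows "(\<Sum>\<nu>\<in>partitions n r. \<Sum>\<mu>\<in>vertical_strips n \<nu>.
      t ^ (\<Sum>i<n. \<nu> i - \<mu> i) * real (card (fillings (symplectic_letters n) \<mu>))) =
    (\<Prod>i=1..n. (2 * real i + real r - 1) / (2 * real i - 1)) ^ e *
    (\<Prod>i=1..n. \<Prod>j=1..n. (real i + real j + real r - 1) / (real i + real j - 1))"
proof -
  let ?\<rho> = "\<lambda>i. real (n - 1 - i) + 1 / 2" and ?b = "\<lambda>i. real (n - 1 - i) + 1 / 2 + real r / 2"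
  let ?D = "\<Prod>i=1..n. (2 * real i + real r - 1) / (2 * real i - 1)"
  let ?P = "\<Prod>j=1..n. \<Prod>i=Suc j..n. (real i + real j + real r - 1) / (real i + real j - 1)"
  let ?A = "bounded_sum n r (\<lambda>_. 1)"
  have nz: "parity_alternant n e ?\<rho> \<noteq> 0" "parity_alternant n 1 ?\<rho> \<noteq> 0"
    using sum_vertical_strips_card(1)[OF te, of "\<lambda>_. 0" n r]
      sum_vertical_strips_card(1)[of 1 1 "\<lambda>_. 0" n r] by (simp_all add: partitions_def)
  have e: "e \<le> 1" using te by auto
  have "?A * parity_alternant n 1 ?\<rho> = parity_alternant n 1 ?b"
    using sum_partitions_parity_alternant[where e = 1 and n = n and r = r and c = "1 / 2 - real r / 2"] sum_partitions_odd_alternant[of n r]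
    by (simp add: add.assoc)
  then have A: "?A = ?D * ?P"
    using parity_alternant_ratio[OF nz(2), of r] nz(2) by (simp add: field_simps)
  have "(\<Sum>\<nu>\<in>partitions n r. \<Sum>\<mu>\<in>vertical_strips n \<nu>.
      t ^ (\<Sum>i<n. \<nu> i - \<mu> i) * real (card (fillings (symplectic_letters n) \<mu>))) =
    (\<Sum>\<nu>\<in>partitions n r. parity_alternant n e (\<lambda>i. real (\<nu> i) + real (n - 1 - i) + 1 / 2)) / parity_alternant n e ?\<rho>"
    unfolding sum_divide_distrib by (rule sum.cong[OF refl], rule sum_vertical_strips_card(2)[OF te])
  also have "\<dots> = ?A * (parity_alternant n e ?b / parity_alternant n e ?\<rho>)"
    unfolding sum_partitions_parity_alternant[OF e] by simp
  also have "\<dots> = ?D ^ e * (?D * ?P\<^sup>2)"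
    unfolding parity_alternant_ratio[OF nz(1)] A by (simp add: power2_eq_square mult_ac)
  also have "?D * ?P\<^sup>2 = (\<Prod>i=1..n. \<Prod>j=1..n. (real i + real j + real r - 1) / (real i + real j - 1))"
  proof -
    have diagonal: "(\<Prod>i=1..n. (real i + real i + real r - 1) / (real i + real i - 1)) = ?D"
      by (simp only: mult_2)
    show ?thesis unfolding diagonal[symmetric]
      by (rule prod_square_symmetric[symmetric]) (simp only: add.commute)
  qed
  finally show ?thesis .
qed

theorem theorem1p2:
  fixes n r :: nat
  assumes "n \<ge> 1"
  shows "real (card (sundaram_tableaux n n r)) =
           (\<Prod>i=1..n. (2 * real i + real r - 1) / (2 * real i - 1)) *
           (\<Prod>i=1..n. \<Prod>j=1..n. (real i + real j + real r - 1) / (real i + real j - 1))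
       \<and> (\<Sum>T\<in>sundaram_tableaux n n r. (-1 :: real) ^ num_squares T) =
           (-1) ^ (r * n) *
           (\<Prod>i=1..n. \<Prod>j=1..n. (real i + real j + real r - 1) / (real i + real j - 1))
       \<and> (\<Sum>T\<in>sundaram_tableaux n n r. (-1 :: real) ^ m_infty T) =
           (\<Prod>i=1..n. \<Prod>j=1..n. (real i + real j + real r - 1) / (real i + real j - 1))"
proof (intro conjI)
  let ?c = "\<lambda>\<mu>. real (card (fillings (symplectic_letters n) \<mu>))"
  let ?D = "\<Prod>i=1..n. (2 * real i + real r - 1) / (2 * real i - 1)"
  let ?Q = "\<Prod>i=1..n. \<Prod>j=1..n. (real i + real j + real r - 1) / (real i + real j - 1)"
  have plus: "(\<Sum>\<nu>\<in>partitions n r. \<Sum>\<mu>\<in>vertical_strips n \<nu>. 1 ^ (\<Sum>i<n. \<nu> i - \<mu> i) * ?c \<mu>) = ?D ^ 1 * ?Q"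
    by (rule sum_partitions_strips) simp
  have minus: "(\<Sum>\<nu>\<in>partitions n r. \<Sum>\<mu>\<in>vertical_strips n \<nu>. (-1) ^ (\<Sum>i<n. \<nu> i - \<mu> i) * ?c \<mu>) = ?D ^ 0 * ?Q"
    by (rule sum_partitions_strips) simp
  have "real (card (sundaram_tableaux n n r)) = (\<Sum>T\<in>sundaram_tableaux n n r. 1 ^ m_infty T)"
    by simp
  also have "\<dots> = ?D * ?Q"
    unfolding sum_sundaram_tableaux[of "\<lambda>_ m. 1 ^ m"] plus by (simp only: power_one_right)
  finally show "real (card (sundaram_tableaux n n r)) = ?D * ?Q" .
  show "(\<Sum>T\<in>sundaram_tableaux n n r. (-1 :: real) ^ m_infty T) = ?Q"
    unfolding sum_sundaram_tableaux[of "\<lambda>_ m. (-1) ^ m"] minus by (simp only: power_0 mult_1)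
  show "(\<Sum>T\<in>sundaram_tableaux n n r. (-1 :: real) ^ num_squares T) = (-1) ^ (r * n) * ?Q"
    unfolding sum_sundaram_tableaux[of "\<lambda>s _. (-1) ^ s"] sum_neg_one_power_strips minus
    by (simp only: power_0 mult_1)
qed

end
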